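(* Let $0<p,q<\infty$, $\alpha>-1$, and let $s,t$ be real numbers. Let $\mu$ be a positive Borel measure on $\mathbb{B}_n$. Then: (1) the embedding operator $i:A^p_\alpha(\mathbb{B}_n)\to T^q_{s,t}(\mathbb{B}_n,\mu)$ is bounded if and only if $$\sup_{a\in\mathbb{B}_n}\frac{\mu(D(a,R))}{(1-|a|^2)^{s+(n+1+\alpha)q/p}\left(\log\frac{2}{1-|a|^2}\right)^{t}}<\infty$$ for some (or any) $R>0$. Furthermore, $$\|i\|^q_{A^p_\alpha(\mathbb{B}_n)\to T^q_{s,t}(\mathbb{B}_n,\mu)}\asymp\sup_{a\in\mathbb{B}_n}\frac{\mu(D(a,R))}{(1-|a|^2)^{s+(n+1+\alpha)q/p}\left(\log\frac{2}{1-|a|^2}\right)^{t}}.$$ (2) the embedding operator $i:A^p_\alpha(\mathbb{B}_n)\to T^q_{s,t}(\mathbb{B}_n,\mu)$ is compact if and only if $$\lim_{|a|\to1}\frac{\mu(D(a,R))}{(1-|a|^2)^{s+(n+1+\alpha)q/p}\left(\log\frac{2}{1-|a|^2}\right)^{t}}=0$$ for some (or any) $R>0$.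
   Context: $\mathbb{B}_n$ is the open unit ball of $\mathbb{C}^n$ ($n\ge1$), $H(\mathbb{B}_n)$ the space of holomorphic functions on $\mathbb{B}_n$, $dv$ normalized volume measure. Weighted Bergman space: for $0<p<\infty$, $\alpha>-1$, $A^p_\alpha(\mathbb{B}_n)$ is the space of $f\in H(\mathbb{B}_n)$ with $\|f\|_{A^p_\alpha}=\left(\int_{\mathbb{B}_n}|f|^p\,dv_\alpha\right)^{1/p}<\infty$, where $dv_\alpha(z)=c_\alpha(1-|z|^2)^\alpha dv(z)$ and $c_\alpha>0$ is chosen so that $v_\alpha(\mathbb{B}_n)=1$. Bergman metric balls: $D(a,R)=\{w\in\mathbb{B}_n:\beta(a,w)<R\}$, where $\beta(z,w)=\frac12\log\frac{1+|\varphi_z(w)|}{1-|\varphi_z(w)|}$ and $\varphi_z$ is the involutive automorphism of $\mathbb{B}_n$ interchanging $0$ and $z$. Logarithmic tent space: for $0<q<\infty$, real $s,t$, and a fixed $R>0$, $T^q_{s,t}(\mathbb{B}_n,\mu)=T^q_{s,t,R}(\mathbb{B}_n,\mu)$ is the set of $\mu$-measurable functions $f$ on $\mathbb{B}_n$ with $$\|f\|^q_{T^q_{s,t,R}(\mathbb{B}_n,\mu)}=\sup_{a\in\mathbb{B}_n}\frac{\int_{D(a,R)}|f(z)|^q\,d\mu(z)}{(1-|a|^2)^s\left(\log\frac{2}{1-|a|}\right)^t}<\infty;$$ the space does not depend on $R$. The operator $i$ is the inclusion $f\mapsto f$; it is bounded if it maps the source into the target with $\|f\|_{T^q_{s,t}(\mathbb{B}_n,\mu)}\le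 C\|f\|_{A^p_\alpha}$, and $\|i\|$ is the smallest such $C$. A bounded linear operator $T:A^p_\alpha(\mathbb{B}_n)\to T^q_{s,t}(\mathbb{B}_n,\mu)$ is called compact if $\|Tf_k\|_{T^q_{s,t}(\mathbb{B}_n,\mu)}\to0$ for every bounded sequence $\{f_k\}$ in $A^p_\alpha(\mathbb{B}_n)$ that converges to $0$ uniformly on compact subsets of $\mathbb{B}_n$. "For some (or any) $R>0$" means the equivalence holds with either quantifier. $A\asymp B$ means $C^{-1}B\le A\le CB$ with a constant $C>0$ independent of $\mu$ (it may depend on the parameters and on $R$).
   Formalization: In part (2) the measure μ is additionally assumed finite on compact subsets of the ball; without this (2) fails, e.g. for μ = ∞·δ_0, where the limit is 0 but the embedding is not even bounded. *)

theory Defs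
  imports "HOL-Analysis.Analysis"
begin

section \<open>Holomorphic functions on the unit ball\<close>

abbreviation unit_ball :: "(complex ^ 'n) set"
  where "unit_ball \<equiv> ball 0 1"

text \<open>Functions on the ball are total functions of which only the values on the ball matter.
  Holomorphy in several variables is Frechet differentiability with a complex-linear derivative.\<close>

definition holomorphic_ball :: "(complex ^ 'n \<Rightarrow> complex) \<Rightarrow> bool"
  where "holomorphic_ball f \<longleftrightarrow>
    (\<forall>z\<in>unit_ball. \<exists>f'. (f has_derivative f') (at z) \<and> (\<forall>c v. f' (c *s v) = c * f' v))"

section \<open>Weighted Bergman spaces\<close>

text \<open>The measures live on the ball itself (not on the whole space), so that measurability of
  a function does not depend on its irrelevant values outside the ball.\<close>

definition vol_ball :: "(complex ^ 'n) measure"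
  where "vol_ball = uniform_measure (restrict_space lborel unit_ball) unit_ball"

definition bergman_const :: "'n :: finite itself \<Rightarrow> real \<Rightarrow> real"
  where "bergman_const _ \<alpha> =
    1 / (\<integral>z. (1 - (norm z)\<^sup>2) powr \<alpha> \<partial>(vol_ball :: (complex ^ 'n) measure))"

definition vol_weighted :: "real \<Rightarrow> (complex ^ 'n) measure"
  where "vol_weighted \<alpha> =
    density vol_ball (\<lambda>z. ennreal (bergman_const TYPE('n) \<alpha> * (1 - (norm z)\<^sup>2) powr \<alpha>))"

definition bergman_space :: "real \<Rightarrow> real \<Rightarrow> (complex ^ 'n \<Rightarrow> complex) set"
  where "bergman_space p \<alpha> =
    {f. holomorphic_ball f \<and> integrable (vol_weighted \<alpha>) (\<lambda>z. norm (f z) powr p)}"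

definition bergman_norm :: "real \<Rightarrow> real \<Rightarrow> (complex ^ 'n \<Rightarrow> complex) \<Rightarrow> real"
  where "bergman_norm p \<alpha> f = (\<integral>z. norm (f z) powr p \<partial>(vol_weighted \<alpha>)) powr (1 / p)"

section \<open>The Bergman metric\<close>

definition cdot :: "complex ^ 'n \<Rightarrow> complex ^ 'n \<Rightarrow> complex"
  where "cdot z w = (\<Sum>k\<in>UNIV. z $ k * cnj (w $ k))"

text \<open>Orthogonal projection onto the complex line through \<open>a\<close>; it is \<open>0\<close> for \<open>a = 0\<close>,
  because division by zero gives zero.\<close>

definition line_proj :: "complex ^ 'n \<Rightarrow> complex ^ 'n \<Rightarrow> complex ^ 'n"
  where "line_proj a z = (cdot z a / cdot a a) *s a"

text \<open>The standard involutive automorphism of the ball interchanging \<open>0\<close> and \<open>a\<close>; see the lemmas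
  \<open>mobius_0\<close>, \<open>mobius_self\<close>, \<open>mobius_in_ball\<close>, \<open>mobius_involution\<close> and
  \<open>holomorphic_mobius\<close> below. In particular, \<open>mobius 0 z = - z\<close>.\<close>

definition mobius :: "complex ^ 'n \<Rightarrow> complex ^ 'n \<Rightarrow> complex ^ 'n"
  where "mobius a z = (1 / (1 - cdot z a)) *s
    (a - line_proj a z - of_real (sqrt (1 - (norm a)\<^sup>2)) *s (z - line_proj a z))"

definition bergman_dist :: "complex ^ 'n \<Rightarrow> complex ^ 'n \<Rightarrow> real"
  where "bergman_dist z w = 1 / 2 * ln ((1 + norm (mobius z w)) / (1 - norm (mobius z w)))"

definition bergman_ball :: "complex ^ 'n \<Rightarrow> real \<Rightarrow> (complex ^ 'n) set"
  where "bergman_ball a R = {w \<in> unit_ball. bergman_dist a w < R}"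

section \<open>Logarithmic tent spaces\<close>

text \<open>\<open>borel_measure_ball \<mu>\<close> also forces the space of \<open>\<mu>\<close> to be the ball; no finiteness of \<open>\<mu>\<close>
  is required.\<close>

definition borel_measure_ball :: "(complex ^ 'n) measure \<Rightarrow> bool"
  where "borel_measure_ball \<mu> \<longleftrightarrow> sets \<mu> = sets (restrict_space borel unit_ball)"

definition locally_finite_ball :: "(complex ^ 'n) measure \<Rightarrow> bool"
  where "locally_finite_ball \<mu> \<longleftrightarrow> (\<forall>K. compact K \<and> K \<subseteq> unit_ball \<longrightarrow> emeasure \<mu> K < \<infinity>)"

text \<open>The \<open>q\<close>-th power of the tent space quasinorm, possibly infinite.\<close>

definition tent_sup ::
  "real \<Rightarrow> real \<Rightarrow> real \<Rightarrow> real \<Rightarrow> (complex ^ 'n) measure \<Rightarrow> (complex ^ 'n \<Rightarrow> complex) \<Rightarrow> ennreal"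
  where "tent_sup q s t R \<mu> f =
    (SUP a\<in>unit_ball. (\<integral>\<^sup>+z\<in>bergman_ball a R. ennreal (norm (f z) powr q) \<partial>\<mu>) /
      ennreal ((1 - (norm a)\<^sup>2) powr s * ln (2 / (1 - norm a)) powr t))"

definition tent_space ::
  "real \<Rightarrow> real \<Rightarrow> real \<Rightarrow> real \<Rightarrow> (complex ^ 'n) measure \<Rightarrow> (complex ^ 'n \<Rightarrow> complex) set"
  where "tent_space q s t R \<mu> = {f \<in> borel_measurable \<mu>. tent_sup q s t R \<mu> f < \<infinity>}"

definition tent_norm ::
  "real \<Rightarrow> real \<Rightarrow> real \<Rightarrow> real \<Rightarrow> (complex ^ 'n) measure \<Rightarrow> (complex ^ 'n \<Rightarrow> complex) \<Rightarrow> real"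
  where "tent_norm q s t R \<mu> f = enn2real (tent_sup q s t R \<mu> f) powr (1 / q)"

section \<open>The embedding operator\<close>

definition embedding_bound :: "real \<Rightarrow> real \<Rightarrow> real \<Rightarrow> real \<Rightarrow> real \<Rightarrow> real \<Rightarrow>
    (complex ^ 'n) measure \<Rightarrow> real \<Rightarrow> bool"
  where "embedding_bound p \<alpha> q s t R \<mu> C \<longleftrightarrow> 0 \<le> C \<and>
    (\<forall>f\<in>bergman_space p \<alpha>. f \<in> tent_space q s t R \<mu> \<and>
      tent_norm q s t R \<mu> f \<le> C * bergman_norm p \<alpha> f)"

definition embedding_bounded :: "real \<Rightarrow> real \<Rightarrow> real \<Rightarrow> real \<Rightarrow> real \<Rightarrow> real \<Rightarrow>
    (complex ^ 'n) measure \<Rightarrow> bool"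
  where "embedding_bounded p \<alpha> q s t R \<mu> \<longleftrightarrow> (\<exists>C. embedding_bound p \<alpha> q s t R \<mu> C)"

text \<open>Only meaningful for bounded embeddings; the infimum is then attained.\<close>

definition embedding_norm :: "real \<Rightarrow> real \<Rightarrow> real \<Rightarrow> real \<Rightarrow> real \<Rightarrow> real \<Rightarrow>
    (complex ^ 'n) measure \<Rightarrow> real"
  where "embedding_norm p \<alpha> q s t R \<mu> = Inf {C. embedding_bound p \<alpha> q s t R \<mu> C}"

definition embedding_compact :: "real \<Rightarrow> real \<Rightarrow> real \<Rightarrow> real \<Rightarrow> real \<Rightarrow> real \<Rightarrow>
    (complex ^ 'n) measure \<Rightarrow> bool"
  where "embedding_compact p \<alpha> q s t R \<mu> \<longleftrightarrow> embedding_bounded p \<alpha> q s t R \<mu> \<and>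
    (\<forall>f :: nat \<Rightarrow> complex ^ 'n \<Rightarrow> complex.
      (\<forall>k. f k \<in> bergman_space p \<alpha>) \<and>
      (\<exists>M. \<forall>k. bergman_norm p \<alpha> (f k) \<le> M) \<and>
      (\<forall>K. compact K \<and> K \<subseteq> unit_ball \<longrightarrow> uniform_limit K f (\<lambda>_. 0) sequentially) \<longrightarrow>
      (\<lambda>k. tent_norm q s t R \<mu> (f k)) \<longlonglongrightarrow> 0)"

definition carleson_ratio :: "real \<Rightarrow> real \<Rightarrow> real \<Rightarrow> real \<Rightarrow> real \<Rightarrow>
    (complex ^ 'n) measure \<Rightarrow> real \<Rightarrow> complex ^ 'n \<Rightarrow> ennreal"
  where "carleson_ratio p \<alpha> q s t \<mu> R a = emeasure \<mu> (bergman_ball a R) /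
    ennreal ((1 - (norm a)\<^sup>2) powr (s + (real CARD('n) + 1 + \<alpha>) * q / p) *
      ln (2 / (1 - (norm a)\<^sup>2)) powr t)"

section \<open>Basic properties of the involutions\<close>

lemma cdot_simps:
  "cdot (x + y) z = cdot x z + cdot y z" "cdot (x - y) z = cdot x z - cdot y z"
  "cdot z (x + y) = cdot z x + cdot z y" "cdot z (x - y) = cdot z x - cdot z y"
  "cdot (c *s x) z = c * cdot x z" "cdot z (c *s x) = cnj c * cdot z x"
  "cdot 0 z = 0" "cdot z 0 = 0"
  by (simp_all add: cdot_def sum.distrib sum_subtractf sum_distrib_left algebra_simps)

lemma cnj_cdot: "cnj (cdot z w) = cdot w z"
  by (simp add: cdot_def mult.commute)

lemma cdot_self: "cdot z z = of_real ((norm z)\<^sup>2)"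
  by (simp add: cdot_def norm_vec_def L2_set_def sum_nonneg flip: complex_norm_square)

lemma cdot_self_eq_0 [simp]: "cdot a a = 0 \<longleftrightarrow> a = 0"
  by (simp add: cdot_self)

lemma norm_cdot_le: "norm (cdot z w) \<le> norm z * norm w"
proof -
  have "norm (cdot z w) \<le> (\<Sum>k\<in>UNIV. \<bar>norm (z $ k)\<bar> * \<bar>norm (w $ k)\<bar>)"
    unfolding cdot_def by (rule order_trans[OF norm_sum]) (simp add: norm_mult)
  also have "\<dots> \<le> norm z * norm w"
    unfolding norm_vec_def by (rule L2_set_mult_ineq)
  finally show ?thesis .
qed

lemma one_minus_cdot_nonzero:
  assumes "norm a < 1" "norm z < 1"
  shows "1 - cdot z a \<noteq> 0"
proof
  assume "1 - cdot z a = 0"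
  then have "cdot z a = 1" by simp
  then have "1 \<le> norm z * norm a" using norm_cdot_le[of z a] by simp
  moreover have "norm z * norm a < 1 * 1"
    using assms by (intro mult_strict_mono') auto
  ultimately show False by simp
qed

lemma line_proj_cdot: "cdot (line_proj a z) a = cdot z a"
  by (cases "a = 0") (simp_all add: line_proj_def cdot_simps)

lemma mobius_0 [simp]: "mobius a 0 = a"
  by (simp add: mobius_def line_proj_def cdot_simps)

lemma mobius_self [simp]: "mobius a a = 0"
  by (cases "a = 0") (simp_all add: mobius_def line_proj_def cdot_simps)

lemma mobius_norm:
  assumes "norm a < 1" "norm z < 1"
  shows "1 - (norm (mobius a z))\<^sup>2 =
    (1 - (norm a)\<^sup>2) * (1 - (norm z)\<^sup>2) / (norm (1 - cdot z a))\<^sup>2"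
proof -
  define l where "l = cdot z a / cdot a a"
  define A where "A = cdot a a"
  define s where "s = complex_of_real (sqrt (1 - (norm a)\<^sup>2))"
  have "(norm a)\<^sup>2 \<le> 1" using assms by (simp add: power_le_one)
  then have s2: "s * s = 1 - A" "cnj s = s"
    by (simp_all add: s_def A_def cdot_self flip: of_real_mult)
  have za: "cdot z a = l * A" "cdot a z = cnj l * A"
    using cnj_cdot[of z a] cnj_cdot[of a a]
    by (cases "a = 0"; simp add: l_def A_def cdot_simps; fail)+
  define w where "w = a - l *s a - s *s (z - l *s a)"
  have "cdot w w = (1 - l) * cnj (1 - l) * A + s * s * (cdot z z - l * cnj l * A)"
    unfolding w_def by (simp add: cdot_simps s2(2) za A_def[symmetric]) (simp add: algebra_simps)
  then have "cdot w w = (1 - l) * cnj (1 - l) * A + (1 - A) * (cdot z z - l * cnj l * A)"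
    unfolding s2 .
  moreover have "cnj A = A" using cnj_cdot[of a a] by (simp add: A_def)
  ultimately have "(1 - l * A) * cnj (1 - l * A) - cdot w w = (1 - A) * (1 - cdot z z)"
    by (simp add: algebra_simps)
  then have "of_real ((norm (1 - cdot z a))\<^sup>2 - (norm w)\<^sup>2) =
      complex_of_real ((1 - (norm a)\<^sup>2) * (1 - (norm z)\<^sup>2))"
    using za(1) unfolding complex_norm_square[symmetric] A_def cdot_self by simp
  then have eq: "(norm (1 - cdot z a))\<^sup>2 - (norm w)\<^sup>2 = (1 - (norm a)\<^sup>2) * (1 - (norm z)\<^sup>2)"
    by (simp only: of_real_eq_iff)
  have "mobius a z = (1 / (1 - cdot z a)) *s w"
    by (simp add: mobius_def line_proj_def w_def l_def s_def)
  then have "cdot (mobius a z) (mobius a z) =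
      (1 / (1 - cdot z a)) * cnj (1 / (1 - cdot z a)) * cdot w w"
    by (simp add: cdot_simps)
  then have "of_real ((norm (mobius a z))\<^sup>2) =
      complex_of_real ((norm (1 / (1 - cdot z a)))\<^sup>2 * (norm w)\<^sup>2)"
    unfolding cdot_self complex_norm_square[symmetric] by simp
  then have "(norm (mobius a z))\<^sup>2 = (norm w)\<^sup>2 / (norm (1 - cdot z a))\<^sup>2"
    unfolding of_real_eq_iff by (simp add: norm_divide power_divide)
  with eq one_minus_cdot_nonzero[OF assms] show ?thesis
    by (simp add: field_simps)
qed

lemma mobius_in_ball:
  assumes "a \<in> unit_ball" "z \<in> unit_ball"
  shows "mobius a z \<in> unit_ball"
proof -
  have *: "norm a < 1" "norm z < 1" using assms by auto
  then have "(norm a)\<^sup>2 < 1" "(norm z)\<^sup>2 < 1" by (simp_all add: power_less_one_iff)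
  then have "0 < 1 - (norm (mobius a z))\<^sup>2"
    unfolding mobius_norm[OF *] using one_minus_cdot_nonzero[OF *] by simp
  then show ?thesis by (simp add: power_less_one_iff)
qed

lemma mobius_involution:
  assumes "a \<in> unit_ball" "z \<in> unit_ball"
  shows "mobius a (mobius a z) = z"
proof -
  have *: "norm a < 1" "norm z < 1" using assms by auto
  define s where "s = complex_of_real (sqrt (1 - (norm a)\<^sup>2))"
  define d where "d = 1 - cdot z a"
  define P where "P = line_proj a z"
  have "(norm a)\<^sup>2 < 1" using * by (simp add: power_less_one_iff)
  then have s2: "s * s = 1 - cdot a a" and s0: "s \<noteq> 0"
    by (simp_all add: s_def cdot_self flip: of_real_mult)
  have d0: "d \<noteq> 0" using one_minus_cdot_nonzero[OF *] by (simp add: d_def)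
  have m: "mobius a z = (1 / d) *s (a - P - s *s (z - P))"
    by (simp add: mobius_def d_def P_def s_def)
  have c: "cdot (mobius a z) a = (cdot a a - cdot z a) / d"
    by (simp add: m cdot_simps P_def line_proj_cdot diff_divide_distrib)
  have d': "1 - cdot (mobius a z) a = s * s / d"
    using d0 by (simp add: c s2 d_def field_simps)
  have P': "line_proj a (mobius a z) = (1 / d) *s (a - P)"
    unfolding line_proj_def c P_def
    by (cases "a = 0") (simp_all add: vec_eq_iff field_simps d0)
  have Pa: "cdot a a *s P = cdot z a *s a"
    by (cases "a = 0") (simp_all add: P_def line_proj_def vec_eq_iff)
  have Pk: "cdot a a * P $ k = cdot z a * a $ k" for k
    using arg_cong[OF Pa, of "\<lambda>v. v $ k"] by simp
  have "mobius a (mobius a z) = (d / (s * s)) *s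
      (a - (1 / d) *s (a - P) - s *s ((1 / d) *s (a - P - s *s (z - P)) - (1 / d) *s (a - P)))"
    unfolding mobius_def[of a "mobius a z"] d' P' s_def[symmetric] by (simp add: m)
  also have "\<dots> = z"
  proof -
    have "(d / (s * s)) * (a $ k - (1 / d) * (a $ k - P $ k) - s *
        ((1 / d) * (a $ k - P $ k - s * (z $ k - P $ k)) - (1 / d) * (a $ k - P $ k))) = z $ k" for k
    proof -
      have "d * a $ k - (a $ k - P $ k) = s * s * P $ k"
        unfolding s2 d_def using Pk[of k] by (simp add: algebra_simps)
      then show ?thesis using d0 s0 by (simp add: field_simps)
    qed
    then show ?thesis by (simp only: vec_eq_iff vector_minus_component vector_smult_component) simp
  qed
  finally show ?thesis .
qed

lemma has_derivative_cdot: "((\<lambda>z. cdot z a) has_derivative (\<lambda>v. cdot v a)) (at z)"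
  unfolding cdot_def
  by (intro has_derivative_sum has_derivative_mult_left
    bounded_linear_imp_has_derivative bounded_linear_vec_nth)

lemma holomorphic_mobius:
  fixes a :: "complex ^ 'n"
  assumes "a \<in> unit_ball"
  shows "holomorphic_ball (\<lambda>z. mobius a z $ k)"
  unfolding holomorphic_ball_def
proof
  fix z :: "complex ^ 'n"
  assume "z \<in> unit_ball"
  then have d0: "1 - cdot z a \<noteq> 0" using one_minus_cdot_nonzero assms by auto
  define s where "s = complex_of_real (sqrt (1 - (norm a)\<^sup>2))"
  define L where "L v = - (cdot v a / cdot a a * a $ k) -
    s * (v $ k - cdot v a / cdot a a * a $ k)" for v :: "complex ^ 'n"
  have m: "(\<lambda>z. mobius a z $ k) = (\<lambda>z. (a $ k + L z) / (1 - cdot z a))"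
    by (simp add: fun_eq_iff mobius_def line_proj_def L_def s_def divide_inverse algebra_simps)
  have L: "(L has_derivative L) (at z)"
    unfolding L_def divide_inverse
    by (intro has_derivative_minus has_derivative_diff has_derivative_mult_left
      has_derivative_mult_right has_derivative_cdot
      bounded_linear_imp_has_derivative bounded_linear_vec_nth)
  have L_scale: "L (c *s v) = c * L v" for c v
    by (simp add: L_def cdot_simps algebra_simps)
  let ?f' = "\<lambda>v. L v / (1 - cdot z a) + (a $ k + L z) * cdot v a / (1 - cdot z a)\<^sup>2"
  have "((\<lambda>z. (a $ k + L z) / (1 - cdot z a)) has_derivative ?f') (at z)"
    by (rule derivative_eq_intros has_derivative_cdot L d0 refl)+
      (use d0 in \<open>auto simp: fun_eq_iff field_simps power2_eq_square simp flip: add_divide_distrib\<close>)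
  moreover have "?f' (c *s v) = c * ?f' v" for c v
    by (simp add: L_scale cdot_simps algebra_simps add_divide_distrib)
  ultimately show "\<exists>f'. ((\<lambda>z. mobius a z $ k) has_derivative f') (at z) \<and>
      (\<forall>c v. f' (c *s v) = c * f' v)"
    unfolding m by blast
qed

end

theory Submission
  imports Defs "HOL-Complex_Analysis.Cauchy_Integral_Formula"
begin

text \<open>Let \<open>N = n + 1 + \<alpha>\<close> and \<open>\<delta>(a) = 1 - |a|\<^sup>2\<close>. Two facts about the Bergman space reduce everything to a
  comparison of \<open>\<mu>(D(a,R))\<close> with powers of \<open>\<delta>(a)\<close>.

  Upper bound: \<open>|f(a)|^p \<delta>(a)^N \<le> C \<parallel>f\<parallel>^p\<close>. A complex ellipsoid around \<open>a\<close>, with radius comparable to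
  \<open>\<delta>(a)\<close> in the direction of \<open>a\<close> and to the square root of \<open>\<delta>(a)\<close> in the orthogonal directions, has
  volume comparable to \<open>\<delta>(a)^(n+1)\<close> and lies where \<open>1 - |z|\<^sup>2\<close> is comparable to \<open>\<delta>(a)\<close>; on it \<open>|f|^p\<close> satisfies a
  submean inequality up to a constant.

  Lower bound: the functions \<open>\<delta>(a)^(b - N/p) (1 - \<langle>z,a\<rangle>)^(-b)\<close> with \<open>b p > N\<close> are bounded in the Bergman space
  (split the ball dyadically according to \<open>|1 - \<langle>z,a\<rangle>|\<close>), are at least \<open>c \<delta>(a)^(-N/p)\<close> in modulus on \<open>D(a,R)\<close>, and
  tend to \<open>0\<close> locally uniformly as \<open>|a| \<rightarrow> 1\<close>.

  Finally \<open>D(a,R)\<close> is covered by the images under the involution \<open>\<phi>\<^sub>a\<close> of a fixed finite cover of \<open>D(0,R)\<close> by balls of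
  radius \<open>R'\<close>, so the conditions do not depend on the radius.\<close>

text \<open>Cauchy's formula gives a submean inequality for |f| only; a real-variable argument
  carries it to |f|^p for every p > 0, at the price of a constant. Ellipsoids are forced by the
  exponent: a Euclidean ball around \<open>a\<close> inside the domain has volume of order at most
  \<delta>^(2n), which for n > 1 would give \<delta>^(2n + \<alpha>) in place of \<delta>^(n + 1 +
  \<alpha>). All comparisons are local: at each point \<open>a\<close>, the quotient in the tent
  norm is compared with the Carleson ratio at the same \<open>a\<close>, with constants independent
  of \<mu> and \<open>a\<close>. Taking suprema yields boundedness and the norm, letting |a| tend to
  1 yields compactness. The limit sees only points near the sphere, and local finiteness of \<mu>
  supplies the rest. The exponent \<open>b\<close> of the test functions is a natural number, so
  that no branch of a complex power has to be chosen.\<close>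

abbreviation defect :: "'a::real_normed_vector \<Rightarrow> real"
  where "defect z \<equiv> 1 - (norm z)\<^sup>2"

abbreviation weighted_lint :: "real \<Rightarrow> (complex ^ 'n \<Rightarrow> real) \<Rightarrow> ennreal"
  where "weighted_lint \<alpha> g \<equiv> \<integral>\<^sup>+z\<in>unit_ball. ennreal (g z * defect z powr \<alpha>) \<partial>lborel"

section \<open>Lebesgue measure under isometries and anisotropic dilations\<close>

lemma emeasure_lborel_ball_pos:
  "0 < r \<Longrightarrow> 0 < emeasure lborel (ball (z :: 'a::euclidean_space) r)"
  using open_not_negligible[of "ball z r"]
  by (auto simp: negligible_iff_null_sets null_sets_def zero_less_iff_neq_zero)

lemma measure_lborel_ball_pos: "0 < r \<Longrightarrow> 0 < measure lborel (ball (z :: 'a::euclidean_space) r)"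
  using emeasure_lborel_ball_finite[of z r] emeasure_lborel_ball_pos[of r z]
  by (simp add: measure_def enn2real_positive_iff less_top)

lemma nn_integral_lborel_translate:
  fixes g :: "'a::euclidean_space \<Rightarrow> ennreal"
  assumes [measurable]: "g \<in> borel_measurable borel"
  shows "(\<integral>\<^sup>+z. g (v + z) \<partial>lborel) = (\<integral>\<^sup>+z. g z \<partial>lborel)"
proof -
  have "(\<integral>\<^sup>+z. g z \<partial>lborel) = (\<integral>\<^sup>+z. g z \<partial>(distr lborel borel ((+) v)))"
    by (simp add: lborel_distr_plus)
  also have "\<dots> = (\<integral>\<^sup>+z. g (v + z) \<partial>lborel)" by (rule nn_integral_distr) measurable
  finally show ?thesis by simp
qed

text \<open>The image measure \<nu> is invariant under translations, because \<open>U\<close> is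
  onto and carries the translation by \<open>y'\<close> to the one by \<open>U y'\<close>. Such a
  measure is a multiple of Lebesgue measure, and the factor is 1 since \<open>U\<close> preserves
  the balls around 0.\<close>

lemma lborel_distr_isometry:
  fixes U :: "'a::euclidean_space \<Rightarrow> 'a"
  assumes lin: "linear U" and iso: "\<And>x. norm (U x) = norm x"
  shows "distr lborel borel U = lborel"
proof -
  define \<nu> where "\<nu> = distr lborel borel U"
  have U [measurable]: "U \<in> borel_measurable borel"
    using lin by (intro borel_measurable_continuous_onI linear_continuous_on)
      (simp add: linear_conv_bounded_linear)
  have sets_nu [measurable_cong, simp]: "sets \<nu> = sets borel" and space_nu [simp]: "space \<nu> = UNIV"
    by (simp_all add: \<nu>_def)
  have ball: "emeasure \<nu> (ball 0 r) = emeasure lborel (ball (0::'a) r)" for r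
  proof -
    have "U -` ball 0 r = ball 0 r" by (auto simp: iso)
    then show ?thesis by (simp add: \<nu>_def emeasure_distr)
  qed
  have "inj U" using lin iso
    by (metis linear_injective_0 norm_eq_zero)
  then have "surj U" using lin by (simp add: linear_injective_imp_surjective)
  have trans: "distr \<nu> borel ((+) y) = \<nu>" for y
  proof -
    obtain y' where y': "y = U y'" using \<open>surj U\<close> by blast
    have "distr \<nu> borel ((+) y) = distr lborel borel (\<lambda>x. y + U x)"
      by (simp add: \<nu>_def distr_distr o_def)
    also have "\<dots> = distr lborel borel (\<lambda>x. U (y' + x))"
      by (simp add: y' linear_add[OF lin])
    also have "\<dots> = distr (distr lborel borel ((+) y')) borel U"
      by (simp add: distr_distr o_def)
    also have "\<dots> = \<nu>" by (simp add: lborel_distr_plus \<nu>_def)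
    finally show ?thesis .
  qed
  interpret nu: sigma_finite_measure \<nu>
  proof
    show "\<exists>A. countable A \<and> A \<subseteq> sets \<nu> \<and> \<Union>A = space \<nu> \<and> (\<forall>a\<in>A. emeasure \<nu> a \<noteq> \<infinity>)"
    proof (intro exI[of _ "range (\<lambda>n::nat. ball 0 (real n))"] conjI ballI)
      show "\<Union> (range (\<lambda>n::nat. ball (0::'a) (real n))) = space \<nu>"
        by (auto simp: reals_Archimedean2)
      fix a assume "a \<in> range (\<lambda>n::nat. ball (0::'a) (real n))"
      then show "emeasure \<nu> a \<noteq> \<infinity>"
        using emeasure_bounded_finite[OF bounded_ball] by (auto simp: ball less_top)
    qed auto
  qed
  interpret P: pair_sigma_finite \<nu> lborel ..
  define B where "B = ball (0::'a) 1"
  have [measurable]: "B \<in> sets borel" by (simp add: B_def)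
  have ballB: "emeasure \<nu> B = emeasure lborel B" by (simp add: B_def ball)
  have "emeasure \<nu> A = emeasure lborel A" if A [measurable]: "A \<in> sets borel" for A
  proof -
    let ?b = "emeasure lborel B"
    \<comment> \<open>Uniqueness of the invariant measure by Fubini, applied to 1_A(x) 1_B(x + y).
      Integrating in \<open>y\<close> first gives \<nu>(A) times the volume of \<open>B\<close>;
      shifting \<open>x\<close> by \<open>y\<close> under \<nu> and then integrating in
      \<open>y\<close> gives the volume of \<open>A\<close> times \<nu>(B).\<close>
    have "emeasure \<nu> A * ?b = (\<integral>\<^sup>+x. indicator A x * ?b \<partial>\<nu>)"
      by (simp add: nn_integral_multc)
    also have "\<dots> = (\<integral>\<^sup>+x. indicator A x * (\<integral>\<^sup>+y. indicator B (x + y) \<partial>lborel) \<partial>\<nu>)"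
      by (simp add: nn_integral_lborel_translate)
    also have "\<dots> = (\<integral>\<^sup>+x. (\<integral>\<^sup>+y. indicator A x * indicator B (x + y) \<partial>lborel) \<partial>\<nu>)"
      by (simp add: nn_integral_cmult)
    also have "\<dots> = (\<integral>\<^sup>+y. (\<integral>\<^sup>+x. indicator A x * indicator B (x + y) \<partial>\<nu>) \<partial>lborel)"
      by (rule P.Fubini'[symmetric]) measurable
    also have "\<dots> = (\<integral>\<^sup>+y. (\<integral>\<^sup>+x. indicator A (x - y) * indicator B x \<partial>\<nu>) \<partial>lborel)"
    proof (rule nn_integral_cong)
      fix y :: 'a
      have "(\<integral>\<^sup>+x. indicator A x * indicator B (x + y) \<partial>\<nu>)
          = (\<integral>\<^sup>+x. indicator A x * indicator B (x + y) \<partial>(distr \<nu> borel ((+) (- y))))"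
        by (simp only: trans)
      also have "\<dots> = (\<integral>\<^sup>+x. indicator A (x - y) * indicator B x \<partial>\<nu>)"
        by (subst nn_integral_distr) (auto simp: algebra_simps)
      finally show "(\<integral>\<^sup>+x. indicator A x * indicator B (x + y) \<partial>\<nu>) =
        (\<integral>\<^sup>+x. indicator A (x - y) * indicator B x \<partial>\<nu>)" .
    qed
    also have "\<dots> = (\<integral>\<^sup>+x. (\<integral>\<^sup>+y. indicator A (x - y) * indicator B x \<partial>lborel) \<partial>\<nu>)"
      by (rule P.Fubini') measurable
    also have "\<dots> = (\<integral>\<^sup>+x. emeasure lborel A * indicator B x \<partial>\<nu>)"
    proof -
      have "(\<integral>\<^sup>+y. indicator A (x - y) \<partial>lborel) = emeasure lborel A" for x
      proof -
        have "(\<integral>\<^sup>+y. indicator A y \<partial>lborel) = (\<integral>\<^sup>+y. indicator A y \<partial>(distr lborel borel (\<lambda>y. x - y)))"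
          using lborel_affine[of "-1" x] by (simp add: density_1 flip: ennreal_power)
        also have "\<dots> = (\<integral>\<^sup>+y. indicator A (x - y) \<partial>lborel)"
          by (rule nn_integral_distr) measurable
        finally show ?thesis by simp
      qed
      then show ?thesis by (simp add: nn_integral_multc)
    qed
    also have "\<dots> = emeasure lborel A * ?b" by (simp add: nn_integral_cmult_indicator ballB)
    finally have eq: "emeasure \<nu> A * ?b = emeasure lborel A * ?b" .
    have "?b \<noteq> 0" "?b \<noteq> \<infinity>"
      using emeasure_lborel_ball_finite[of "0::'a" 1] emeasure_lborel_ball_pos[of 1 "0::'a"]
      by (auto simp: B_def)
    then show ?thesis
      by (metis eq mult_divide_eq_ennreal infinity_ennreal_def)
  qed
  then show ?thesis by (intro measure_eqI) (auto simp flip: \<nu>_def)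
qed

lemma nn_integral_lborel_isometry:
  fixes U :: "'a::euclidean_space \<Rightarrow> 'a"
  assumes "linear U" "\<And>x. norm (U x) = norm x" and [measurable]: "g \<in> borel_measurable borel"
  shows "(\<integral>\<^sup>+x. g (U x) \<partial>lborel) = (\<integral>\<^sup>+x. g x \<partial>lborel)"
proof -
  have [measurable]: "U \<in> borel_measurable borel"
    using assms(1) by (intro borel_measurable_continuous_onI linear_continuous_on)
      (simp add: linear_conv_bounded_linear)
  have "(\<integral>\<^sup>+x. g x \<partial>lborel) = (\<integral>\<^sup>+x. g x \<partial>(distr lborel borel U))"
    by (simp add: lborel_distr_isometry[OF assms(1,2)])
  then show ?thesis by (simp add: nn_integral_distr)
qed

section \<open>Orthogonal projections, anisotropic dilations and unitary maps\<close>

lemma scaleR_eq_vector_smult: "r *\<^sub>R v = of_real r *s (v :: complex ^ 'n)"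
  by (simp add: vec_eq_iff) (simp add: scaleR_conv_of_real)

lemma norm_eq_cdot: "norm x = norm y \<longleftrightarrow> cdot x x = cdot y y"
  by (simp add: cdot_self flip: of_real_power)

lemma Re_cdot: "Re (cdot x y) = x \<bullet> y"
  by (simp add: cdot_def inner_vec_def inner_complex_def)

lemma linear_line_proj: "linear (line_proj u)"
  by (intro linearI)
    (simp_all add: line_proj_def cdot_simps scaleR_eq_vector_smult vec_eq_iff add_divide_distrib distrib_right)

lemma line_proj_unit: "norm u = 1 \<Longrightarrow> line_proj u z = cdot z u *s u"
  by (simp add: line_proj_def cdot_self)

text \<open>For a unit vector \<open>u\<close> the unit ball is mapped to the ellipsoid of radius
  \<open>t\<close> in the complex line of \<open>u\<close> and \<open>sqrt t\<close> orthogonally to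
  it. The parameter \<open>1 / t\<close> gives the inverse map.\<close>

definition aniso :: "complex ^ 'n \<Rightarrow> real \<Rightarrow> complex ^ 'n \<Rightarrow> complex ^ 'n"
  where "aniso u t w = t *\<^sub>R line_proj u w + sqrt t *\<^sub>R (w - line_proj u w)"

lemma linear_aniso: "linear (aniso u t)"
  using linear_line_proj[of u]
  by (intro linearI) (simp_all add: aniso_def linear_add linear_scale algebra_simps)

lemma measurable_aniso [measurable]: "aniso u t \<in> borel_measurable borel"
  using linear_aniso by (intro borel_measurable_continuous_onI linear_continuous_on)
    (simp add: linear_conv_bounded_linear)

lemma aniso_axis: "aniso (axis k 1) t w $ i = (if i = k then of_real t else of_real (sqrt t)) * w $ i"
proof -
  have "cdot w (axis k 1) = w $ k"
    by (simp add: cdot_def axis_def if_distrib cong: if_cong)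
  then have "line_proj (axis k 1) w = axis k (w $ k)"
    by (simp add: line_proj_unit norm_axis_1) (simp add: vec_eq_iff axis_def)
  then show ?thesis
    by (simp add: aniso_def) (simp add: axis_def scaleR_conv_of_real)
qed

text \<open>The dilation is diagonal in the real standard basis: 2 directions are scaled by
  \<open>t\<close> and 2n - 2 by \<open>sqrt t\<close>, so the Jacobian is t^2 t^(n-1) =
  t^(n+1).\<close>

lemma nn_integral_aniso_axis:
  fixes k :: "'n :: finite"
  assumes "0 < t" and [measurable]: "g \<in> borel_measurable borel"
  shows "(\<integral>\<^sup>+w. g w \<partial>lborel) =
    ennreal (t ^ (CARD('n) + 1)) * (\<integral>\<^sup>+w. g (aniso (axis k 1) t w) \<partial>lborel)"
proof -
  define s where "s i = (if i = k then t else sqrt t)" for i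
  define c where "c b = (if b \<in> {axis k 1, axis k \<i>} then t else sqrt t)" for b :: "complex ^ 'n"
  have c_axis: "c (axis i \<beta>) = s i" if "\<beta> \<in> Basis" for i \<beta>
    using that by (auto simp: c_def s_def axis_eq_axis Basis_complex_def)
  have Basis: "(Basis :: (complex ^ 'n) set) = (\<lambda>(i, \<beta>). axis i \<beta>) ` (UNIV \<times> Basis)"
    by (auto simp: Basis_vec_def)
  have inj: "inj_on (\<lambda>(i, \<beta>). axis i \<beta> :: complex ^ 'n) (UNIV \<times> Basis)"
    by (auto simp: inj_on_def axis_eq_axis)
  have "(\<Prod>b\<in>Basis. \<bar>c b\<bar>) = (\<Prod>(i, \<beta>)\<in>UNIV \<times> (Basis :: complex set). \<bar>s i\<bar>)"
    unfolding Basis by (subst prod.reindex[OF inj]) (auto simp: c_axis intro!: prod.cong)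
  also have "\<dots> = (\<Prod>i\<in>UNIV. \<Prod>\<beta>\<in>(Basis :: complex set). \<bar>s i\<bar>)"
    by (rule prod.cartesian_product[symmetric])
  also have "\<dots> = (\<Prod>i\<in>UNIV. t * (if i = k then t else 1))"
    using assms by (intro prod.cong) (auto simp: s_def power2_eq_square)
  also have "\<dots> = t ^ (CARD('n) + 1)"
    by (simp add: prod.distrib)
  finally have prod_c: "(\<Prod>b\<in>Basis. \<bar>c b\<bar>) = t ^ (CARD('n) + 1)" .
  have aniso: "aniso (axis k 1) t w = 0 + (\<Sum>b\<in>Basis. (c b * (w \<bullet> b)) *\<^sub>R b)" for w :: "complex ^ 'n"
  proof (rule euclidean_eqI)
    fix b :: "complex ^ 'n" assume b: "b \<in> Basis"
    then obtain i \<beta> where i: "b = axis i \<beta>" "\<beta> \<in> Basis" by (auto simp: Basis_vec_def)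
    have "aniso (axis k 1) t w \<bullet> b = s i * (w \<bullet> b)"
      by (simp add: i inner_axis aniso_axis s_def inner_mult_left flip: scaleR_conv_of_real)
    then show "aniso (axis k 1) t w \<bullet> b = (0 + (\<Sum>b\<in>Basis. (c b * (w \<bullet> b)) *\<^sub>R b)) \<bullet> b"
      using b by (simp add: inner_sum_left_Basis i c_axis)
  qed
  have T: "(\<lambda>w. 0 + (\<Sum>b\<in>Basis. (c b * (w \<bullet> b)) *\<^sub>R b)) = aniso (axis k 1) t"
    by (rule ext) (rule aniso[symmetric])
  have nz: "c b \<noteq> 0" for b using assms(1) by (simp add: c_def)
  have "lborel = density (distr lborel borel (aniso (axis k 1) t))
      (\<lambda>_. ennreal (\<Prod>b\<in>Basis. \<bar>c b\<bar>))"
    using lborel_affine_euclidean[of c 0, OF nz] by (simp only: T)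
  then have "(\<integral>\<^sup>+w. g w \<partial>lborel) =
      (\<integral>\<^sup>+w. g w \<partial>density (distr lborel borel (aniso (axis k 1) t)) (\<lambda>_. ennreal (\<Prod>b\<in>Basis. \<bar>c b\<bar>)))"
    by simp
  then show ?thesis
    by (simp add: nn_integral_density nn_integral_distr nn_integral_cmult prod_c)
qed

text \<open>A complex Householder reflection along e - u'. It sends \<open>e\<close> to
  \<open>u'\<close> only if \<open>cdot e u'\<close> is real, and the phase \<omega> is there to
  achieve this.\<close>

lemma unitary_exists:
  fixes e u :: "complex ^ 'n"
  assumes "norm e = 1" "norm u = 1"
  obtains U \<omega> where "\<And>x y. U (x + y) = U x + U y" "\<And>c x. U (c *s x) = c *s U x"
    "\<And>x y. cdot (U x) (U y) = cdot x y" "norm \<omega> = 1" "U e = \<omega> *s u"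
proof -
  define \<omega> where "\<omega> = (if cdot e u = 0 then 1 else sgn (cdot e u))"
  have \<omega>: "norm \<omega> = 1" by (simp add: \<omega>_def norm_sgn)
  define u' where "u' = \<omega> *s u"
  define s where "s = cdot e u'"
  have s: "s = of_real (norm (cdot e u))"
  proof (cases "cdot e u = 0")
    case False
    have "cnj (sgn (cdot e u)) * cdot e u = of_real (norm (cdot e u))"
      using False complex_norm_square[of "cdot e u"]
      by (simp add: sgn_div_norm scaleR_conv_of_real mult.commute power2_eq_square field_simps)
    then show ?thesis using False by (simp add: s_def u'_def \<omega>_def cdot_simps)
  qed (simp add: s_def u'_def cdot_simps)
  have u'1: "cdot u' u' = 1"
    using \<omega> cdot_self[of u] assms(2) complex_norm_square[of \<omega>] by (simp add: u'_def cdot_simps mult.commute)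
  have e1: "cdot e e = 1" using assms by (simp add: cdot_self)
  have s': "cdot u' e = s" using cnj_cdot[of e u'] by (simp add: s s_def[symmetric])
  define v where "v = e - u'"
  have vv: "cdot v v = 2 * (1 - s)" "cdot e v = 1 - s"
    by (simp_all add: v_def cdot_simps e1 u'1 s' s_def[symmetric])
  \<comment> \<open>If \<open>v = 0\<close>, the quotient is 0 by convention and \<open>U\<close> is
    the identity, which is correct since then e = u'.\<close>
  define U where "U x = x - (2 * cdot x v / cdot v v) *s v" for x
  have "U (x + y) = U x + U y" for x y
    by (simp add: U_def cdot_simps vec_eq_iff add_divide_distrib distrib_left distrib_right)
  moreover have "U (c *s x) = c *s U x" for c x
    by (simp add: U_def cdot_simps vec_eq_iff right_diff_distrib mult_ac)
  moreover have "cdot (U x) (U y) = cdot x y" for x y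
  proof (cases "v = 0")
    case False
    then have nz: "cdot v v \<noteq> 0" by simp
    have "cnj (cdot v v) = cdot v v" "cnj (cdot y v) = cdot v y" by (simp_all add: cnj_cdot)
    then show ?thesis using nz by (simp add: U_def cdot_simps field_simps)
  qed (simp add: U_def)
  moreover have "U e = \<omega> *s u"
  proof (cases "v = 0")
    case False
    then have "s \<noteq> 1" using vv by (metis cdot_self_eq_0 diff_self mult_zero_right)
    then have "2 * (1 - s) / (2 * (1 - s)) = 1" by simp
    then have "U e = e - v" unfolding U_def vv by simp
    then show ?thesis by (simp add: v_def u'_def)
  qed (simp add: U_def v_def u'_def)
  ultimately show ?thesis using \<omega> by (intro that[of U \<omega>])
qed

text \<open>Conjugation by a unitary map reduces to a coordinate axis. The phase \<omega> is
  harmless, because the projection onto the line of \<open>u\<close> does not change when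
  \<open>u\<close> is multiplied by a phase.\<close>

lemma nn_integral_aniso:
  fixes u :: "complex ^ 'n"
  assumes "norm u = 1" "0 < t" and [measurable]: "g \<in> borel_measurable borel"
  shows "(\<integral>\<^sup>+w. g w \<partial>lborel) = ennreal (t ^ (CARD('n) + 1)) * (\<integral>\<^sup>+w. g (aniso u t w) \<partial>lborel)"
proof -
  fix k :: 'n
  define e :: "complex ^ 'n" where "e = axis k 1"
  have e: "norm e = 1" by (simp add: e_def norm_axis_1)
  obtain U \<omega> where U: "\<And>x y. U (x + y) = U x + U y" "\<And>c x. U (c *s x) = c *s U x"
    "\<And>x y. cdot (U x) (U y) = cdot x y" "norm \<omega> = 1" "U e = \<omega> *s u"
    by (rule unitary_exists[OF e assms(1)]) (rule that; assumption)
  have lin: "linear U" using U(1,2) by (intro linearI) (auto simp: scaleR_eq_vector_smult)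
  have iso: "norm (U x) = norm x" for x by (simp add: norm_eq_cdot U(3))
  have [measurable]: "U \<in> borel_measurable borel"
    using lin by (intro borel_measurable_continuous_onI linear_continuous_on)
      (simp add: linear_conv_bounded_linear)
  have "line_proj u (U x) = U (line_proj e x)" for x
  proof -
    have "U (line_proj e x) = cdot x e *s U e"
      by (simp add: line_proj_unit e_def U(2))
    also have "cdot x e = cdot (U x) (U e)" by (simp only: U(3))
    also have "cdot (U x) (U e) *s U e = (cnj \<omega> * \<omega> * cdot (U x) u) *s u"
      by (simp add: U(5) cdot_simps mult_ac)
    also have "cnj \<omega> * \<omega> = 1" using complex_norm_square[of \<omega>] U(4) by (simp add: mult.commute)
    finally show ?thesis using assms(1) by (simp add: line_proj_unit)
  qed
  then have comm: "aniso u t (U x) = U (aniso e t x)" for x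
    by (simp add: aniso_def linear_add[OF lin] linear_diff[OF lin] linear_scale[OF lin])
  have "(\<integral>\<^sup>+w. g w \<partial>lborel) = (\<integral>\<^sup>+w. g (U w) \<partial>lborel)"
    by (simp add: nn_integral_lborel_isometry[OF lin iso])
  also have "\<dots> = ennreal (t ^ (CARD('n) + 1)) * (\<integral>\<^sup>+w. g (U (aniso e t w)) \<partial>lborel)"
    unfolding e_def by (rule nn_integral_aniso_axis) (use assms in measurable)
  also have "(\<integral>\<^sup>+w. g (U (aniso e t w)) \<partial>lborel) = (\<integral>\<^sup>+w. g (aniso u t w) \<partial>lborel)"
    unfolding comm[symmetric] by (rule nn_integral_lborel_isometry[OF lin iso]) measurable
  finally show ?thesis .
qed

section \<open>Submean inequalities\<close>

text \<open>Cauchy's formula at the centre: on the circle path the derivative is 2 \<pi> \<i> times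
  the point itself and cancels the kernel.\<close>

lemma circle_mean_value:
  assumes "continuous_on (cball 0 1) f" "f holomorphic_on ball 0 1"
  shows "((\<lambda>x. f (exp (2 * of_real pi * \<i> * of_real x))) has_integral f 0) {0..1}"
proof -
  have "((\<lambda>u. f u / (u - 0)) has_contour_integral (2 * of_real pi * \<i> * f 0)) (circlepath 0 1)"
    using assms by (intro Cauchy_integral_circlepath) auto
  then have "((\<lambda>x. f (circlepath 0 1 x) / circlepath 0 1 x *
      vector_derivative (circlepath 0 1) (at x within {0..1})) has_integral (2 * of_real pi * \<i> * f 0)) {0..1}"
    by (simp add: has_contour_integral_def)
  then have "((\<lambda>x. (2 * of_real pi * \<i>) * f (exp (2 * of_real pi * \<i> * of_real x))) has_integral
      (2 * of_real pi * \<i>) * f 0) {0..1}"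
    by (rule has_integral_eq[rotated])
      (simp add: vector_derivative_circlepath01, simp add: circlepath)
  from has_integral_mult_right[OF this, of "1 / (2 * of_real pi * \<i>)"] show ?thesis
    by simp
qed

lemma circle_submean:
  assumes "continuous_on (cball 0 1) f" "f holomorphic_on ball 0 1"
  shows "ennreal (norm (f 0)) \<le>
    (\<integral>\<^sup>+x\<in>{0..1}. ennreal (norm (f (exp (2 * of_real pi * \<i> * of_real x)))) \<partial>lborel)"
proof -
  let ?e = "\<lambda>x. exp (2 * of_real pi * \<i> * of_real x) :: complex"
  have c: "continuous_on {0..1} (\<lambda>x. norm (f (?e x)))"
    using assms(1) by (intro continuous_on_norm continuous_on_compose2[OF assms(1)] continuous_intros) auto
  have i: "(\<lambda>x. norm (f (?e x))) integrable_on {0..1}"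
    using c by (rule integrable_continuous_interval)
  have mv: "((\<lambda>x. f (?e x)) has_integral f 0) {0..1}" by (rule circle_mean_value[OF assms])
  have "norm (integral {0..1} (\<lambda>x. f (?e x))) \<le> integral {0..1} (\<lambda>x. norm (f (?e x)))"
    using mv i by (intro integral_norm_bound_integral) auto
  then have le: "norm (f 0) \<le> integral {0..1} (\<lambda>x. norm (f (?e x)))"
    using mv by (simp add: integral_unique)
  have "(\<lambda>x. indicator {0..1} x *\<^sub>R norm (f (?e x))) \<in> borel_measurable borel"
    by (rule borel_measurable_continuous_on_indicator[OF _ c]) simp
  then have m: "(\<lambda>x. norm (f (?e x)) * indicator {0..1} x) \<in> borel_measurable borel"
    by (simp add: mult.commute)
  have "(\<lambda>x. norm (f (?e x)) * indicator {0..1} x) = (\<lambda>x. if x \<in> {0..1} then norm (f (?e x)) else 0)"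
    by (simp add: fun_eq_iff indicator_def)
  then have "((\<lambda>x. norm (f (?e x)) * indicator {0..1} x) has_integral
      integral {0..1} (\<lambda>x. norm (f (?e x)))) UNIV"
    using integrable_integral[OF i] by (simp only: has_integral_restrict_UNIV)
  then have "(\<integral>\<^sup>+x. ennreal (norm (f (?e x)) * indicator {0..1} x) \<partial>lborel)
      = ennreal (integral {0..1} (\<lambda>x. norm (f (?e x))))"
    by (intro nn_integral_has_integral_lborel m) auto
  then show ?thesis using le by (simp add: ennreal_leI nn_integral_set_ennreal)
qed

text \<open>If x > e, then x^(1-p) \<le> e^(1-p), because the exponent is not positive. This takes
  the part of Jensen's inequality for p \<ge> 1; \<open>e\<close> is chosen later to balance the two
  terms.\<close>

lemma powr_interpolation:
  fixes x e p :: real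
  assumes "0 < e" "0 \<le> x" "1 \<le> p"
  shows "x \<le> e + e powr (1 - p) * x powr p"
proof (cases "x \<le> e")
  case True
  then show ?thesis by (simp add: add_increasing2)
next
  case False
  then have "x = x powr (1 - p) * x powr p"
    using assms by (simp flip: powr_add)
  also have "\<dots> \<le> e powr (1 - p) * x powr p"
    using False assms by (intro mult_right_mono powr_mono2') auto
  finally show ?thesis using assms by linarith
qed

text \<open>Continuity up to the closed ball makes the supremum finite that is used for p < 1;
  measurability on the whole space lets all integrals be taken over \<open>lborel\<close>.\<close>

definition submean_on_ball :: "('a::euclidean_space \<Rightarrow> real) \<Rightarrow> bool"
  where "submean_on_ball u \<longleftrightarrow> continuous_on (cball 0 1) u \<and> (\<forall>x. 0 \<le> u x) \<and> u \<in> borel_measurable borel \<and>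
    (\<forall>z \<rho>. 0 < \<rho> \<and> cball z \<rho> \<subseteq> cball 0 1 \<longrightarrow>
      ennreal (u z) * emeasure lborel (ball z \<rho>) \<le> (\<integral>\<^sup>+x\<in>ball z \<rho>. ennreal (u x) \<partial>lborel))"

text \<open>For \<open>p < 1\<close> this is the argument of Hardy--Littlewood and Fefferman--Stein: compare
  with the supremum of \<open>(1 - |z|)^(d/p) u(z)\<close>.\<close>

lemma submean_powr:
  fixes p :: real
  assumes "0 < p"
  obtains C :: real where "0 < C"
    "\<And>u :: 'a::euclidean_space \<Rightarrow> real. submean_on_ball u \<Longrightarrow>
      ennreal (u 0 powr p) \<le> ennreal C * (\<integral>\<^sup>+x\<in>ball 0 1. ennreal (u x powr p) \<partial>lborel)"
proof -
  have [measurable]: "ball z \<rho> \<in> sets borel" for z :: 'a and \<rho> by simp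
  define d where "d = real DIM('a)"
  define \<omega> where "\<omega> = measure lborel (ball (0::'a) 1)"
  have \<omega>: "\<omega> > 0" unfolding \<omega>_def by (rule measure_lborel_ball_pos) simp
  have vol: "emeasure lborel (ball z \<rho>) = ennreal (\<omega> * \<rho> powr d)" if "0 < \<rho>" for z :: 'a and \<rho>
  proof -
    have "emeasure lborel (ball z \<rho>) = ennreal (measure lborel (ball z \<rho>))"
      using emeasure_lborel_ball_finite[of z \<rho>] by (simp add: emeasure_eq_ennreal_measure less_top)
    also have "measure lborel (ball z \<rho>) = \<rho> ^ DIM('a) * \<omega>"
      using content_ball_conv_unit_ball[of \<rho> z] that unfolding \<omega>_def by simp
    finally show ?thesis using that by (simp add: d_def powr_realpow mult.commute)
  qed
  \<comment> \<open>For p \<ge> 1 the factor 2^p comes from u(0) \<le> 2E below; for p < 1 the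
    factor 2^(d/p) comes from working with half the distance to the sphere.\<close>
  define C where "C = (if p < 1 then 2 powr (d / p) / \<omega> else 2 powr p / \<omega>)"
  have C: "C > 0" using \<omega> by (simp add: C_def)
  have "ennreal (u 0 powr p) \<le> ennreal C * (\<integral>\<^sup>+x\<in>ball 0 1. ennreal (u x powr p) \<partial>lborel)"
    (is "_ \<le> _ * ?I") if sub: "submean_on_ball u" for u :: "'a \<Rightarrow> real"
  proof (cases "?I = \<infinity>")
    case True
    then show ?thesis using C by (simp add: ennreal_mult_top)
  next
    case False
    then obtain J where J: "0 \<le> J" "?I = ennreal J"
      by (cases ?I) auto
    have cont: "continuous_on (cball 0 1) u" and nonneg: "\<And>x. 0 \<le> u x"
      and [measurable]: "u \<in> borel_measurable borel"
      and sm: "\<And>z \<rho>. 0 < \<rho> \<Longrightarrow> cball z \<rho> \<subseteq> cball 0 1 \<Longrightarrow>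
        ennreal (u z) * emeasure lborel (ball z \<rho>) \<le> (\<integral>\<^sup>+x\<in>ball z \<rho>. ennreal (u x) \<partial>lborel)"
      using sub unfolding submean_on_ball_def by blast+
    \<comment> \<open>A pointwise bound u \<le> A + B u^p is inserted into the submean inequality on
      a small ball; the integral of u^p is then enlarged to the whole unit ball, where it equals
      \<open>J\<close>.\<close>
    have bound: "u z * (\<omega> * \<rho> powr d) \<le> A * (\<omega> * \<rho> powr d) + B * J"
      if "0 < \<rho>" "cball z \<rho> \<subseteq> cball 0 1" "0 \<le> A" "0 \<le> B"
        and le: "\<And>x. x \<in> ball z \<rho> \<Longrightarrow> u x \<le> A + B * u x powr p" for z \<rho> A B
    proof -
      have sub: "ball z \<rho> \<subseteq> ball 0 1"
        using interior_mono[OF that(2)] by simp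
      have "ennreal (u z) * emeasure lborel (ball z \<rho>) \<le> (\<integral>\<^sup>+x\<in>ball z \<rho>. ennreal (u x) \<partial>lborel)"
        using that by (intro sm) auto
      also have "\<dots> \<le> (\<integral>\<^sup>+x. ennreal A * indicator (ball z \<rho>) x +
          ennreal B * (ennreal (u x powr p) * indicator (ball 0 1) x) \<partial>lborel)"
        using sub le that(3,4) nonneg
        by (intro nn_integral_mono)
          (auto simp: indicator_def simp flip: ennreal_mult ennreal_plus intro!: ennreal_leI)
      also have "\<dots> = ennreal A * emeasure lborel (ball z \<rho>) + ennreal B * ennreal J"
        by (simp add: nn_integral_add nn_integral_cmult J)
      finally show ?thesis
        using that(1,3,4) \<omega> J(1) nonneg[of z]
        by (simp add: vol flip: ennreal_mult ennreal_plus)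
    qed
    have "u 0 powr p \<le> C * J"
    proof (cases "p < 1")
      case False
      have "u 0 powr p \<le> C * (J + e)" if "e > 0" for e
      proof -
        \<comment> \<open>With this choice E \<omega> = E^(1-p) (J + e), so the two terms balance.
          The extra \<open>e\<close> keeps \<open>E\<close> positive when \<open>J = 0\<close> and
          is removed at the end.\<close>
        define E where "E = ((J + e) / \<omega>) powr (1 / p)"
        have E: "E > 0" using that J(1) \<omega> by (simp add: E_def)
        have Ep: "E powr p = (J + e) / \<omega>"
          using that J(1) \<omega> assms by (simp add: E_def powr_powr)
        have "u 0 * (\<omega> * 1 powr d) \<le> E * (\<omega> * 1 powr d) + E powr (1 - p) * J"
          using False E nonneg by (intro bound powr_interpolation) auto
        then have "u 0 * \<omega> \<le> E * \<omega> + E powr (1 - p) * J" by simp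
        also have "E powr (1 - p) * J \<le> E powr (1 - p) * (E powr p * \<omega>)"
          using that \<omega> by (intro mult_left_mono) (auto simp: Ep)
        also have "\<dots> = E * \<omega>" using E by (simp flip: powr_add mult.assoc)
        finally have "u 0 \<le> 2 * E" using \<omega> by simp
        then have "u 0 powr p \<le> (2 * E) powr p"
          using nonneg assms by (intro powr_mono2) auto
        also have "\<dots> = C * (J + e)"
          using E False by (simp add: powr_mult Ep C_def)
        finally show ?thesis .
      qed
      then have "u 0 powr p \<le> C * (J + e / C)" if "e > 0" for e
        using that C by simp
      then have "u 0 powr p \<le> C * J + e" if "e > 0" for e
        using that C by (simp add: distrib_left)
      then show ?thesis by (rule field_le_epsilon)
    next
      case True
      \<comment> \<open>The weight compensates the growth of the submean constant near the sphere;
        its exponent d/p is the one for which all powers of \<rho> cancel below.\<close>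
      define h where "h x = (1 - norm x) powr (d / p) * u x" for x
      have "compact (u ` cball 0 1)" using cont by (intro compact_continuous_image) auto
      then obtain M where M: "\<And>x. x \<in> cball 0 1 \<Longrightarrow> u x \<le> M"
        using compact_imp_bounded bounded_real by (metis abs_le_D1 imageI)
      have hM: "h x \<le> M" if "x \<in> ball 0 1" for x
      proof -
        have "(1 - norm x) powr (d / p) \<le> 1 powr (d / p)"
          using that assms by (intro powr_mono2) (auto simp: d_def)
        then have "h x \<le> 1 * u x"
          unfolding h_def using nonneg by (intro mult_right_mono) auto
        then show ?thesis using M[of x] that by auto
      qed
      define S where "S = (SUP x\<in>ball 0 1. h x)"
      have hS: "h x \<le> S" if "x \<in> ball 0 1" for x
        unfolding S_def using that hM by (intro cSUP_upper bdd_aboveI2) auto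
      have u0: "u 0 \<le> S" using hS[of 0] by (simp add: h_def)
      show ?thesis
      proof (cases "S \<le> 0")
        case True
        then have "u 0 = 0" using u0 nonneg[of 0] by simp
        then show ?thesis using C J assms by simp
      next
        case False
        have key: "h z \<le> (2 powr (d / p) / \<omega>) * S powr (1 - p) * J" if z: "z \<in> ball 0 1" for z
        proof -
          define \<rho> where "\<rho> = (1 - norm z) / 2"
          have two_rho: "1 - norm z = 2 * \<rho>" by (simp add: \<rho>_def)
          have \<rho>: "0 < \<rho>" using z by (simp add: \<rho>_def)
          have le: "\<rho> \<le> 1 - norm x" if "x \<in> cball z \<rho>" for x
            using that norm_triangle_sub[of x z] by (simp add: \<rho>_def dist_norm norm_minus_commute field_simps)
          \<comment> \<open>An upper bound for u^(1-p) on the ball of radius \<rho>: there the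
            distance to the sphere is still at least \<rho>, so h \<le> S bounds \<open>u\<close>.
            The other factor u^p is what \<open>J\<close> integrates.\<close>
          define B where "B = (S * \<rho> powr (- (d / p))) powr (1 - p)"
          have ux: "u x \<le> S * \<rho> powr (- (d / p))" if "x \<in> ball z \<rho>" for x
          proof -
            have *: "\<rho> \<le> 1 - norm x" using le that by auto
            have "\<rho> powr (d / p) * u x \<le> h x"
              unfolding h_def using * \<rho> assms nonneg by (intro mult_right_mono powr_mono2) (auto simp: d_def)
            also have "\<dots> \<le> S" using * \<rho> by (intro hS) auto
            finally show ?thesis using \<rho> by (simp add: powr_minus field_simps)
          qed
          have "u z * (\<omega> * \<rho> powr d) \<le> 0 * (\<omega> * \<rho> powr d) + B * J"
          proof (rule bound)
            show "cball z \<rho> \<subseteq> cball 0 1" using le \<rho> by force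
            fix x assume x: "x \<in> ball z \<rho>"
            show "u x \<le> 0 + B * u x powr p"
            proof (cases "u x = 0")
              case False
              then have "u x = u x powr (1 - p) * u x powr p"
                using nonneg[of x] by (simp flip: powr_add)
              also have "\<dots> \<le> B * u x powr p"
                unfolding B_def using ux[OF x] nonneg[of x] True
                by (intro mult_right_mono powr_mono2) auto
              finally show ?thesis by simp
            qed (use assms in auto)
          qed (auto simp: \<rho> B_def)
          then have "u z \<le> B * J / (\<omega> * \<rho> powr d)"
            using \<rho> \<omega> by (simp add: field_simps)
          then have "h z \<le> (2 * \<rho>) powr (d / p) * (B * J / (\<omega> * \<rho> powr d))"
            by (simp only: h_def two_rho mult_left_mono powr_ge_zero)
          also have "\<dots> = (2 powr (d / p) / \<omega>) * S powr (1 - p) * J *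
              (\<rho> powr (d / p) * \<rho> powr (- (d / p) * (1 - p)) / \<rho> powr d)"
            using \<rho> False by (simp add: B_def powr_mult powr_powr mult_ac)
          also have "\<rho> powr (d / p) * \<rho> powr (- (d / p) * (1 - p)) / \<rho> powr d =
              \<rho> powr (d / p + - (d / p) * (1 - p) - d)"
            by (simp only: powr_add powr_diff)
          also have "d / p + - (d / p) * (1 - p) - d = 0"
            using assms by (simp add: field_simps)
          finally show ?thesis using \<rho> by simp
        qed
        have "S \<le> (2 powr (d / p) / \<omega>) * S powr (1 - p) * J"
          unfolding S_def by (rule cSUP_least) (use key in \<open>auto simp: S_def\<close>)
        moreover have "S = S powr p * S powr (1 - p)" using False by (simp flip: powr_add)
        \<comment> \<open>\<open>S\<close> occurs on the right only to the power 1 - p. As it is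
          positive and, by continuity of \<open>u\<close>, finite, this power can be
          cancelled.\<close>
        ultimately have "S powr p * S powr (1 - p) \<le> ((2 powr (d / p) / \<omega>) * J) * S powr (1 - p)"
          by (simp add: mult_ac)
        then have "S powr p \<le> (2 powr (d / p) / \<omega>) * J"
          by (rule mult_right_le_imp_le) (use False in simp)
        moreover have "u 0 powr p \<le> S powr p" using u0 nonneg assms by (intro powr_mono2) auto
        ultimately show ?thesis using True by (simp add: C_def)
      qed
    qed
    then show ?thesis using J C by (simp add: J(2) flip: ennreal_mult)
  qed
  with C show ?thesis by (rule that)
qed

section \<open>Holomorphic functions on complex lines and balls\<close>

definition cdiff_at :: "(complex ^ 'n \<Rightarrow> complex) \<Rightarrow> complex ^ 'n \<Rightarrow> bool"
  where "cdiff_at f z \<longleftrightarrow> (\<exists>f'. (f has_derivative f') (at z) \<and> (\<forall>c v. f' (c *s v) = c * f' v))"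

lemma holomorphic_ball_iff: "holomorphic_ball f \<longleftrightarrow> (\<forall>z\<in>unit_ball. cdiff_at f z)"
  by (simp add: holomorphic_ball_def cdiff_at_def)

lemma cdiff_at_imp_isCont: "cdiff_at f z \<Longrightarrow> isCont f z"
  unfolding cdiff_at_def by (metis has_derivative_continuous)

lemma cdiff_at_compose_affine:
  assumes "cdiff_at f (a + L w)" "bounded_linear L" "\<And>c v. L (c *s v) = c *s L v"
  shows "cdiff_at (\<lambda>w. f (a + L w)) w"
proof -
  from assms(1) obtain f' where f': "(f has_derivative f') (at (a + L w))"
    "\<And>c v. f' (c *s v) = c * f' v"
    unfolding cdiff_at_def by blast
  have "((\<lambda>w. a + L w) has_derivative (\<lambda>v. 0 + L v)) (at w)"
    using assms(2) by (intro has_derivative_add has_derivative_const bounded_linear_imp_has_derivative)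
  then have "((\<lambda>w. f (a + L w)) has_derivative (\<lambda>v. f' (0 + L v))) (at w)"
    by (rule has_derivative_compose) (rule f')
  then show ?thesis unfolding cdiff_at_def using assms(3) f'(2) by auto
qed

lemma continuous_on_smult [continuous_intros]:
  fixes g :: "'a::topological_space \<Rightarrow> complex ^ 'n"
  assumes "continuous_on S f" "continuous_on S g"
  shows "continuous_on S (\<lambda>x. f x *s g x)"
  unfolding vector_scalar_mult_def using assms by (intro continuous_intros)

text \<open>On the complex line through \<open>z\<close> in direction \<open>w\<close> the function
  becomes holomorphic in one variable, at every point of the closed unit disc.\<close>

lemma circle_submean_slice:
  assumes "\<And>x. x \<in> cball z \<rho> \<Longrightarrow> cdiff_at f x" and w: "norm w \<le> \<rho>"
  shows "ennreal (norm (f z)) \<le>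
    (\<integral>\<^sup>+x\<in>{0..1}. ennreal (norm (f (z + exp (2 * of_real pi * \<i> * of_real x) *s w))) \<partial>lborel)"
proof -
  let ?h = "\<lambda>y. f (z + y *s w)"
  have norm_smult: "norm (y *s w) = norm y * norm w" for y
    by (simp add: norm_vec_def norm_mult L2_set_right_distrib)
  have h: "?h field_differentiable at y" if "y \<in> cball 0 1" for y
  proof -
    have "norm y * norm w \<le> 1 * \<rho>" using that w by (intro mult_mono) auto
    then have "z + y *s w \<in> cball z \<rho>" by (simp add: dist_norm norm_smult)
    then obtain f' where f': "(f has_derivative f') (at (z + y *s w))"
      "\<And>c v. f' (c *s v) = c * f' v"
      using assms(1) unfolding cdiff_at_def by blast
    have "bounded_linear (\<lambda>y. y *s w)"
      by (rule linear_conv_bounded_linear[THEN iffD1], intro linearI)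
        (simp_all add: vec_eq_iff distrib_right)
    then have "((\<lambda>y. z + y *s w) has_derivative (\<lambda>\<mu>. 0 + \<mu> *s w)) (at y)"
      by (intro has_derivative_add has_derivative_const bounded_linear_imp_has_derivative)
    then have "(?h has_derivative (\<lambda>\<mu>. f' (0 + \<mu> *s w))) (at y)"
      by (rule has_derivative_compose) (rule f')
    moreover have "(\<lambda>\<mu>. f' (0 + \<mu> *s w)) = (*) (f' w)" by (simp add: f' fun_eq_iff mult.commute)
    ultimately show ?thesis
      by (auto simp: field_differentiable_def has_field_derivative_def)
  qed
  have "?h holomorphic_on cball 0 1"
    using h by (auto simp: holomorphic_on_def intro: field_differentiable_at_within)
  then have "continuous_on (cball 0 1) ?h" "?h holomorphic_on ball 0 1"
    by (simp_all add: holomorphic_on_imp_continuous_on holomorphic_on_subset[OF _ ball_subset_cball])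
  from circle_submean[OF this] show ?thesis by simp
qed

lemma borel_measurable_ennreal_indicator:
  fixes f :: "'a::euclidean_space \<Rightarrow> real"
  assumes "A \<in> sets borel" "continuous_on A f"
  shows "(\<lambda>x. ennreal (f x) * indicator A x) \<in> borel_measurable borel"
proof -
  have "(\<lambda>x. ennreal (indicator A x *\<^sub>R f x)) \<in> borel_measurable borel"
    using borel_measurable_continuous_on_indicator[OF assms] by simp
  also have "(\<lambda>x. ennreal (indicator A x *\<^sub>R f x)) = (\<lambda>x. ennreal (f x) * indicator A x)"
    by (auto simp: indicator_def)
  finally show ?thesis .
qed

text \<open>The circle inequality is averaged over all \<open>w\<close> in the ball. After Fubini
  each rotation of \<open>w\<close> by a phase is an isometry, so every angle contributes the same
  integral.\<close>

lemma submean_ball: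
  fixes f :: "complex ^ 'n \<Rightarrow> complex"
  assumes f: "\<And>x. x \<in> cball z \<rho> \<Longrightarrow> cdiff_at f x"
  shows "ennreal (norm (f z)) * emeasure lborel (ball z \<rho>) \<le>
    (\<integral>\<^sup>+x\<in>ball z \<rho>. ennreal (norm (f x)) \<partial>lborel)"
proof -
  let ?e = "\<lambda>x. exp (2 * of_real pi * \<i> * of_real x) :: complex"
  define F where "F x = ennreal (norm (f x)) * indicator (ball z \<rho>) x" for x
  define B where "B = ball (0 :: complex ^ 'n) \<rho>"
  have [measurable]: "B \<in> sets borel" by (simp add: B_def)
  have "continuous_on (ball z \<rho>) (\<lambda>x. norm (f x))"
    using f by (intro continuous_on_norm continuous_at_imp_continuous_on ballI)
      (auto intro: cdiff_at_imp_isCont)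
  then have F [measurable]: "F \<in> borel_measurable borel"
    unfolding F_def by (intro borel_measurable_ennreal_indicator) auto
  have [measurable]: "(\<lambda>(w, x). ?e x *s w :: complex ^ 'n) \<in> borel_measurable (borel \<Otimes>\<^sub>M borel)"
    unfolding borel_prod case_prod_unfold
    by (intro borel_measurable_continuous_onI continuous_intros)
  have "emeasure lborel (ball z \<rho>) = emeasure lborel B"
  proof -
    have "emeasure lborel (ball z \<rho>) = emeasure (distr lborel borel ((+) z)) (ball z \<rho>)"
      by (simp add: lborel_distr_plus)
    also have "\<dots> = emeasure lborel ((+) z -` ball z \<rho>)" by (simp add: emeasure_distr)
    also have "(+) z -` ball z \<rho> = B" by (auto simp: B_def dist_norm)
    finally show ?thesis .
  qed
  then have "ennreal (norm (f z)) * emeasure lborel (ball z \<rho>) =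
      (\<integral>\<^sup>+w. ennreal (norm (f z)) * indicator B w \<partial>lborel)"
    by (simp add: nn_integral_cmult_indicator)
  also have "\<dots> \<le> (\<integral>\<^sup>+w. (\<integral>\<^sup>+x. F (z + ?e x *s w) * indicator {0..1} x \<partial>lborel) \<partial>lborel)"
  proof (intro nn_integral_mono)
    fix w :: "complex ^ 'n"
    have "z + ?e x *s w \<in> ball z \<rho>" if "w \<in> B" for x
      using that by (simp add: B_def dist_norm norm_vec_def norm_mult)
    then show "ennreal (norm (f z)) * indicator B w \<le>
        (\<integral>\<^sup>+x. F (z + ?e x *s w) * indicator {0..1} x \<partial>lborel)"
      using circle_submean_slice[of z \<rho> f w] f by (cases "w \<in> B") (auto simp: F_def B_def)
  qed
  also have "\<dots> = (\<integral>\<^sup>+x. (\<integral>\<^sup>+w. F (z + ?e x *s w) * indicator {0..1} x \<partial>lborel) \<partial>lborel)"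
    by (rule lborel_pair.Fubini'[symmetric]) measurable
  also have "\<dots> = (\<integral>\<^sup>+x. (\<integral>\<^sup>+w. F (z + w) \<partial>lborel) * indicator {0..1} (x::real) \<partial>lborel)"
  proof (intro nn_integral_cong)
    fix x :: real
    have "(\<integral>\<^sup>+w. F (z + ?e x *s w) \<partial>lborel) = (\<integral>\<^sup>+w. F (z + w) \<partial>lborel)"
    proof (rule nn_integral_lborel_isometry[where g="\<lambda>w. F (z + w)"])
      show "linear (\<lambda>w. ?e x *s w :: complex ^ 'n)"
        by (intro linearI) (simp_all add: vec_eq_iff distrib_left)
    qed (simp_all add: norm_vec_def norm_mult)
    then show "(\<integral>\<^sup>+w. F (z + ?e x *s w) * indicator {0..1} x \<partial>lborel) =
        (\<integral>\<^sup>+w. F (z + w) \<partial>lborel) * indicator {0..1} x"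
      by (simp add: nn_integral_multc)
  qed
  also have "\<dots> = (\<integral>\<^sup>+w. F (z + w) \<partial>lborel)"
    by (simp add: nn_integral_cmult_indicator)
  also have "\<dots> = (\<integral>\<^sup>+w. F w \<partial>lborel)" by (simp add: nn_integral_lborel_translate)
  finally show ?thesis by (simp add: F_def)
qed

text \<open>Comparability is assumed in both directions because the sign of the exponent decides
  which one is used.\<close>

lemma powr_le_powr_cmult:
  fixes x y M a :: real
  assumes "0 < x" "0 < y" "1 \<le> M" "x \<le> M * y" "y \<le> M * x"
  shows "x powr a \<le> M powr \<bar>a\<bar> * y powr a"
proof (cases "a \<ge> 0")
  case True
  then have "x powr a \<le> (M * y) powr a" using assms by (intro powr_mono2) auto
  then show ?thesis using True assms by (simp add: powr_mult)
next
  case False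
  have "y / M \<le> x" using assms by (simp add: field_simps)
  then have "x powr a \<le> (y / M) powr a" using False assms by (intro powr_mono2') auto
  then show ?thesis using False assms by (simp add: powr_divide powr_minus field_simps)
qed

section \<open>Ellipsoids near the sphere\<close>

lemma norm_add_cdot_orthogonal:
  assumes "norm u = 1" "cdot v u = 0"
  shows "(norm (c *s u + v))\<^sup>2 = (norm c)\<^sup>2 + (norm v)\<^sup>2"
proof -
  have "cdot u v = 0" using assms cnj_cdot[of v u] by simp
  moreover have "cdot u u = 1" using assms by (simp add: cdot_self)
  ultimately have "cdot (c *s u + v) (c *s u + v) = c * cnj c + cdot v v"
    using assms by (simp add: cdot_simps)
  then have "complex_of_real ((norm (c *s u + v))\<^sup>2) = of_real ((norm c)\<^sup>2 + (norm v)\<^sup>2)"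
    unfolding cdot_self complex_norm_square[symmetric] by simp
  then show ?thesis by (simp only: of_real_eq_iff)
qed

lemma cdot_line_proj_diff: "norm u = 1 \<Longrightarrow> cdot (w - cdot w u *s u) u = 0"
  by (simp add: cdot_simps cdot_self)

lemma norm_decompose:
  assumes "norm u = 1"
  shows "(norm w)\<^sup>2 = (norm (cdot w u))\<^sup>2 + (norm (w - cdot w u *s u))\<^sup>2"
  using norm_add_cdot_orthogonal[OF assms cdot_line_proj_diff[OF assms], of "cdot w u" w] by simp

lemma aniso_unit:
  "norm u = 1 \<Longrightarrow> aniso u t w = (of_real t * cdot w u) *s u + sqrt t *\<^sub>R (w - cdot w u *s u)"
  by (simp add: aniso_def line_proj_unit scaleR_eq_vector_smult[of t])

lemma aniso_smult: "aniso u t (c *s v) = c *s aniso u t v"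
  by (simp add: aniso_def line_proj_def cdot_simps scaleR_eq_vector_smult vec_eq_iff algebra_simps)

lemma norm_unit_ball_sq: "z \<in> unit_ball \<Longrightarrow> 0 < defect z"
  by (simp add: power_less_one_iff)

text \<open>Expanding the square gives 1 - |z|^2 = \<delta> (1 - r Re(c)/2 - \<delta> |c|^2/16 -
  |Q|^2/16). The first correction is at most 1/2 in modulus, and the other two together are at most
  1/16. The radius \<delta> in the direction of \<open>u\<close> is right because |z|^2 varies to
  first order there; orthogonally it varies only to second order, which allows
  \<open>sqrt \<delta>\<close>.\<close>

lemma aniso_box_bounds:
  assumes u: "norm u = 1" and r: "0 \<le> r" "r < 1" and w: "norm w \<le> 1"
  defines "\<delta> \<equiv> 1 - r\<^sup>2"
  defines "z \<equiv> of_real r *s u + (1 / 4) *\<^sub>R aniso u \<delta> w"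
  shows "\<delta> \<le> 4 * defect z" "defect z \<le> 4 * \<delta>"
proof -
  define c where "c = cdot w u"
  define Q where "Q = w - c *s u"
  have \<delta>: "0 < \<delta>" "\<delta> \<le> 1" using r by (auto simp: \<delta>_def power_less_one_iff)
  have Qu: "cdot Q u = 0" unfolding Q_def c_def by (rule cdot_line_proj_diff[OF u])
  have cQ: "(norm c)\<^sup>2 + (norm Q)\<^sup>2 \<le> 1"
    using norm_decompose[OF u, of w] power_le_one[of "norm w" 2] w by (simp add: c_def Q_def)
  have z: "z = (of_real r + of_real (\<delta> / 4) * c) *s u + (sqrt \<delta> / 4) *\<^sub>R Q"
    unfolding z_def aniso_unit[OF u]
    by (simp add: Q_def c_def scaleR_eq_vector_smult vec_eq_iff algebra_simps)
  have "cdot ((sqrt \<delta> / 4) *\<^sub>R Q) u = 0" by (simp add: scaleR_eq_vector_smult cdot_simps Qu)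
  from norm_add_cdot_orthogonal[OF u this, of "of_real r + of_real (\<delta> / 4) * c"]
  have "(norm z)\<^sup>2 = (norm (of_real r + of_real (\<delta> / 4) * c))\<^sup>2 + (norm ((sqrt \<delta> / 4) *\<^sub>R Q))\<^sup>2"
    by (simp only: z)
  also have "(norm (of_real r + of_real (\<delta> / 4) * c))\<^sup>2 = r\<^sup>2 + r * \<delta> / 2 * Re c + (\<delta> / 4)\<^sup>2 * (norm c)\<^sup>2"
    unfolding cmod_power2 by (simp add: power2_eq_square algebra_simps)
  also have "(norm ((sqrt \<delta> / 4) *\<^sub>R Q))\<^sup>2 = \<delta> / 16 * (norm Q)\<^sup>2"
    using \<delta> by (simp add: power_mult_distrib power_divide)
  also have "r\<^sup>2 = 1 - \<delta>" by (simp add: \<delta>_def)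
  finally have nz: "(norm z)\<^sup>2 =
    1 - \<delta> + r * \<delta> / 2 * Re c + (\<delta> / 4)\<^sup>2 * (norm c)\<^sup>2 + \<delta> / 16 * (norm Q)\<^sup>2" .
  have eq: "defect z = \<delta> * (1 - r / 2 * Re c - \<delta> / 16 * (norm c)\<^sup>2 - (norm Q)\<^sup>2 / 16)"
  proof -
    have "1 - (1 - d + r * d / 2 * x + (d / 4)\<^sup>2 * C + d / 16 * q) =
        d * (1 - r / 2 * x - d / 16 * C - q / 16)" for d x C q :: real
      by (simp add: power2_eq_square field_simps)
    then show ?thesis unfolding nz .
  qed
  have "(norm c)\<^sup>2 \<le> 1" using cQ zero_le_power2[of "norm Q"] by linarith
  then have "norm c \<le> 1" by (metis norm_ge_zero one_power2 power2_le_imp_le zero_le_one)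
  then have "\<bar>Re c\<bar> \<le> 1" using abs_Re_le_cmod[of c] by linarith
  then have "\<bar>r * Re c\<bar> \<le> 1 * 1" using r unfolding abs_mult by (intro mult_mono) auto
  then have "r * Re c \<le> 1" "- (r * Re c) \<le> 1" by (auto simp: abs_le_iff)
  moreover have "\<delta> * (norm c)\<^sup>2 \<le> 1 * (norm c)\<^sup>2" using \<delta> by (intro mult_right_mono) auto
  moreover have "0 \<le> \<delta> * (norm c)\<^sup>2" using \<delta> by simp
  moreover have "0 \<le> (norm Q)\<^sup>2" by simp
  moreover have "\<delta> / 16 * (norm c)\<^sup>2 = \<delta> * (norm c)\<^sup>2 / 16" "r / 2 * Re c = r * Re c / 2" by simp_all
  ultimately have *: "1 / 4 \<le> 1 - r / 2 * Re c - \<delta> / 16 * (norm c)\<^sup>2 - (norm Q)\<^sup>2 / 16"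
    "1 - r / 2 * Re c - \<delta> / 16 * (norm c)\<^sup>2 - (norm Q)\<^sup>2 / 16 \<le> 4"
    using cQ by linarith+
  show "\<delta> \<le> 4 * defect z"
    unfolding eq using mult_left_mono[OF *(1), of \<delta>] \<delta> by simp
  show "defect z \<le> 4 * \<delta>"
    unfolding eq using mult_left_mono[OF *(2), of \<delta>] \<delta> by simp
qed

lemma unit_direction_exists:
  fixes a :: "complex ^ 'n"
  obtains u where "norm u = 1" "a = of_real (norm a) *s u"
proof (cases "a = 0")
  case True
  then show ?thesis by (intro that[of "axis undefined 1"]) (auto simp: norm_axis_1)
next
  case False
  then show ?thesis
    by (intro that[of "(1 / norm a) *\<^sub>R a"]) (auto simp: scaleR_eq_vector_smult[symmetric])
qed

lemma holomorphic_ball_imp_continuous_on: "holomorphic_ball f \<Longrightarrow> continuous_on unit_ball f"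
  unfolding holomorphic_ball_iff
  by (intro continuous_at_imp_continuous_on ballI cdiff_at_imp_isCont) auto

lemma continuous_on_weight:
  "continuous_on (ball 0 1) (\<lambda>z :: 'a::real_normed_vector. defect z powr \<alpha>)"
proof (intro continuous_on_powr continuous_intros ballI)
  fix z :: 'a assume "z \<in> ball 0 1"
  then have "(norm z)\<^sup>2 < 1" by (simp add: power_less_one_iff)
  then show "defect z \<noteq> 0" by simp
qed

lemma continuous_on_norm_powr:
  fixes f :: "'a::topological_space \<Rightarrow> 'b::real_normed_vector" and p :: real
  assumes "continuous_on S f" "0 < p"
  shows "continuous_on S (\<lambda>z. norm (f z) powr p)"
  using assms by (intro continuous_on_powr' continuous_intros) auto

text \<open>In the coordinates of the ellipsoid the submean inequality is applied at the centre of
  the unit ball. Changing variables back contributes \<delta>^(n+1) from the Jacobian, and the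
  weight contributes \<delta>^\<alpha>.\<close>

lemma pointwise_estimate:
  fixes p \<alpha> :: real
  assumes "0 < p"
  obtains C :: real where "0 < C"
    "\<And>(f :: complex ^ 'n \<Rightarrow> complex) a. holomorphic_ball f \<Longrightarrow> a \<in> unit_ball \<Longrightarrow>
      ennreal (norm (f a) powr p * defect a powr (real CARD('n) + 1 + \<alpha>)) \<le>
      ennreal C * weighted_lint \<alpha> (\<lambda>z. norm (f z) powr p)"
proof -
  obtain C0 :: real where C0: "0 < C0"
    "\<And>u :: complex ^ 'n \<Rightarrow> real. submean_on_ball u \<Longrightarrow>
      ennreal (u 0 powr p) \<le> ennreal C0 * (\<integral>\<^sup>+x\<in>ball 0 1. ennreal (u x powr p) \<partial>lborel)"
    using submean_powr[OF assms, where 'a="complex ^ 'n"] by blast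
  define D where "D = DIM(complex ^ 'n)"
  define K where "K = (4 :: real) powr \<bar>\<alpha>\<bar>"
  \<comment> \<open>\<open>K\<close> compares the weight at \<open>a\<close> with the weight on the
    ellipsoid; \<open>4 ^ D\<close> undoes the dilation by 1/4 in all \<open>D\<close> real
    directions.\<close>
  define C where "C = C0 * (K * 4 ^ D)"
  have "ennreal (norm (f a) powr p * defect a powr (real CARD('n) + 1 + \<alpha>)) \<le>
      ennreal C * weighted_lint \<alpha> (\<lambda>z. norm (f z) powr p)"
    if f: "holomorphic_ball f" and a: "a \<in> unit_ball" for f :: "complex ^ 'n \<Rightarrow> complex" and a
  proof -
    obtain u where u: "norm u = 1" "a = of_real (norm a) *s u"
      by (rule unit_direction_exists) 
    define \<delta> where "\<delta> = defect a"
    have \<delta>: "0 < \<delta>" using norm_unit_ball_sq[OF a] by (simp add: \<delta>_def)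
    define L where "L w = (1 / 4) *\<^sub>R aniso u \<delta> w" for w
    have L: "bounded_linear L" "\<And>c v. L (c *s v) = c *s L v"
    proof -
      show "bounded_linear L"
        unfolding L_def using linear_aniso
        by (intro bounded_linear_scaleR_right[THEN bounded_linear_compose])
          (simp add: linear_conv_bounded_linear)
      show "L (c *s v) = c *s L v" for c v
        by (simp add: L_def aniso_smult scaleR_eq_vector_smult mult.commute)
    qed
    have box: "\<delta> \<le> 4 * (defect (a + L w))" "defect (a + L w) \<le> 4 * \<delta>"
      if "norm w \<le> 1" for w
      using aniso_box_bounds[OF u(1) _ _ that, of "norm a"] a u(2)
      by (simp_all add: L_def \<delta>_def flip: u(2))
    have in_ball: "a + L w \<in> unit_ball" if "norm w \<le> 1" for w
    proof -
      have "(norm (a + L w))\<^sup>2 < 1" using box[OF that] \<delta> by simp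
      then show ?thesis by (simp add: power_less_one_iff)
    qed
    define g where "g w = f (a + L w)" for w
    have g: "cdiff_at g w" if "w \<in> cball 0 1" for w
      unfolding g_def using f[unfolded holomorphic_ball_iff, rule_format, OF in_ball] that
      by (intro cdiff_at_compose_affine L) auto
    \<comment> \<open>The cut-off outside the closed ball makes the function measurable on the whole
      space, although nothing is known about \<open>f\<close> outside its domain.\<close>
    define U where "U w = indicator (cball 0 1) w *\<^sub>R norm (g w)" for w
    have cont: "continuous_on (cball 0 1) (\<lambda>w. norm (g w))"
      by (intro continuous_on_norm continuous_at_imp_continuous_on ballI cdiff_at_imp_isCont g)
    let ?J = "(\<integral>\<^sup>+x\<in>ball 0 1. ennreal (U x powr p) \<partial>lborel)"
    have "ennreal (U 0 powr p) \<le> ennreal C0 * ?J"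
    proof (rule C0(2), unfold submean_on_ball_def, intro conjI allI impI; (elim conjE)?)
      show "continuous_on (cball 0 1) U"
        by (rule continuous_on_eq[OF cont]) (auto simp: U_def)
      show "U \<in> borel_measurable borel"
        unfolding U_def by (rule borel_measurable_continuous_on_indicator[OF _ cont]) simp
      fix z :: "complex ^ 'n" and \<rho> :: real assume "0 < \<rho>" and sub: "cball z \<rho> \<subseteq> cball 0 1"
      then have z: "z \<in> cball 0 1" by (meson centre_in_cball less_imp_le subsetD)
      have "ennreal (U z) * emeasure lborel (ball z \<rho>) = ennreal (norm (g z)) * emeasure lborel (ball z \<rho>)"
        using z by (simp add: U_def)
      also have "\<dots> \<le> (\<integral>\<^sup>+x\<in>ball z \<rho>. ennreal (norm (g x)) \<partial>lborel)"
        using sub by (intro submean_ball g) blast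
      also have "\<dots> = (\<integral>\<^sup>+x\<in>ball z \<rho>. ennreal (U x) \<partial>lborel)"
      proof (intro nn_integral_cong)
        fix x :: "complex ^ 'n"
        have "x \<in> ball z \<rho> \<Longrightarrow> x \<in> cball 0 1" using sub ball_subset_cball by blast
        then show "ennreal (norm (g x)) * indicator (ball z \<rho>) x = ennreal (U x) * indicator (ball z \<rho>) x"
          by (auto simp: U_def indicator_def)
      qed
      finally show "ennreal (U z) * emeasure lborel (ball z \<rho>) \<le> (\<integral>\<^sup>+x\<in>ball z \<rho>. ennreal (U x) \<partial>lborel)" .
    qed (simp add: U_def)
    moreover have "U 0 = norm (f a)"
      using L(1) by (simp add: U_def g_def linear_simps)
    ultimately have 1: "ennreal (norm (f a) powr p) \<le>
      ennreal C0 * ?J" by simp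
    define H where "H z = ennreal (norm (f z) powr p * defect z powr \<alpha>) * indicator unit_ball z" for z
    let ?I = "\<integral>\<^sup>+x. H (a + L x) \<partial>lborel"
    have "continuous_on unit_ball (\<lambda>z. norm (f z) powr p * defect z powr \<alpha>)"
      using assms by (intro continuous_on_mult continuous_on_weight continuous_on_norm_powr
          holomorphic_ball_imp_continuous_on f)
    then have H [measurable]: "H \<in> borel_measurable borel"
      unfolding H_def by (intro borel_measurable_ennreal_indicator) auto
    have [measurable]: "L \<in> borel_measurable borel"
      using L(1) by (intro borel_measurable_continuous_onI linear_continuous_on)
    have "ennreal (\<delta> powr \<alpha>) * ?J
        = (\<integral>\<^sup>+x. ennreal (\<delta> powr \<alpha>) * (ennreal (U x powr p) * indicator (ball 0 1) x) \<partial>lborel)"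
    proof (rule nn_integral_cmult[symmetric])
      have "U \<in> borel_measurable borel"
        unfolding U_def by (rule borel_measurable_continuous_on_indicator[OF _ cont]) simp
      then show "(\<lambda>x. ennreal (U x powr p) * indicator (ball 0 1) x) \<in> borel_measurable lborel"
        by (auto intro!: borel_measurable_times_ennreal borel_measurable_indicator)
    qed
    also have "\<dots> \<le> (\<integral>\<^sup>+x. ennreal K * H (a + L x) \<partial>lborel)"
    proof (rule nn_integral_mono)
      fix x :: "complex ^ 'n"
      show "ennreal (\<delta> powr \<alpha>) * (ennreal (U x powr p) * indicator (ball 0 1) x) \<le> ennreal K * H (a + L x)"
      proof (cases "x \<in> ball 0 1")
        case True
        then have x: "norm x \<le> 1" by simp
        have pos: "0 < defect (a + L x)" using box(1)[OF x] \<delta> by simp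
        have "\<delta> powr \<alpha> \<le> K * (defect (a + L x)) powr \<alpha>"
          unfolding K_def using box[OF x] \<delta> pos by (intro powr_le_powr_cmult) auto
        then have "\<delta> powr \<alpha> * U x powr p \<le> K * (defect (a + L x)) powr \<alpha> * U x powr p"
          by (intro mult_right_mono) auto
        then show ?thesis
          using True in_ball[OF x] x
          by (simp add: H_def U_def g_def K_def mult_ac flip: ennreal_mult)
      qed simp
    qed
    also have "\<dots> = ennreal K * ?I"
      by (simp add: nn_integral_cmult)
    finally have 2: "ennreal (\<delta> powr \<alpha>) * ?J
        \<le> ennreal K * ?I" .
    have "(\<integral>\<^sup>+z. H z \<partial>lborel) = ennreal ((1/4) ^ D) * (\<integral>\<^sup>+v. H (a + (1/4) *\<^sub>R v) \<partial>lborel)"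
    proof -
      have "(\<integral>\<^sup>+z. H z \<partial>lborel) =
          (\<integral>\<^sup>+z. H z \<partial>(density (distr lborel borel (\<lambda>v. a + (1/4) *\<^sub>R v)) (\<lambda>_. ennreal ((1/4) ^ D))))"
        using lborel_affine[of "1/4" a] by (simp add: D_def)
      then show ?thesis by (simp add: nn_integral_density nn_integral_distr nn_integral_cmult)
    qed
    also have "(\<integral>\<^sup>+v. H (a + (1/4) *\<^sub>R v) \<partial>lborel) =
        ennreal (\<delta> ^ (CARD('n) + 1)) * ?I"
      unfolding L_def by (rule nn_integral_aniso[OF u(1) \<delta>, where g="\<lambda>v. H (a + (1/4) *\<^sub>R v)"]) measurable
    finally have 3: "(\<integral>\<^sup>+z. H z \<partial>lborel) =
      ennreal ((1/4) ^ D) * (ennreal (\<delta> ^ (CARD('n) + 1)) * ?I)" .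
    have pow: "ennreal (\<delta> ^ (CARD('n) + 1)) * ?I = ennreal (4 ^ D) * (\<integral>\<^sup>+z. H z \<partial>lborel)"
      unfolding 3 mult.assoc[symmetric] by (simp flip: ennreal_mult power_mult_distrib)
    have "ennreal (norm (f a) powr p * \<delta> powr (real CARD('n) + 1 + \<alpha>)) =
      ennreal (\<delta> ^ (CARD('n) + 1)) * (ennreal (\<delta> powr \<alpha>) * ennreal (norm (f a) powr p))"
      using \<delta> by (simp add: powr_add powr_realpow mult_ac flip: ennreal_mult)
    also have "\<dots> \<le> ennreal (\<delta> ^ (CARD('n) + 1)) * (ennreal (\<delta> powr \<alpha>) *
        (ennreal C0 * ?J))"
      by (intro mult_left_mono 1) auto
    also have "\<dots> = ennreal C0 * (ennreal (\<delta> ^ (CARD('n) + 1)) *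
        (ennreal (\<delta> powr \<alpha>) * ?J))"
      by (simp only: mult_ac)
    also have "\<dots> \<le> ennreal C0 * (ennreal (\<delta> ^ (CARD('n) + 1)) * (ennreal K * ?I))"
      by (intro mult_left_mono 2) auto
    also have "\<dots> = ennreal C0 * (ennreal K * (ennreal (\<delta> ^ (CARD('n) + 1)) * ?I))"
      by (simp only: mult_ac)
    also have "\<dots> = ennreal C * (\<integral>\<^sup>+z. H z \<partial>lborel)"
      unfolding pow using C0(1) by (simp add: C_def K_def ennreal_mult mult_ac)
    finally show ?thesis by (simp add: H_def \<delta>_def)
  qed
  moreover have "C > 0" using C0 by (simp add: C_def K_def)
  ultimately show ?thesis using that by blast
qed

section \<open>Integrals of the weight\<close>

lemma nn_integral_powr_from_0:
  fixes \<alpha> b :: real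
  assumes "- 1 < \<alpha>" "0 \<le> b"
  shows "(\<integral>\<^sup>+x. ennreal (x powr \<alpha> * indicator {0..b} x) \<partial>lborel) = ennreal (b powr (\<alpha> + 1) / (\<alpha> + 1))"
proof (rule nn_integral_has_integral_lborel)
  have "(\<lambda>x. x powr \<alpha> * indicator {0..b} x) = (\<lambda>x. if x \<in> {0..b} then x powr \<alpha> else 0)"
    by (simp add: fun_eq_iff indicator_def)
  then show "((\<lambda>x. x powr \<alpha> * indicator {0..b} x) has_integral b powr (\<alpha> + 1) / (\<alpha> + 1)) UNIV"
    using has_integral_powr_from_0[OF assms] by (simp only: has_integral_restrict_UNIV)
qed auto

text \<open>Averaging over the translations by \<open>t e\<close> with \<open>0 \<le> t \<le> T\<close> replaces Fubini's theorem in
  the direction \<open>e\<close>: along a line, \<open>1 - |z|\<^sup>2\<close> is comparable to the distance to the sphere.\<close>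

lemma slab_estimate:
  fixes \<alpha> m :: real
  assumes \<alpha>: "- 1 < \<alpha>" and m: "0 < m"
  obtains K :: real where "0 < K"
    "\<And>(e :: 'a::euclidean_space) T A B. \<lbrakk>norm e = 1; 0 < T; A \<in> sets borel; B \<in> sets borel;
      \<And>z. z \<in> A \<Longrightarrow> norm z < 1 \<and> m \<le> z \<bullet> e \<and> defect z \<le> T;
      \<And>z t. z \<in> A \<Longrightarrow> t \<in> {0..T} \<Longrightarrow> z - t *\<^sub>R e \<in> B\<rbrakk> \<Longrightarrow>
      (\<integral>\<^sup>+z\<in>A. ennreal (defect z powr \<alpha>) \<partial>lborel) \<le> ennreal (K * T powr \<alpha>) * emeasure lborel B"
proof -
  \<comment> \<open>Dominates both constants of m u \<le> c - y^2 \<le> 2 u, where \<open>u\<close>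
    is the distance to the sphere along the line.\<close>
  define M where "M = max 2 (1 / m)"
  have M: "2 \<le> M" "1 \<le> M * m" using m by (auto simp: M_def field_simps max_def)
  define K where "K = M powr \<bar>\<alpha>\<bar> * ((1 / m) powr (\<alpha> + 1) / (\<alpha> + 1))"
  have K: "K > 0" using M m \<alpha> by (simp add: K_def)
  have "(\<integral>\<^sup>+z\<in>A. ennreal (defect z powr \<alpha>) \<partial>lborel) \<le> ennreal (K * T powr \<alpha>) * emeasure lborel B"
    if e: "norm e = 1" and T: "0 < T" and [measurable]: "A \<in> sets borel" "B \<in> sets borel"
      and A: "\<And>z. z \<in> A \<Longrightarrow> norm z < 1 \<and> m \<le> z \<bullet> e \<and> defect z \<le> T"
      and B: "\<And>z t. z \<in> A \<Longrightarrow> t \<in> {0..T} \<Longrightarrow> z - t *\<^sub>R e \<in> B"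
    for e :: 'a and T A B
  proof -
    define g where "g z = ennreal (defect z powr \<alpha>) * indicator A z" for z
    have [measurable]: "g \<in> borel_measurable borel" unfolding g_def by measurable
    let ?L = "\<lambda>z. \<integral>\<^sup>+t. g (z + t *\<^sub>R e) * indicator {0..T} t \<partial>lborel" and ?G = "\<integral>\<^sup>+z. g z \<partial>lborel"
    have ee: "e \<bullet> e = 1" using e by (simp add: norm_eq_1)
    \<comment> \<open>From a point outside \<open>B\<close> no translate by \<open>t\<close> with 0
      \<le> t \<le> T reaches \<open>A\<close>; from a point of \<open>B\<close> the integral runs
      along a single line, on which the weight is integrable since \<alpha> > -1.\<close>
    have inner_le: "?L z \<le> ennreal (K * T powr (\<alpha> + 1)) * indicator B z"
      for z
    proof (cases "z \<in> B")
      case False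
      have "g (z + t *\<^sub>R e) * indicator {0..T} t = 0" for t
        using B[of "z + t *\<^sub>R e" t] False by (auto simp: g_def indicator_def)
      then show ?thesis by (simp only:) simp
    next
      case True
      define x where "x = z \<bullet> e"
      \<comment> \<open>One minus the squared norm of the component of \<open>z\<close> orthogonal
        to \<open>e\<close>; when it is positive, the line leaves the ball at height
        \<open>sqrt c\<close>.\<close>
      define c where "c = defect z + x\<^sup>2"
      have "\<bar>x\<bar> \<le> norm z" using Cauchy_Schwarz_ineq2[of z e] e by (simp add: x_def)
      then have "x\<^sup>2 \<le> (norm z)\<^sup>2" by (metis abs_ge_zero power2_abs power_mono)
      then have c1: "c \<le> 1" by (simp add: c_def)
      have norm_line: "defect (z + t *\<^sub>R e) = c - (x + t)\<^sup>2" for t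
        unfolding c_def x_def power2_norm_eq_inner
        by (simp add: inner_add ee inner_commute[of e z] power2_eq_square algebra_simps)
      let ?h = "\<lambda>u. ennreal (M powr \<bar>\<alpha>\<bar>) * ennreal (u powr \<alpha> * indicator {0..T / m} u)"
      have "g (z + t *\<^sub>R e) * indicator {0..T} t \<le> ?h ((sqrt c - x) + (-1) * t)" for t
      proof (cases "z + t *\<^sub>R e \<in> A")
        case True
        define y where "y = x + t"
        define u where "u = sqrt c - y"
        from A[OF True] have y: "m \<le> y" "c - y\<^sup>2 \<le> T" and n1: "norm (z + t *\<^sub>R e) < 1"
          unfolding norm_line by (auto simp: y_def x_def inner_add ee)
        have "(norm (z + t *\<^sub>R e))\<^sup>2 < 1" using n1 by (simp add: power_less_one_iff)
        then have pos: "0 < c - y\<^sup>2" using norm_line[of t] by (simp add: y_def)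
        have y_lt: "y < sqrt c" using pos y m by (intro real_less_rsqrt) auto
        have c0: "0 < c" using pos by (smt (verit) zero_le_power2)
        \<comment> \<open>The factor \<open>u\<close> is the distance to the exit point along the
          line, and the other factor lies between \<open>m\<close> and 2.\<close>
        have fact: "c - y\<^sup>2 = u * (sqrt c + y)"
          using c0 by (simp add: u_def algebra_simps power2_eq_square)
        have sq1: "sqrt c \<le> 1" using c1 by simp
        have u0: "0 < u" using y_lt by (simp add: u_def)
        have lo: "m * u \<le> c - y\<^sup>2"
          unfolding fact mult.commute[of m] using u0 y y_lt m by (intro mult_left_mono) auto
        have hi: "c - y\<^sup>2 \<le> 2 * u"
          unfolding fact mult.commute[of 2] using u0 y_lt sq1 by (intro mult_left_mono) linarith+
        have "(c - y\<^sup>2) powr \<alpha> \<le> M powr \<bar>\<alpha>\<bar> * u powr \<alpha>"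
        proof (rule powr_le_powr_cmult)
          show "c - y\<^sup>2 \<le> M * u" using hi mult_right_mono[OF M(1), of u] u0 by linarith
          have "1 * u \<le> (M * m) * u" using M(2) u0 by (intro mult_right_mono) auto
          also have "\<dots> \<le> M * (c - y\<^sup>2)"
            using lo M(1) by (simp add: mult.assoc mult_left_mono)
          finally show "u \<le> M * (c - y\<^sup>2)" by simp
        qed (use pos u0 M in auto)
        moreover have "u \<le> T / m" using lo y(2) m by (simp add: field_simps)
        moreover have "(sqrt c - x) + (-1) * t = u" by (simp add: u_def y_def)
        ultimately show ?thesis
          using True u0 norm_line[of t]
          by (auto simp: g_def y_def indicator_def simp flip: ennreal_mult intro!: ennreal_leI)
      qed (simp add: g_def)
      then have "?L z \<le> (\<integral>\<^sup>+t. ?h ((sqrt c - x) + (-1) * t) \<partial>lborel)"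
        by (intro nn_integral_mono) auto
      also have "\<dots> = (\<integral>\<^sup>+u. ?h u \<partial>lborel)"
        by (subst (2) nn_integral_real_affine[where c="-1" and t="sqrt c - x"]) auto
      also have "\<dots> = ennreal (M powr \<bar>\<alpha>\<bar>) * ennreal ((T / m) powr (\<alpha> + 1) / (\<alpha> + 1))"
        using \<alpha> T m by (simp add: nn_integral_cmult nn_integral_powr_from_0)
      also have "\<dots> = ennreal (K * T powr (\<alpha> + 1))"
        using T m \<alpha> by (simp add: K_def powr_divide divide_simps mult_ac flip: ennreal_mult)
      finally show ?thesis using True by simp
    qed
    have shift: "(\<integral>\<^sup>+z. g (z + v) \<partial>lborel) = ?G" for v
      using nn_integral_lborel_translate[of g v] by (simp add: add.commute)
    have "ennreal T * ?G = (\<integral>\<^sup>+t. ?G * indicator {0..T} t \<partial>lborel)"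
      using T by (simp add: nn_integral_cmult_indicator mult.commute)
    also have "\<dots> = (\<integral>\<^sup>+t. (\<integral>\<^sup>+z. g (z + t *\<^sub>R e) * indicator {0..T} t \<partial>lborel) \<partial>lborel)"
      by (simp add: nn_integral_multc shift)
    also have "\<dots> = (\<integral>\<^sup>+z. ?L z \<partial>lborel)"
      by (rule lborel_pair.Fubini') measurable
    also have "\<dots> \<le> (\<integral>\<^sup>+z. ennreal (K * T powr (\<alpha> + 1)) * indicator B z \<partial>lborel)"
      by (intro nn_integral_mono inner_le)
    also have "\<dots> = ennreal (K * T powr (\<alpha> + 1)) * emeasure lborel B"
      by (simp add: nn_integral_cmult_indicator)
    finally have le: "ennreal T * ?G \<le> ennreal (K * T powr (\<alpha> + 1)) * emeasure lborel B" .
    have "?G = ennreal (1 / T) * (ennreal T * ?G)"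
      using T by (simp flip: ennreal_mult mult.assoc)
    also have "\<dots> \<le> ennreal (1 / T) * (ennreal (K * T powr (\<alpha> + 1)) * emeasure lborel B)"
      by (intro mult_left_mono le) auto
    also have "\<dots> = ennreal (K * T powr \<alpha>) * emeasure lborel B"
      using T K by (simp add: powr_add flip: ennreal_mult mult.assoc)
    finally show ?thesis by (simp add: g_def)
  qed
  with K show ?thesis by (rule that)
qed

text \<open>The ball is covered by its half-size concentric ball, where the weight is bounded, and
  by the parts where some coordinate is at least \<open>m\<close> in modulus, which the slab
  estimate handles. If |z| \<ge> 1/2, such a coordinate exists, because otherwise the sum of the
  moduli would be below dim times \<open>m\<close>, which is 1/2.\<close>

lemma weight_integral_finite:
  fixes \<alpha> :: real
  assumes \<alpha>: "- 1 < \<alpha>"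
  shows "(\<integral>\<^sup>+z\<in>ball 0 1. ennreal (defect z powr \<alpha>) \<partial>(lborel :: 'a::euclidean_space measure)) < \<infinity>"
proof -
  let ?W = "\<lambda>z :: 'a. ennreal (defect z powr \<alpha>)"
  define m where "m = 1 / (2 * real DIM('a))"
  have m: "0 < m" by (simp add: m_def)
  obtain K :: real where K: "0 < K"
    "\<And>(e :: 'a) T A B. \<lbrakk>norm e = 1; 0 < T; A \<in> sets borel; B \<in> sets borel;
      \<And>z. z \<in> A \<Longrightarrow> norm z < 1 \<and> m \<le> z \<bullet> e \<and> defect z \<le> T;
      \<And>z t. z \<in> A \<Longrightarrow> t \<in> {0..T} \<Longrightarrow> z - t *\<^sub>R e \<in> B\<rbrakk> \<Longrightarrow>
      (\<integral>\<^sup>+z\<in>A. ?W z \<partial>lborel) \<le> ennreal (K * T powr \<alpha>) * emeasure lborel B"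
    using slab_estimate[OF \<alpha> m, where 'a='a] by blast
  have [measurable]: "ball z r \<in> sets borel" for z :: 'a and r by simp
  define A where "A e = {z :: 'a. norm z < 1 \<and> m \<le> z \<bullet> e}" for e
  have A [measurable]: "A e \<in> sets borel" for e unfolding A_def by measurable
  have fin: "(\<integral>\<^sup>+z\<in>A e. ?W z \<partial>lborel) < \<infinity>" if e: "norm e = 1" for e
  proof -
    have "(\<integral>\<^sup>+z\<in>A e. ?W z \<partial>lborel) \<le> ennreal (K * 1 powr \<alpha>) * emeasure lborel (ball (0::'a) 3)"
    proof (rule K(2)[OF e])
      show "z - t *\<^sub>R e \<in> ball 0 3" if "z \<in> A e" "t \<in> {0..1}" for z t
        using that e norm_triangle_ineq4[of z "t *\<^sub>R e"] by (simp add: A_def)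
    qed (auto simp: A_def)
    also have "\<dots> < \<infinity>"
      using emeasure_lborel_ball_finite[of "0::'a" 3] by (simp add: ennreal_mult_less_top)
    finally show ?thesis .
  qed
  \<comment> \<open>On the inner ball 1 - |z|^2 lies between 3/4 and 1, so this maximum bounds the
    weight for either sign of \<alpha>.\<close>
  define c where "c = max 1 ((3 / 4 :: real) powr \<alpha>)"
  have "(\<integral>\<^sup>+z\<in>ball 0 1. ?W z \<partial>lborel) \<le>
      (\<integral>\<^sup>+z. ennreal c * indicator (ball 0 1) z +
        (\<Sum>b\<in>Basis. ?W z * indicator (A b) z + ?W z * indicator (A (- b)) z) \<partial>lborel)"
  proof (rule nn_integral_mono)
    fix z :: 'a
    show "?W z * indicator (ball 0 1) z \<le> ennreal c * indicator (ball 0 1) z +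
        (\<Sum>b\<in>Basis. ?W z * indicator (A b) z + ?W z * indicator (A (- b)) z)"
    proof (cases "z \<in> ball 0 1")
      case True
      show ?thesis
      proof (cases "norm z < 1 / 2")
        case T': True
        have "(norm z)\<^sup>2 \<le> (1 / 2)\<^sup>2" using T' by (intro power_mono) auto
        then have n: "3 / 4 \<le> defect z" by (simp add: power2_eq_square)
        have "defect z powr \<alpha> \<le> c"
        proof (cases "\<alpha> \<ge> 0")
          case True
          then have "defect z powr \<alpha> \<le> 1 powr \<alpha>" using n by (intro powr_mono2) auto
          then show ?thesis by (simp add: c_def)
        next
          case False
          then have "defect z powr \<alpha> \<le> (3 / 4) powr \<alpha>" using n by (intro powr_mono2') auto
          then show ?thesis by (simp add: c_def)
        qed
        then show ?thesis using True by (simp add: add_increasing2 ennreal_leI)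
      next
        case F': False
        have "\<exists>b\<in>Basis. m \<le> \<bar>z \<bullet> b\<bar>"
        proof (rule ccontr)
          assume "\<not> (\<exists>b\<in>Basis. m \<le> \<bar>z \<bullet> b\<bar>)"
          then have "(\<Sum>b\<in>Basis. \<bar>z \<bullet> b\<bar>) < (\<Sum>b\<in>(Basis :: 'a set). m)"
            by (intro sum_strict_mono) auto
          then show False using norm_le_l1[of z] F' by (simp add: m_def)
        qed
        then obtain b where b: "b \<in> Basis" "m \<le> \<bar>z \<bullet> b\<bar>" by blast
        then have "z \<in> A b \<or> z \<in> A (- b)" using True by (auto simp: A_def abs_if split: if_splits)
        then have "?W z \<le> ?W z * indicator (A b) z + ?W z * indicator (A (- b)) z"
          by (auto simp: add_increasing add_increasing2)
        also have "\<dots> \<le> (\<Sum>b\<in>Basis. ?W z * indicator (A b) z + ?W z * indicator (A (- b)) z)"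
          using b(1) by (intro member_le_sum) auto
        finally show ?thesis using True by (simp add: add_increasing)
      qed
    qed simp
  qed
  also have "\<dots> = ennreal c * emeasure lborel (ball (0::'a) 1) +
      (\<Sum>b\<in>Basis. (\<integral>\<^sup>+z\<in>A b. ?W z \<partial>lborel) + (\<integral>\<^sup>+z\<in>A (- b). ?W z \<partial>lborel))"
    by (subst nn_integral_add; (subst nn_integral_sum)?) (auto simp: nn_integral_cmult_indicator nn_integral_add)
  also have "\<dots> < \<infinity>"
    using emeasure_lborel_ball_finite[of "0::'a" 1] fin
    by (auto simp: ennreal_mult_less_top)
  finally show ?thesis .
qed

text \<open>For small \<eta> the set, even after shifts by at most 2 \<eta> along -u, lies in an
  ellipsoid around u = a/|a| with radii of order \<eta> and \<open>sqrt \<eta>\<close>. Its volume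
  has order \<eta>^(n+1), and the slab estimate with T = 2 \<eta> contributes \<eta>^\<alpha>. For
  the remaining \<eta> the integral over the whole ball is enough.\<close>

lemma nonisotropic_ball_estimate:
  fixes \<alpha> :: real
  assumes \<alpha>: "- 1 < \<alpha>"
  obtains K :: real where "0 < K"
    "\<And>(a :: complex ^ 'n) \<eta>. a \<in> unit_ball \<Longrightarrow> 0 < \<eta> \<Longrightarrow>
      (\<integral>\<^sup>+z\<in>{z \<in> unit_ball. norm (1 - cdot z a) < \<eta>}. ennreal (defect z powr \<alpha>) \<partial>lborel)
      \<le> ennreal (K * \<eta> powr (real CARD('n) + 1 + \<alpha>))"
proof -
  let ?W = "\<lambda>z :: complex ^ 'n. ennreal (defect z powr \<alpha>)"
  define N where "N = real CARD('n) + 1 + \<alpha>"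
  have N: "0 < N" using \<alpha> by (simp add: N_def)
  obtain K :: real where K: "0 < K"
    "\<And>(e :: complex ^ 'n) T A B. \<lbrakk>norm e = 1; 0 < T; A \<in> sets borel; B \<in> sets borel;
      \<And>z. z \<in> A \<Longrightarrow> norm z < 1 \<and> 1 / 2 \<le> z \<bullet> e \<and> defect z \<le> T;
      \<And>z t. z \<in> A \<Longrightarrow> t \<in> {0..T} \<Longrightarrow> z - t *\<^sub>R e \<in> B\<rbrakk> \<Longrightarrow>
      (\<integral>\<^sup>+z\<in>A. ?W z \<partial>lborel) \<le> ennreal (K * T powr \<alpha>) * emeasure lborel B"
    using slab_estimate[OF \<alpha> half_gt_zero[OF zero_less_one], where 'a="complex ^ 'n"] by blast
  have "(\<integral>\<^sup>+z\<in>unit_ball. ?W z \<partial>lborel) < \<infinity>" by (rule weight_integral_finite[OF \<alpha>])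
  then obtain V where V: "0 \<le> V" "(\<integral>\<^sup>+z\<in>unit_ball. ?W z \<partial>lborel) = ennreal V"
    by (cases "(\<integral>\<^sup>+z\<in>unit_ball. ?W z \<partial>lborel)") auto
  define v where "v = measure lborel (cball (0 :: complex ^ 'n) 8)"
  have v: "emeasure lborel (cball (0 :: complex ^ 'n) 8) = ennreal v"
    using emeasure_lborel_cball_finite[of "0 :: complex ^ 'n" 8]
    by (simp add: v_def emeasure_eq_ennreal_measure less_top)
  \<comment> \<open>The first term serves \<eta> \<ge> 1/8, where (8 \<eta>)^N \<ge> 1; the second
    serves \<eta> < 1/8; the third makes the constant positive.\<close>
  define C where "C = V * 8 powr N + K * 2 powr \<alpha> * v + 1"
  have C: "C > 0" "V * 8 powr N \<le> C" "K * 2 powr \<alpha> * v \<le> C"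
    using V K by (auto simp: C_def v_def add_nonneg_pos)
  have "(\<integral>\<^sup>+z\<in>{z \<in> unit_ball. norm (1 - cdot z a) < \<eta>}. ?W z \<partial>lborel) \<le> ennreal (C * \<eta> powr N)"
    if a: "a \<in> unit_ball" and \<eta>: "0 < \<eta>" for a :: "complex ^ 'n" and \<eta>
  proof (cases "\<eta> < 1 / 8")
    case False
    have "(\<integral>\<^sup>+z\<in>{z \<in> unit_ball. norm (1 - cdot z a) < \<eta>}. ?W z \<partial>lborel) \<le> ennreal V"
      unfolding V(2)[symmetric] by (intro nn_integral_mono) (auto simp: indicator_def)
    also have "ennreal V \<le> ennreal (C * \<eta> powr N)"
    proof (rule ennreal_leI)
      have "V * 1 \<le> V * (8 * \<eta>) powr N"
        using False N V by (intro mult_left_mono ge_one_powr_ge_zero) auto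
      also have "\<dots> = V * 8 powr N * \<eta> powr N" using \<eta> by (simp add: powr_mult)
      also have "\<dots> \<le> C * \<eta> powr N" using C by (intro mult_right_mono) auto
      finally show "V \<le> C * \<eta> powr N" by simp
    qed
    finally show ?thesis .
  next
    case True
    obtain u where u: "norm u = 1" "a = of_real (norm a) *s u"
      by (rule unit_direction_exists)
    define A where "A = {z \<in> unit_ball. norm (1 - cdot z a) < \<eta>}"
    \<comment> \<open>The ellipsoid around \<open>u\<close> with radius 8 \<eta> along
      \<open>u\<close> and 8 \<open>sqrt \<eta>\<close> orthogonally. The radius is generous: the
      squared rescaled norm found below is at most 4^2 + 2.\<close>
    define B where "B = {x. aniso u (1 / \<eta>) (x - u) \<in> cball 0 8}"
    have [measurable]: "cball (0 :: complex ^ 'n) 8 \<in> sets borel" by simp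
    have [measurable]: "B \<in> sets borel" unfolding B_def by measurable
    have "continuous_on UNIV (\<lambda>z. norm (1 - cdot z a))"
      unfolding cdot_def by (intro continuous_intros)
    then have [measurable]: "(\<lambda>z. norm (1 - cdot z a)) \<in> borel_measurable borel"
      by (rule borel_measurable_continuous_onI)
    have [measurable]: "unit_ball \<in> sets (borel :: (complex ^ 'n) measure)" by simp
    have [measurable]: "A \<in> sets borel" unfolding A_def by measurable
    \<comment> \<open>The centre \<open>a\<close> is replaced by the boundary point
      \<open>u\<close>. If the set is nonempty then 1 - |a| \<le> \<eta>, so passing from
      \<open>a\<close> to \<open>u\<close> changes the inner product by at most \<eta>.\<close>
    have props: "norm z < 1" "1 - \<eta> \<le> Re (cdot z u)" "(norm z)\<^sup>2 \<ge> (1 - \<eta>)\<^sup>2"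
        "norm (1 - cdot z u) \<le> 2 * \<eta>" "(1 - \<eta>)\<^sup>2 \<le> (norm (cdot z u))\<^sup>2" if "z \<in> A" for z
    proof -
      have z: "norm z < 1" "norm (1 - cdot z a) < \<eta>" using that by (auto simp: A_def)
      have za: "cdot z a = of_real (norm a) * cdot z u" by (subst u(2)) (simp add: cdot_simps)
      have "1 - Re (cdot z a) \<le> \<eta>" using abs_Re_le_cmod[of "1 - cdot z a"] z by simp
      then have re: "1 - \<eta> \<le> norm a * Re (cdot z u)" by (simp add: za)
      then have "0 < norm a * Re (cdot z u)" using True by linarith
      then have pos: "0 < Re (cdot z u)" by (simp add: zero_less_mult_iff)
      have "norm a * Re (cdot z u) \<le> 1 * Re (cdot z u)"
        using a pos by (intro mult_right_mono) auto
      then show re': "1 - \<eta> \<le> Re (cdot z u)" using re by simp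
      have zu: "norm (cdot z u) \<le> norm z" using norm_cdot_le[of z u] u by simp
      have re_le: "Re (cdot z u) \<le> norm (cdot z u)" by (rule complex_Re_le_cmod)
      show "norm z < 1" by (rule z)
      show "(norm z)\<^sup>2 \<ge> (1 - \<eta>)\<^sup>2" using re' re_le zu True by (intro power_mono) auto
      show "(1 - \<eta>)\<^sup>2 \<le> (norm (cdot z u))\<^sup>2" using re' re_le True by (intro power_mono) auto
      have "norm a * Re (cdot z u) \<le> norm a * 1"
        using re_le zu z by (intro mult_left_mono) auto
      then have a1: "1 - norm a \<le> \<eta>" using re by simp
      have "1 - cdot z u = (1 - cdot z a) - of_real (1 - norm a) * cdot z u"
        by (simp add: za algebra_simps)
      then have "norm (1 - cdot z u) \<le> norm (1 - cdot z a) + norm (of_real (1 - norm a) * cdot z u)"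
        by (metis norm_triangle_ineq4)
      also have "norm (of_real (1 - norm a) * cdot z u) \<le> (1 - norm a) * 1"
        using zu z a unfolding norm_mult norm_of_real by (intro mult_mono) auto
      finally show "norm (1 - cdot z u) \<le> 2 * \<eta>" using a1 z by simp
    qed
    have "(\<integral>\<^sup>+z\<in>A. ?W z \<partial>lborel) \<le> ennreal (K * (2 * \<eta>) powr \<alpha>) * emeasure lborel B"
    proof (rule K(2)[OF u(1)])
      show "norm z < 1 \<and> 1 / 2 \<le> z \<bullet> u \<and> defect z \<le> 2 * \<eta>" if "z \<in> A" for z
      proof -
        have "defect z \<le> 2 * \<eta> - \<eta>\<^sup>2"
          using props(3)[OF that] by (simp add: power2_eq_square algebra_simps)
        then have "defect z \<le> 2 * \<eta>" using zero_le_power2[of \<eta>] by linarith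
        then show ?thesis using props[OF that] True \<eta> by (auto simp flip: Re_cdot)
      qed
      show "z - t *\<^sub>R u \<in> B" if z: "z \<in> A" and t: "t \<in> {0..2 * \<eta>}" for z t
      proof -
        define x where "x = z - t *\<^sub>R u - u"
        define Q where "Q = z - cdot z u *s u"
        have uu: "cdot u u = 1" using u by (simp add: cdot_self)
        have c: "cdot x u = cdot z u - 1 - of_real t"
          by (simp add: x_def cdot_simps uu scaleR_eq_vector_smult)
        have xQ: "x - cdot x u *s u = Q"
          unfolding c by (simp add: x_def Q_def scaleR_eq_vector_smult vec_eq_iff algebra_simps)
        have Qu: "cdot (sqrt (1 / \<eta>) *\<^sub>R Q) u = 0"
          by (simp add: Q_def cdot_simps uu scaleR_eq_vector_smult)
        have "(norm (aniso u (1 / \<eta>) x))\<^sup>2 = (norm (of_real (1 / \<eta>) * cdot x u))\<^sup>2 + (norm (sqrt (1 / \<eta>) *\<^sub>R Q))\<^sup>2"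
          unfolding aniso_unit[OF u(1)] xQ by (rule norm_add_cdot_orthogonal[OF u(1) Qu])
        also have "\<dots> = (norm (cdot x u) / \<eta>)\<^sup>2 + (norm Q)\<^sup>2 / \<eta>"
          using \<eta> by (simp add: norm_mult norm_divide power_mult_distrib power_divide)
        also have "(norm (cdot x u) / \<eta>)\<^sup>2 \<le> 4\<^sup>2"
        proof (rule power_mono)
          have "norm (cdot x u) \<le> norm (cdot z u - 1) + norm (of_real t :: complex)"
            unfolding c by (rule norm_triangle_ineq4)
          also have "\<dots> \<le> 4 * \<eta>" using props(4)[OF z] t by (simp add: norm_minus_commute)
          finally show "norm (cdot x u) / \<eta> \<le> 4" using \<eta> by (simp add: field_simps)
        qed (use \<eta> in simp)
        also have "(norm Q)\<^sup>2 \<le> 2 * \<eta>"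
        proof -
          have "(norm Q)\<^sup>2 = (norm z)\<^sup>2 - (norm (cdot z u))\<^sup>2"
            using norm_decompose[OF u(1), of z] by (simp add: Q_def)
          also have "\<dots> \<le> 1 - (1 - \<eta>)\<^sup>2"
            using props(1,5)[OF z] power_le_one[of "norm z" 2] by simp
          also have "\<dots> \<le> 2 * \<eta>" by (simp add: power2_eq_square algebra_simps)
          finally show ?thesis .
        qed
        finally have "(norm (aniso u (1 / \<eta>) x))\<^sup>2 \<le> 8\<^sup>2" using \<eta> by (simp add: divide_right_mono)
        then have "norm (aniso u (1 / \<eta>) x) \<le> 8" by (rule power2_le_imp_le) simp
        then show ?thesis by (simp add: B_def x_def)
      qed
    qed (use \<eta> in auto)
    also have "emeasure lborel B = ennreal (\<eta> ^ (CARD('n) + 1) * v)"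
    proof -
      have "emeasure lborel B = (\<integral>\<^sup>+x. indicator (cball 0 8) (aniso u (1 / \<eta>) (- u + x)) \<partial>lborel)"
        unfolding nn_integral_indicator[symmetric, OF \<open>B \<in> sets borel\<close>[folded sets_lborel]]
        by (intro nn_integral_cong) (auto simp: B_def indicator_def)
      also have "\<dots> = (\<integral>\<^sup>+x. indicator (cball 0 8) (aniso u (1 / \<eta>) x) \<partial>lborel)"
        by (rule nn_integral_lborel_translate[where g="\<lambda>x. indicator (cball 0 8) (aniso u (1 / \<eta>) x)"]) measurable
      finally have B: "emeasure lborel B = (\<integral>\<^sup>+x. indicator (cball 0 8) (aniso u (1 / \<eta>) x) \<partial>lborel)" .
      have "ennreal v = (\<integral>\<^sup>+x. indicator (cball (0 :: complex ^ 'n) 8) x \<partial>lborel)" by (simp add: v)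
      also have "\<dots> = ennreal ((1 / \<eta>) ^ (CARD('n) + 1)) * emeasure lborel B"
        unfolding B using \<eta> by (intro nn_integral_aniso[OF u(1)]) auto
      finally have "ennreal (\<eta> ^ (CARD('n) + 1)) * ennreal v =
          ennreal (\<eta> ^ (CARD('n) + 1)) * ennreal ((1 / \<eta>) ^ (CARD('n) + 1)) * emeasure lborel B"
        by (simp add: mult.assoc)
      also have "\<dots> = emeasure lborel B"
        using \<eta> by (simp flip: ennreal_mult power_mult_distrib)
      finally show ?thesis using \<eta> by (simp add: ennreal_mult v_def)
    qed
    also have "ennreal (K * (2 * \<eta>) powr \<alpha>) * ennreal (\<eta> ^ (CARD('n) + 1) * v) = ennreal (K * 2 powr \<alpha> * v * \<eta> powr N)"
    proof -
      have "\<eta> powr N = \<eta> ^ (CARD('n) + 1) * \<eta> powr \<alpha>"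
        unfolding N_def powr_add using \<eta> by (simp add: powr_realpow)
      then show ?thesis using \<eta> K(1) by (simp add: powr_mult v_def mult_ac flip: ennreal_mult)
    qed
    also have "\<dots> \<le> ennreal (C * \<eta> powr N)"
      using C by (intro ennreal_leI mult_right_mono) auto
    finally show ?thesis by (simp add: A_def)
  qed
  with C(1) show ?thesis unfolding N_def by (rule that)
qed

text \<open>Where |1 - \<langle>z,a\<rangle>| has size 2^j \<delta>, the integrand has size (2^j
  \<delta>)^(-\<beta>) and the mass is at most of order (2^j \<delta>)^N. The sum over
  \<open>j\<close> is geometric with ratio 2^(N-\<beta>), which is below 1 because \<beta> >
  N.\<close>

lemma forelli_rudin_estimate:
  fixes \<alpha> \<beta> :: real
  assumes \<alpha>: "- 1 < \<alpha>" and \<beta>: "real CARD('n) + 1 + \<alpha> < \<beta>"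
  obtains K :: real where "0 < K"
    "\<And>a :: complex ^ 'n. a \<in> unit_ball \<Longrightarrow>
      weighted_lint \<alpha> (\<lambda>z. norm (1 - cdot z a) powr (- \<beta>))
      \<le> ennreal (K * defect a powr (real CARD('n) + 1 + \<alpha> - \<beta>))"
proof -
  let ?W = "\<lambda>z :: complex ^ 'n. ennreal (defect z powr \<alpha>)"
  define N where "N = real CARD('n) + 1 + \<alpha>"
  have N: "0 < N" "N < \<beta>" using \<alpha> \<beta> by (simp_all add: N_def)
  obtain K :: real where K: "0 < K"
    "\<And>(a :: complex ^ 'n) \<eta>. a \<in> unit_ball \<Longrightarrow> 0 < \<eta> \<Longrightarrow>
      (\<integral>\<^sup>+z\<in>{z \<in> unit_ball. norm (1 - cdot z a) < \<eta>}. ?W z \<partial>lborel) \<le> ennreal (K * \<eta> powr (real CARD('n) + 1 + \<alpha>))"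
    using nonisotropic_ball_estimate[OF \<alpha>, where 'n='n] by blast
  note K = K(1) K(2)[folded N_def]
  define r where "r = 2 powr (N - \<beta>)"
  have "2 powr (N - \<beta>) < 2 powr 0" using N by (intro powr_less_mono) auto
  then have r: "0 < r" "r < 1" by (simp_all add: r_def)
  define C where "C = K * 2 powr \<beta> * (1 / (1 - r))"
  have "weighted_lint \<alpha> (\<lambda>z. norm (1 - cdot z a) powr (- \<beta>))
      \<le> ennreal (C * defect a powr (N - \<beta>))"
    if a: "a \<in> unit_ball" for a :: "complex ^ 'n"
  proof -
    define \<delta> where "\<delta> = defect a"
    have \<delta>: "0 < \<delta>" using norm_unit_ball_sq[OF a] by (simp add: \<delta>_def)
    define E where "E j = {z \<in> unit_ball. norm (1 - cdot z a) < 2 ^ j * \<delta>}" for j :: nat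
    \<comment> \<open>If \<open>j\<close> is least with x < 2^j \<delta>, then x \<ge> 2^j \<delta>
      / 2. For \<open>j = 0\<close> this holds because x \<ge> 1 - |a| \<ge> \<delta> / 2.\<close>
    define c where "c j = (2 ^ j * \<delta> / 2) powr (- \<beta>)" for j :: nat
    let ?G = "\<lambda>z. \<Sum>j. ennreal (c j) * (?W z * indicator (E j) z)"
    have "continuous_on UNIV (\<lambda>z. norm (1 - cdot z a))"
      unfolding cdot_def by (intro continuous_intros)
    then have [measurable]: "(\<lambda>z. norm (1 - cdot z a)) \<in> borel_measurable borel"
      by (rule borel_measurable_continuous_onI)
    have [measurable]: "unit_ball \<in> sets (borel :: (complex ^ 'n) measure)" by simp
    have [measurable]: "E j \<in> sets borel" for j unfolding E_def by measurable
    have pt: "ennreal (norm (1 - cdot z a) powr (- \<beta>) * defect z powr \<alpha>) * indicator unit_ball z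
        \<le> ?G z" for z
    proof (cases "z \<in> unit_ball")
      case True
      define x where "x = norm (1 - cdot z a)"
      obtain j0 where "2 / \<delta> < 2 ^ j0" using real_arch_pow[of 2 "2 / \<delta>"] by auto
      then have j0: "2 < 2 ^ j0 * \<delta>" using \<delta> by (simp add: field_simps)
      have za: "norm (cdot z a) \<le> norm a"
        using norm_cdot_le[of z a] True mult_right_mono[of "norm z" 1 "norm a"] by simp
      have "x \<le> 1 + norm (cdot z a)" unfolding x_def using norm_triangle_ineq4[of 1 "cdot z a"] by simp
      then have ex: "x < 2 ^ j0 * \<delta>" using za a j0 by simp
      have "1 - norm (cdot z a) \<le> x"
        unfolding x_def using norm_triangle_ineq2[of 1 "cdot z a"] by simp
      moreover have "\<delta> / 2 \<le> 1 - norm a"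
        using zero_le_power2[of "1 - norm a"] by (simp add: \<delta>_def power2_diff)
      ultimately have low: "\<delta> / 2 \<le> x" using za by linarith
      define j where "j = (LEAST j. x < 2 ^ j * \<delta>)"
      have j: "x < 2 ^ j * \<delta>" unfolding j_def by (rule LeastI[of _ j0]) (rule ex)
      have lj: "2 ^ j * \<delta> / 2 \<le> x"
      proof (cases j)
        case (Suc i)
        then have "\<not> x < 2 ^ i * \<delta>" unfolding j_def by (intro not_less_Least) auto
        then show ?thesis using Suc by simp
      qed (use low in simp)
      have "x powr (- \<beta>) \<le> c j"
        unfolding c_def using lj \<delta> N by (intro powr_mono2') auto
      then have "x powr (- \<beta>) * defect z powr \<alpha> \<le> c j * defect z powr \<alpha>"
        by (intro mult_right_mono) auto
      then have "ennreal (x powr (- \<beta>) * defect z powr \<alpha>) * indicator unit_ball z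
          \<le> ennreal (c j) * (?W z * indicator (E j) z)"
        using True j by (simp add: E_def x_def c_def ennreal_leI flip: ennreal_mult)
      also have "\<dots> \<le> ?G z"
        using sum_le_suminf[of "\<lambda>j. ennreal (c j) * (?W z * indicator (E j) z)" "{j}"] by simp
      finally show ?thesis by (simp add: x_def)
    qed simp
    have "weighted_lint \<alpha> (\<lambda>z. norm (1 - cdot z a) powr (- \<beta>))
        \<le> (\<integral>\<^sup>+z. ?G z \<partial>lborel)"
      by (intro nn_integral_mono pt)
    also have "\<dots> = (\<Sum>j. ennreal (c j) * (\<integral>\<^sup>+z\<in>E j. ?W z \<partial>lborel))"
      by (subst nn_integral_suminf) (auto simp: nn_integral_cmult)
    also have "\<dots> \<le> (\<Sum>j. ennreal (K * 2 powr \<beta> * \<delta> powr (N - \<beta>) * r ^ j))"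
    proof (intro suminf_le summableI allI)
      fix j
      have "ennreal (c j) * (\<integral>\<^sup>+z\<in>E j. ?W z \<partial>lborel) \<le> ennreal (c j) * ennreal (K * (2 ^ j * \<delta>) powr N)"
        unfolding E_def using a \<delta> by (intro mult_left_mono K(2)) auto
      also have "\<dots> = ennreal (c j * (K * (2 ^ j * \<delta>) powr N))"
        using K(1) by (simp add: c_def ennreal_mult)
      also have "c j * (K * (2 ^ j * \<delta>) powr N) = K * 2 powr \<beta> * ((2 ^ j * \<delta>) powr (- \<beta>) * (2 ^ j * \<delta>) powr N)"
        using \<delta> by (simp add: c_def powr_divide powr_minus divide_simps mult_ac)
      also have "(2 ^ j * \<delta>) powr (- \<beta>) * (2 ^ j * \<delta>) powr N = (2 ^ j * \<delta>) powr (N - \<beta>)"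
        by (simp flip: powr_add)
      also have "\<dots> = (2 ^ j) powr (N - \<beta>) * \<delta> powr (N - \<beta>)"
        using \<delta> by (simp add: powr_mult)
      also have "(2 ^ j) powr (N - \<beta>) = r ^ j"
        by (simp add: r_def powr_powr mult.commute flip: powr_realpow)
      finally show "ennreal (c j) * (\<integral>\<^sup>+z\<in>E j. ?W z \<partial>lborel) \<le> ennreal (K * 2 powr \<beta> * \<delta> powr (N - \<beta>) * r ^ j)"
        by (simp add: mult_ac)
    qed
    also have "\<dots> = ennreal (\<Sum>j. K * 2 powr \<beta> * \<delta> powr (N - \<beta>) * r ^ j)"
      using K(1) r by (intro suminf_ennreal2) (auto intro!: summable_mult)
    also have "(\<Sum>j. K * 2 powr \<beta> * \<delta> powr (N - \<beta>) * r ^ j) = C * \<delta> powr (N - \<beta>)"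
      using r by (subst suminf_mult) (auto simp: suminf_geometric C_def)
    finally show ?thesis by (simp add: \<delta>_def)
  qed
  moreover have "C > 0" using K r by (simp add: C_def)
  ultimately show ?thesis using that unfolding N_def by blast
qed

section \<open>The Bergman metric\<close>

text \<open>This is tanh R, the radius of the ball in the pseudo-hyperbolic distance
  |\<phi>_a(w)|.\<close>

definition bergman_radius :: "real \<Rightarrow> real"
  where "bergman_radius R = (exp (2 * R) - 1) / (exp (2 * R) + 1)"

lemma bergman_radius: "0 < R \<Longrightarrow> 0 < bergman_radius R" "bergman_radius R < 1"
  by (simp_all add: bergman_radius_def field_simps add_pos_pos)

lemma mem_bergman_ball_iff:
  assumes "a \<in> unit_ball"
  shows "w \<in> bergman_ball a R \<longleftrightarrow> w \<in> unit_ball \<and> norm (mobius a w) < bergman_radius R"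
proof (cases "w \<in> unit_ball")
  case True
  define x where "x = norm (mobius a w)"
  have x: "0 \<le> x" "x < 1" using mobius_in_ball[OF assms True] by (auto simp: x_def)
  have E: "0 < exp (2 * R) + 1" by (simp add: add_pos_pos)
  have "bergman_dist a w < R \<longleftrightarrow> ln ((1 + x) / (1 - x)) < 2 * R"
    by (auto simp: bergman_dist_def x_def)
  also have "\<dots> \<longleftrightarrow> (1 + x) / (1 - x) < exp (2 * R)"
    using x by (metis add_pos_nonneg diff_gt_0_iff_gt divide_pos_pos exp_less_cancel_iff exp_ln zero_less_one)
  also have "\<dots> \<longleftrightarrow> 1 + x < exp (2 * R) * (1 - x)" using x by (simp add: pos_divide_less_eq)
  also have "\<dots> \<longleftrightarrow> x < bergman_radius R"
    unfolding bergman_radius_def pos_less_divide_eq[OF E] by (auto simp: algebra_simps)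
  finally show ?thesis using True by (simp add: bergman_ball_def x_def)
qed (simp add: bergman_ball_def)

text \<open>The polarised form of \<open>mobius_norm\<close>, by the same computation with two
  different numerators \<open>Z\<close> and \<open>W\<close>. It gives the invariance of the metric
  and, for \<open>w = 0\<close>, the inner product of \<phi>_a(z) with \<open>a\<close>.\<close>

lemma one_minus_cdot_mobius:
  assumes "a \<in> unit_ball" "z \<in> unit_ball" "w \<in> unit_ball"
  shows "1 - cdot (mobius a z) (mobius a w) =
    (1 - cdot a a) * (1 - cdot z w) / ((1 - cdot z a) * (1 - cdot a w))"
proof -
  define l where "l = cdot z a / cdot a a"
  define k where "k = cdot w a / cdot a a"
  define A where "A = cdot a a"
  define s where "s = complex_of_real (sqrt (defect a))"
  have "(norm a)\<^sup>2 \<le> 1" using assms by (simp add: power_le_one)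
  then have s2: "s * s = 1 - A" "cnj s = s"
    by (simp_all add: s_def A_def cdot_self flip: of_real_mult)
  have za: "cdot z a = l * A" "cdot a w = cnj k * A" "cdot w a = k * A"
    using cnj_cdot[of w a] cnj_cdot[of a a]
    by (cases "a = 0"; simp add: l_def k_def A_def cdot_simps; fail)+
  define Z where "Z = a - l *s a - s *s (z - l *s a)"
  define W where "W = a - k *s a - s *s (w - k *s a)"
  have "cdot Z W = (1 - l) * cnj (1 - k) * A + s * s * (cdot z w - l * cnj k * A)"
    unfolding Z_def W_def by (simp add: cdot_simps s2(2) za A_def[symmetric]) (simp add: algebra_simps)
  then have ZW: "cdot Z W = (1 - l) * cnj (1 - k) * A + (1 - A) * (cdot z w - l * cnj k * A)"
    unfolding s2 .
  have "cnj A = A" using cnj_cdot[of a a] by (simp add: A_def)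
  then have c: "cnj (1 - cdot w a) = 1 - cdot a w" using cnj_cdot[of w a] by simp
  have nz: "1 - cdot z a \<noteq> 0" "1 - cdot a w \<noteq> 0"
    using assms one_minus_cdot_nonzero[of a z] one_minus_cdot_nonzero[of w a] by auto
  have eq: "(1 - cdot z a) * (1 - cdot a w) - cdot Z W = (1 - A) * (1 - cdot z w)"
    unfolding ZW za by (simp add: algebra_simps)
  have "mobius a z = (1 / (1 - cdot z a)) *s Z" "mobius a w = (1 / (1 - cdot w a)) *s W"
    by (simp_all add: mobius_def line_proj_def Z_def W_def l_def k_def s_def)
  then have "cdot (mobius a z) (mobius a w) = (1 / (1 - cdot z a)) * cnj (1 / (1 - cdot w a)) * cdot Z W"
    by (simp add: cdot_simps)
  also have "\<dots> = cdot Z W / ((1 - cdot z a) * (1 - cdot a w))"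
    unfolding complex_cnj_divide c by simp
  finally have "1 - cdot (mobius a z) (mobius a w) =
      ((1 - cdot z a) * (1 - cdot a w) - cdot Z W) / ((1 - cdot z a) * (1 - cdot a w))"
    using nz by (simp add: diff_divide_distrib)
  then show ?thesis unfolding eq A_def .
qed

lemma norm_one_minus_cdot_commute: "norm (1 - cdot z w) = norm (1 - cdot w z)"
  using complex_mod_cnj[of "1 - cdot z w"] by (simp add: cnj_cdot)

text \<open>The quantity 1 - |\<phi>_z(w)|^2 is a quotient of factors each of which transforms
  explicitly under \<phi>_a, and the extra factors cancel.\<close>

lemma norm_mobius_mobius:
  assumes "a \<in> unit_ball" "z \<in> unit_ball" "w \<in> unit_ball"
  shows "norm (mobius (mobius a z) (mobius a w)) = norm (mobius z w)"
proof -
  have n: "norm a < 1" "norm z < 1" "norm w < 1" using assms by auto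
  have m: "norm (mobius a z) < 1" "norm (mobius a w) < 1"
    using mobius_in_ball[OF assms(1,2)] mobius_in_ball[OF assms(1,3)] by auto
  have pos: "0 < defect a" by (rule norm_unit_ball_sq[OF assms(1)])
  have nz: "norm (1 - cdot z a) \<noteq> 0" "norm (1 - cdot w a) \<noteq> 0" "norm (1 - cdot w z) \<noteq> 0"
    using one_minus_cdot_nonzero n by auto
  have "norm (1 - cdot (mobius a w) (mobius a z)) =
      (defect a) * norm (1 - cdot w z) / (norm (1 - cdot w a) * norm (1 - cdot z a))"
  proof -
    have "norm (1 - cdot a a) = defect a"
      using pos unfolding cdot_self by (metis abs_of_pos norm_of_real of_real_1 of_real_diff)
    then show ?thesis
      unfolding one_minus_cdot_mobius[OF assms(1,3,2)]
      by (simp add: norm_mult norm_divide norm_one_minus_cdot_commute[of a z])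
  qed
  moreover have "A * Z / p\<^sup>2 * (A * W / q\<^sup>2) / (A * r / (q * p))\<^sup>2 = Z * W / r\<^sup>2"
    if "A \<noteq> 0" "p \<noteq> 0" "q \<noteq> 0" "r \<noteq> 0" for A Z W p q r :: real
    using that by (simp add: field_simps power2_eq_square)
  ultimately have "defect (mobius (mobius a z) (mobius a w)) = defect (mobius z w)"
    unfolding mobius_norm[OF m] mobius_norm[OF n(1,2)] mobius_norm[OF n(1,3)] mobius_norm[OF n(2,3)]
    using pos nz by simp
  then show ?thesis by (simp add: power2_eq_iff_nonneg)
qed

text \<open>By \<open>mobius_norm\<close> the two defects differ by the factor (1 - |y|^2) / |1 -
  \<langle>y,a\<rangle>|^2, whose numerator lies between (1-\<rho>)^2 and 1 and whose denominator
  lies between (1-\<rho>)^2 and 4. The third estimate uses a = \<phi>_a(0).\<close>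

lemma mobius_comparable:
  assumes a: "a \<in> unit_ball" and y: "norm y \<le> \<rho>" and \<rho>: "0 \<le> \<rho>" "\<rho> < 1"
  shows "defect (mobius a y) \<le> 4 / (1 - \<rho>)\<^sup>2 * defect a"
    and "defect a \<le> 4 / (1 - \<rho>)\<^sup>2 * (defect (mobius a y))"
    and "norm (1 - cdot (mobius a y) a) \<le> defect a / (1 - \<rho>)"
proof -
  have n: "norm a < 1" "norm y < 1" using a y \<rho> by auto
  have pos: "0 < defect a" by (rule norm_unit_ball_sq[OF a])
  define d where "d = norm (1 - cdot y a)"
  have "norm (cdot y a) \<le> \<rho> * 1"
    using y n(1) \<rho>(1) by (intro order_trans[OF norm_cdot_le] mult_mono) auto
  then have "1 - \<rho> \<le> d" "d \<le> 2"
    using norm_triangle_ineq4[of 1 "cdot y a"] norm_triangle_ineq2[of 1 "cdot y a"] \<rho>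
    by (auto simp: d_def)
  then have d: "(1 - \<rho>)\<^sup>2 \<le> d\<^sup>2" "d\<^sup>2 \<le> 2\<^sup>2" "0 < d"
    using \<rho> power_mono[of d 2 2] by (auto intro: power_mono)
  have eq: "defect (mobius a y) = (defect a) * defect y / d\<^sup>2"
    unfolding d_def by (rule mobius_norm[OF n])
  have y2: "(norm y)\<^sup>2 \<le> \<rho>\<^sup>2" using y by (intro power_mono) auto
  have "(defect a) * defect y / d\<^sup>2 \<le> defect a * 4 / (1 - \<rho>)\<^sup>2"
  proof (rule frac_le)
    have "defect y \<le> 4" using zero_le_power2[of "norm y"] by linarith
    then show "(defect a) * defect y \<le> defect a * 4"
      using pos by (intro mult_left_mono) auto
  qed (use pos d \<rho> in auto)
  then show "defect (mobius a y) \<le> 4 / (1 - \<rho>)\<^sup>2 * defect a"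
    unfolding eq by (simp add: mult.commute)
  have "1 * ((1 - \<rho>)\<^sup>2 * d\<^sup>2) \<le> defect y * 4"
  proof -
    have "(1 - \<rho>)\<^sup>2 \<le> 1 - \<rho>\<^sup>2"
      using mult_left_mono[of "1 - \<rho>" "1 + \<rho>" "1 - \<rho>"] \<rho> by (simp add: power2_eq_square algebra_simps)
    then have "(1 - \<rho>)\<^sup>2 \<le> defect y" using y2 by linarith
    moreover have "0 \<le> defect y" using n by (simp add: power_le_one)
    ultimately have "(1 - \<rho>)\<^sup>2 * d\<^sup>2 \<le> defect y * 2\<^sup>2"
      using d by (intro mult_mono) auto
    then show ?thesis by simp
  qed
  then have "(defect a) * ((1 - \<rho>)\<^sup>2 * d\<^sup>2) \<le> defect a * ((defect y) * 4)"
    using pos by (intro mult_left_mono) auto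
  then show "defect a \<le> 4 / (1 - \<rho>)\<^sup>2 * (defect (mobius a y))"
    unfolding eq using d \<rho> by (simp add: field_simps)
  have "1 - cdot (mobius a y) (mobius a 0) = (1 - cdot a a) / (1 - cdot y a)"
    using one_minus_cdot_mobius[of a y 0] a n by (simp add: cdot_simps)
  then have "norm (1 - cdot (mobius a y) a) = norm (1 - cdot a a) / d"
    by (simp add: d_def norm_divide)
  also have "norm (1 - cdot a a) = defect a"
    using pos unfolding cdot_self by (metis abs_of_pos norm_of_real of_real_1 of_real_diff)
  also have "(defect a) / d \<le> defect a / (1 - \<rho>)"
    using pos \<rho> \<open>1 - \<rho> \<le> d\<close> by (intro divide_left_mono) auto
  finally show "norm (1 - cdot (mobius a y) a) \<le> defect a / (1 - \<rho>)" .
qed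

text \<open>By the involution, w = \<phi>_a(y) with y = \<phi>_a(w) of norm below \<rho>.\<close>

lemma bergman_ball_comparable:
  assumes a: "a \<in> unit_ball" and R: "0 < R" and w: "w \<in> bergman_ball a R"
  defines "\<rho> \<equiv> bergman_radius R"
  shows "defect w \<le> 4 / (1 - \<rho>)\<^sup>2 * defect a"
    and "defect a \<le> 4 / (1 - \<rho>)\<^sup>2 * defect w"
    and "norm (1 - cdot w a) \<le> defect a / (1 - \<rho>)"
proof -
  have "w \<in> unit_ball" "norm (mobius a w) \<le> \<rho>"
    using w mem_bergman_ball_iff[OF a] by (auto simp: \<rho>_def)
  moreover have "0 \<le> \<rho>" "\<rho> < 1" using bergman_radius[of R] R by (auto simp: \<rho>_def)
  ultimately show "defect w \<le> 4 / (1 - \<rho>)\<^sup>2 * defect a"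
    "defect a \<le> 4 / (1 - \<rho>)\<^sup>2 * defect w"
    "norm (1 - cdot w a) \<le> defect a / (1 - \<rho>)"
    using mobius_comparable[OF a, of "mobius a w" \<rho>] by (simp_all add: mobius_involution[OF a])
qed

text \<open>Through \<open>mobius_norm\<close> the ball becomes a superlevel set of an explicit
  continuous quotient. Openness serves both measurability and the extraction of finite
  covers.\<close>

lemma open_bergman_ball:
  fixes a :: "complex ^ 'n"
  assumes a: "a \<in> unit_ball" and R: "0 < R"
  shows "open (bergman_ball a R)"
proof -
  define \<rho> where "\<rho> = bergman_radius R"
  have \<rho>: "0 < \<rho>" using bergman_radius R by (simp add: \<rho>_def)
  let ?g = "\<lambda>w. (defect a) * defect w / (norm (1 - cdot w a))\<^sup>2"
  have cd: "continuous_on unit_ball (\<lambda>w. cdot w a)"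
    unfolding cdot_def by (intro continuous_intros)
  have "cdot w a \<noteq> 1" if "w \<in> unit_ball" for w
    using one_minus_cdot_nonzero[of a w] a that by auto
  then have "continuous_on unit_ball ?g"
    by (intro continuous_intros cd) auto
  then have "open (unit_ball \<inter> ?g -` {1 - \<rho>\<^sup>2 <..})"
    by (rule continuous_open_preimage) auto
  also have "unit_ball \<inter> ?g -` {1 - \<rho>\<^sup>2 <..} = bergman_ball a R"
  proof (intro set_eqI)
    fix w :: "complex ^ 'n"
    show "w \<in> unit_ball \<inter> ?g -` {1 - \<rho>\<^sup>2 <..} \<longleftrightarrow> w \<in> bergman_ball a R"
    proof (cases "w \<in> unit_ball")
      case True
      then have g: "?g w = defect (mobius a w)" using mobius_norm[of a w] a by simp
      have "norm (mobius a w) < \<rho> \<longleftrightarrow> (norm (mobius a w))\<^sup>2 < \<rho>\<^sup>2"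
        using \<rho> by (metis abs_norm_cancel abs_of_pos power2_less_imp_less power_strict_mono norm_ge_zero less_imp_le zero_less_numeral)
      then show ?thesis using True unfolding mem_bergman_ball_iff[OF a] \<rho>_def[symmetric] by (simp add: g)
    qed (simp add: mem_bergman_ball_iff[OF a])
  qed
  finally show ?thesis .
qed

lemma centre_in_bergman_ball: "a \<in> unit_ball \<Longrightarrow> 0 < R \<Longrightarrow> a \<in> bergman_ball a R"
  by (simp add: mem_bergman_ball_iff bergman_radius)

lemma bergman_ball_cover:
  assumes "0 < R" "0 < R'"
  obtains F where "finite F" "F \<subseteq> unit_ball"
    "\<And>a :: complex ^ 'n. a \<in> unit_ball \<Longrightarrow> bergman_ball a R \<subseteq> (\<Union>b\<in>F. bergman_ball (mobius a b) R')"
proof -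
  define \<rho> where "\<rho> = bergman_radius R"
  have \<rho>: "\<rho> < 1" using bergman_radius by (simp add: \<rho>_def)
  have "cball (0 :: complex ^ 'n) \<rho> \<subseteq> (\<Union>b\<in>unit_ball. bergman_ball b R')"
  proof
    fix b :: "complex ^ 'n" assume "b \<in> cball 0 \<rho>"
    then have "b \<in> unit_ball" using \<rho> by simp
    then show "b \<in> (\<Union>b\<in>unit_ball. bergman_ball b R')"
      using centre_in_bergman_ball[of b R'] assms by blast
  qed
  then obtain F where F: "F \<subseteq> unit_ball" "finite F" "cball (0 :: complex ^ 'n) \<rho> \<subseteq> (\<Union>b\<in>F. bergman_ball b R')"
    using compactE_image[OF compact_cball, of unit_ball "\<lambda>b. bergman_ball b R'" "0 :: complex ^ 'n" \<rho>]
      open_bergman_ball assms(2) by metis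
  have "bergman_ball a R \<subseteq> (\<Union>b\<in>F. bergman_ball (mobius a b) R')" if a: "a \<in> unit_ball" for a :: "complex ^ 'n"
  proof
    fix w assume "w \<in> bergman_ball a R"
    then have w: "w \<in> unit_ball" "norm (mobius a w) < \<rho>"
      by (simp_all add: mem_bergman_ball_iff[OF a] \<rho>_def)
    then have "mobius a w \<in> cball 0 \<rho>" by simp
    then obtain b where b: "b \<in> F" "mobius a w \<in> bergman_ball b R'" using F by blast
    have b': "b \<in> unit_ball" using b F by blast
    have "norm (mobius b (mobius a w)) < bergman_radius R'" using b mem_bergman_ball_iff[OF b'] by blast
    then have "norm (mobius (mobius a b) (mobius a (mobius a w))) < bergman_radius R'"
      using norm_mobius_mobius[OF a b' mobius_in_ball[OF a w(1)]] by simp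
    then have "w \<in> bergman_ball (mobius a b) R'"
      using w mem_bergman_ball_iff[OF mobius_in_ball[OF a b']] mobius_involution[OF a w(1)] by simp
    then show "w \<in> (\<Union>b\<in>F. bergman_ball (mobius a b) R')" using b by blast
  qed
  then show ?thesis using F that by blast
qed

section \<open>The weights and the Carleson ratio under a change of centre\<close>

lemma ln_ratio_le:
  fixes x y M :: real
  assumes "0 < x" "0 < y" "y \<le> 1" "1 \<le> M" "y \<le> M * x"
  shows "ln (2 / x) \<le> (1 + ln M / ln 2) * ln (2 / y)"
proof -
  \<comment> \<open>The numerator 2 keeps the logarithm away from 0, so an additive error
    \<open>ln M\<close> can be absorbed into a factor.\<close>
  have l2: "ln 2 \<le> ln (2 / y)" using assms by (simp add: field_simps)
  have "2 / x \<le> M * (2 / y)" using assms by (simp add: field_simps)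
  then have "ln (2 / x) \<le> ln (M * (2 / y))" using assms by (simp add: ln_le_cancel_iff)
  also have "\<dots> = ln M + ln (2 / y)" using assms by (subst ln_mult) auto
  also have "ln M = ln M / ln 2 * ln 2" by simp
  also have "ln M / ln 2 * ln 2 \<le> ln M / ln 2 * ln (2 / y)"
    using l2 assms by (intro mult_left_mono) auto
  finally show ?thesis by (simp add: distrib_right)
qed

lemma ln_powr_comparable:
  fixes x y M t :: real
  assumes "0 < x" "x \<le> 1" "0 < y" "y \<le> 1" "1 \<le> M" "x \<le> M * y" "y \<le> M * x"
  shows "ln (2 / x) powr t \<le> (1 + ln M / ln 2) powr \<bar>t\<bar> * ln (2 / y) powr t"
proof (rule powr_le_powr_cmult)
  show "0 < ln (2 / x)" "0 < ln (2 / y)" using assms by (auto simp: field_simps)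
  show "1 \<le> 1 + ln M / ln 2" using assms by simp
qed (use assms ln_ratio_le[of x y M] ln_ratio_le[of y x M] in auto)

definition log_weight :: "real \<Rightarrow> real \<Rightarrow> real \<Rightarrow> real"
  where "log_weight S t x = x powr S * ln (2 / x) powr t"

lemma log_weight_pos: "0 < x \<Longrightarrow> x \<le> 1 \<Longrightarrow> 0 < log_weight S t x"
  by (auto simp: log_weight_def field_simps)

lemma log_weight_comparable:
  fixes x y M S t :: real
  assumes "0 < x" "x \<le> 1" "0 < y" "y \<le> 1" "1 \<le> M" "x \<le> M * y" "y \<le> M * x"
  shows "log_weight S t x \<le> (M powr \<bar>S\<bar> * (1 + ln M / ln 2) powr \<bar>t\<bar>) * log_weight S t y"
proof -
  have "log_weight S t x \<le> (M powr \<bar>S\<bar> * y powr S) * ((1 + ln M / ln 2) powr \<bar>t\<bar> * ln (2 / y) powr t)"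
    unfolding log_weight_def using assms
    by (intro mult_mono powr_le_powr_cmult ln_powr_comparable) auto
  then show ?thesis by (simp add: log_weight_def mult_ac)
qed

lemma carleson_ratio_eq:
  "carleson_ratio p \<alpha> q s t \<mu> R (a :: complex ^ 'n) = emeasure \<mu> (bergman_ball a R) /
    ennreal (log_weight (s + (real CARD('n) + 1 + \<alpha>) * q / p) t (defect a))"
  by (simp add: carleson_ratio_def log_weight_def)

lemma ennreal_divide_eq_times: "0 < u \<Longrightarrow> X / ennreal u = X * ennreal (1 / u)"
  by (simp add: divide_ennreal_def inverse_ennreal inverse_eq_divide)

lemma ennreal_divide_le_cmult:
  assumes "0 < u" "0 < v" "v \<le> C * u" "X \<le> Y"
  shows "X / ennreal u \<le> ennreal C * (Y / ennreal v)"
proof -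
  have C: "0 < C" using assms by (smt (verit) mult_nonneg_nonneg zero_less_mult_pos2)
  have "1 / u \<le> C * (1 / v)" using assms by (simp add: field_simps)
  then have "X * ennreal (1 / u) \<le> Y * ennreal (C * (1 / v))"
    using assms by (intro mult_mono ennreal_leI) auto
  also have "\<dots> = ennreal C * (Y * ennreal (1 / v))"
    using C assms by (subst ennreal_mult) (simp_all add: mult_ac)
  finally show ?thesis using assms by (simp only: ennreal_divide_eq_times)
qed

lemma bergman_ball_in_sets:
  assumes "borel_measure_ball \<mu>" "a \<in> unit_ball" "0 < R"
  shows "bergman_ball a R \<in> sets \<mu>"
  using assms open_bergman_ball[OF assms(2,3)]
  by (auto simp: borel_measure_ball_def sets_restrict_space_iff bergman_ball_def)

lemma one_minus_norm_sq_bounds: "a \<in> unit_ball \<Longrightarrow> 0 < defect a \<and> defect a \<le> 1"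
  using norm_unit_ball_sq by simp

text \<open>The new centres \<phi>_a(b) stay at bounded distance from \<open>a\<close>, since
  \<open>b\<close> runs through a finite set; hence the weights there are comparable with the weight
  at \<open>a\<close>, uniformly in \<open>a\<close>.\<close>

lemma carleson_ratio_transfer:
  fixes p \<alpha> q s t :: real
  assumes R: "0 < R" "0 < R'"
  obtains C :: real and F where "0 < C" "finite F" "F \<subseteq> unit_ball"
    "\<And>\<mu> (a :: complex ^ 'n). borel_measure_ball \<mu> \<Longrightarrow> a \<in> unit_ball \<Longrightarrow>
      carleson_ratio p \<alpha> q s t \<mu> R a \<le> ennreal C * (\<Sum>b\<in>F. carleson_ratio p \<alpha> q s t \<mu> R' (mobius a b))"
proof -
  define S where "S = s + (real CARD('n) + 1 + \<alpha>) * q / p"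
  obtain F where F: "finite F" "F \<subseteq> unit_ball"
    "\<And>a :: complex ^ 'n. a \<in> unit_ball \<Longrightarrow> bergman_ball a R \<subseteq> (\<Union>b\<in>F. bergman_ball (mobius a b) R')"
    using bergman_ball_cover[OF R] by blast
  \<comment> \<open>The inserted 0 makes the maximum well defined without a case distinction and
    ensures \<rho> \<ge> 0.\<close>
  define \<rho> where "\<rho> = Max (insert 0 (norm ` F))"
  have \<rho>: "0 \<le> \<rho>" "\<rho> < 1" "\<And>b. b \<in> F \<Longrightarrow> norm b \<le> \<rho>"
    using F by (auto simp: \<rho>_def)
  define M where "M = 4 / (1 - \<rho>)\<^sup>2"
  have "(1 - \<rho>)\<^sup>2 \<le> 1" using \<rho> by (simp add: power_le_one)
  then have M: "1 \<le> M" using \<rho> by (simp add: M_def field_simps)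
  define C where "C = M powr \<bar>S\<bar> * (1 + ln M / ln 2) powr \<bar>t\<bar>"
  have "1 + ln M / ln 2 > 0" using M by (simp add: add_pos_nonneg)
  then have C: "0 < C" using M by (simp add: C_def)
  have "carleson_ratio p \<alpha> q s t \<mu> R a \<le> ennreal C * (\<Sum>b\<in>F. carleson_ratio p \<alpha> q s t \<mu> R' (mobius a b))"
    if \<mu>: "borel_measure_ball \<mu>" and a: "a \<in> unit_ball" for \<mu> and a :: "complex ^ 'n"
  proof -
    have mb: "mobius a b \<in> unit_ball" if "b \<in> F" for b
      using mobius_in_ball[OF a] F that by blast
    define u where "u = log_weight S t (defect a)"
    have u: "0 < u" unfolding u_def using one_minus_norm_sq_bounds[OF a] by (intro log_weight_pos) auto
    have "emeasure \<mu> (bergman_ball a R) \<le> emeasure \<mu> (\<Union>b\<in>F. bergman_ball (mobius a b) R')"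
      using F(1) bergman_ball_in_sets[OF \<mu> mb R(2)] by (intro emeasure_mono F(3) a) auto
    also have "\<dots> \<le> (\<Sum>b\<in>F. emeasure \<mu> (bergman_ball (mobius a b) R'))"
      using F(1) bergman_ball_in_sets[OF \<mu> mb R(2)] by (intro emeasure_subadditive_finite) auto
    finally have "carleson_ratio p \<alpha> q s t \<mu> R a \<le> (\<Sum>b\<in>F. emeasure \<mu> (bergman_ball (mobius a b) R')) * ennreal (1 / u)"
      using u by (simp add: carleson_ratio_eq S_def[symmetric] u_def[symmetric] ennreal_divide_eq_times mult_right_mono)
    also have "\<dots> = (\<Sum>b\<in>F. emeasure \<mu> (bergman_ball (mobius a b) R') / ennreal u)"
      using u by (simp add: ennreal_divide_eq_times sum_distrib_right)
    also have "\<dots> \<le> (\<Sum>b\<in>F. ennreal C * carleson_ratio p \<alpha> q s t \<mu> R' (mobius a b))"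
    proof (rule sum_mono)
      fix b assume b: "b \<in> F"
      show "emeasure \<mu> (bergman_ball (mobius a b) R') / ennreal u \<le> ennreal C * carleson_ratio p \<alpha> q s t \<mu> R' (mobius a b)"
        unfolding carleson_ratio_eq S_def[symmetric] C_def u_def
        using one_minus_norm_sq_bounds[OF a] one_minus_norm_sq_bounds[OF mb[OF b]]
          mobius_comparable(1,2)[OF a \<rho>(3)[OF b] \<rho>(1,2)] M
        by (intro ennreal_divide_le_cmult log_weight_pos log_weight_comparable) (auto simp: M_def)
    qed
    finally show ?thesis by (simp add: sum_distrib_left)
  qed
  then show ?thesis using C F that by blast
qed

section \<open>Bergman spaces\<close>

lemma nn_integral_vol_ball:
  fixes h :: "complex ^ 'n \<Rightarrow> ennreal"
  assumes [measurable]: "h \<in> borel_measurable (restrict_space borel unit_ball)"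
  shows "(\<integral>\<^sup>+z. h z \<partial>vol_ball) =
    ennreal (1 / measure lborel (unit_ball :: (complex ^ 'n) set)) * (\<integral>\<^sup>+z\<in>unit_ball. h z \<partial>lborel)"
proof -
  let ?M = "restrict_space lborel (unit_ball :: (complex ^ 'n) set)"
  define v where "v = measure lborel (unit_ball :: (complex ^ 'n) set)"
  have v: "emeasure lborel (unit_ball :: (complex ^ 'n) set) = ennreal v" "0 < v"
    using emeasure_lborel_ball_finite[of "0 :: complex ^ 'n" 1]
    unfolding v_def by (auto intro: emeasure_eq_ennreal_measure measure_lborel_ball_pos)
  have h: "h \<in> borel_measurable ?M"
    by (subst measurable_cong_sets[OF sets_restrict_space_cong[OF sets_lborel] refl]) (rule assms)
  have S: "unit_ball \<in> sets ?M" by (simp add: sets_restrict_space_iff)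
  have em: "emeasure ?M unit_ball = ennreal v" by (simp add: emeasure_restrict_space v)
  have "(\<integral>\<^sup>+z. h z \<partial>vol_ball) = (\<integral>\<^sup>+z. indicator unit_ball z / ennreal v * h z \<partial>?M)"
    unfolding vol_ball_def uniform_measure_def em
    using h S by (intro nn_integral_density) auto
  also have "\<dots> = (\<integral>\<^sup>+z. indicator unit_ball z / ennreal v * h z * indicator unit_ball z \<partial>lborel)"
    by (rule nn_integral_restrict_space) simp
  also have "\<dots> = (\<integral>\<^sup>+z. ennreal (1 / v) * (h z * indicator unit_ball z) \<partial>lborel)"
    using v(2) by (intro nn_integral_cong) (auto simp: indicator_def ennreal_divide_eq_times mult_ac)
  also have "\<dots> = ennreal (1 / v) * (\<integral>\<^sup>+z\<in>unit_ball. h z \<partial>lborel)"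
  proof (rule nn_integral_cmult)
    show "(\<lambda>z. h z * indicator unit_ball z) \<in> borel_measurable lborel"
      using assms by (simp add: borel_measurable_restrict_space_iff_ennreal)
  qed
  finally show ?thesis by (simp add: v_def)
qed

lemma measurable_weight_ball:
  "(\<lambda>z. defect z powr \<alpha>) \<in> borel_measurable (restrict_space borel (unit_ball :: (complex ^ 'n) set))"
  by (intro borel_measurable_continuous_on_restrict continuous_on_weight)

lemma sets_vol_ball: "sets (vol_ball :: (complex ^ 'n) measure) = sets (restrict_space borel unit_ball)"
  unfolding vol_ball_def by (simp cong: sets_restrict_space_cong)

lemma borel_measurable_vol_weighted_iff:
  "g \<in> borel_measurable (vol_weighted \<alpha>) \<longleftrightarrow> g \<in> borel_measurable (restrict_space borel unit_ball)"
  by (simp add: vol_weighted_def measurable_cong_sets[OF sets_vol_ball refl])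

text \<open>Combines both normalisations: \<open>vol_weighted \<alpha>\<close> has density this
  constant times (1 - |z|^2)^\<alpha> with respect to Lebesgue measure on the ball.\<close>

definition vol_const :: "'n :: finite itself \<Rightarrow> real \<Rightarrow> real"
  where "vol_const T \<alpha> = bergman_const T \<alpha> / measure lborel (unit_ball :: (complex ^ 'n) set)"

text \<open>The normalising constant is the reciprocal of a Bochner integral, which defaults to 0
  when the weight is not integrable. So the weight must be shown to have a finite and positive
  integral before the constant can be used.\<close>

lemma nn_integral_vol_weighted:
  fixes \<alpha> :: real
  assumes \<alpha>: "- 1 < \<alpha>"
  shows "0 < vol_const TYPE('n :: finite) \<alpha>"
    and "\<And>g. g \<in> borel_measurable (restrict_space borel (unit_ball :: (complex ^ 'n) set)) \<Longrightarrow>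
      (\<integral>\<^sup>+z. ennreal (g z) \<partial>vol_weighted \<alpha>) = ennreal (vol_const TYPE('n) \<alpha>) *
      weighted_lint \<alpha> g"
proof -
  let ?w = "\<lambda>z :: complex ^ 'n. defect z powr \<alpha>"
  define v where "v = measure lborel (unit_ball :: (complex ^ 'n) set)"
  have v: "0 < v" unfolding v_def by (rule measure_lborel_ball_pos) simp
  note w [measurable] = measurable_weight_ball[of \<alpha>, where 'n='n]
  have fin: "(\<integral>\<^sup>+z\<in>unit_ball. ennreal (?w z) \<partial>lborel) < \<infinity>"
    by (rule weight_integral_finite[OF \<alpha>])
  then obtain V where V: "0 \<le> V" "(\<integral>\<^sup>+z\<in>unit_ball. ennreal (?w z) \<partial>lborel) = ennreal V"
    by (cases "\<integral>\<^sup>+z\<in>unit_ball. ennreal (?w z) \<partial>lborel") auto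
  \<comment> \<open>The pointwise estimate for the constant function 1 at the origin yields 1 \<le>
    C V, hence positivity of the integral \<open>V\<close> of the weight.\<close>
  obtain C where C: "0 < C" "\<And>(f :: complex ^ 'n \<Rightarrow> complex) a. holomorphic_ball f \<Longrightarrow> a \<in> unit_ball \<Longrightarrow>
      ennreal (norm (f a) powr 1 * defect a powr (real CARD('n) + 1 + \<alpha>)) \<le>
      ennreal C * weighted_lint \<alpha> (\<lambda>z. norm (f z) powr 1)"
    using pointwise_estimate[of 1 \<alpha>, where 'n='n] by auto
  have "holomorphic_ball (\<lambda>_ :: complex ^ 'n. 1)"
    by (auto simp: holomorphic_ball_def intro!: exI[of _ "\<lambda>_. 0"])
  from C(2)[OF this, of 0] have "1 \<le> C * V"
    using C(1) V by (simp flip: ennreal_mult ennreal_1)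
  then have Vpos: "0 < V" using V(1) by (cases "V = 0") auto
  define c where "c = bergman_const TYPE('n) \<alpha>"
  have nn: "(\<integral>\<^sup>+z. ennreal (?w z) \<partial>vol_ball) = ennreal (V / v)"
    using v V by (subst nn_integral_vol_ball) (auto simp: v_def[symmetric] simp flip: ennreal_mult)
  have "?w \<in> borel_measurable vol_ball"
    using w by (simp add: measurable_cong_sets[OF sets_vol_ball refl])
  then have "c = 1 / (V / v)"
    unfolding c_def bergman_const_def using nn V v by (subst integral_eq_nn_integral) auto
  then have c: "0 < c" using Vpos v by simp
  define \<kappa> where "\<kappa> = vol_const TYPE('n) \<alpha>"
  have \<kappa>_eq: "\<kappa> = c / v" by (simp add: \<kappa>_def vol_const_def c_def v_def)
  show "0 < vol_const TYPE('n) \<alpha>" using c v \<kappa>_eq by (simp add: \<kappa>_def)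
  show "(\<integral>\<^sup>+z. ennreal (g z) \<partial>vol_weighted \<alpha>) = ennreal (vol_const TYPE('n) \<alpha>) *
      (\<integral>\<^sup>+z\<in>unit_ball. ennreal (g z * ?w z) \<partial>lborel)"
    if g: "g \<in> borel_measurable (restrict_space borel (unit_ball :: (complex ^ 'n) set))" for g
  proof -
    have g': "g \<in> borel_measurable vol_ball" and w': "?w \<in> borel_measurable vol_ball"
      using g w by (simp_all add: measurable_cong_sets[OF sets_vol_ball refl])
    have "(\<integral>\<^sup>+z. ennreal (g z) \<partial>vol_weighted \<alpha>) = (\<integral>\<^sup>+z. ennreal (c * ?w z) * ennreal (g z) \<partial>vol_ball)"
      unfolding vol_weighted_def c_def[symmetric] using g' w' by (intro nn_integral_density) auto
    also have "\<dots> = (\<integral>\<^sup>+z. ennreal c * ennreal (g z * ?w z) \<partial>vol_ball)"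
      using c by (intro nn_integral_cong) (simp add: ennreal_mult' ennreal_mult'' mult_ac)
    also have "\<dots> = ennreal c * (\<integral>\<^sup>+z. ennreal (g z * ?w z) \<partial>vol_ball)"
      using g' w' by (intro nn_integral_cmult) auto
    also have "(\<integral>\<^sup>+z. ennreal (g z * ?w z) \<partial>vol_ball) = ennreal (1 / v) * (\<integral>\<^sup>+z\<in>unit_ball. ennreal (g z * ?w z) \<partial>lborel)"
      unfolding v_def using g w by (intro nn_integral_vol_ball) auto
    finally show ?thesis
      using c v \<kappa>_eq by (simp add: \<kappa>_def ennreal_mult' mult.assoc[symmetric] flip: ennreal_mult)
  qed
qed

lemma measurable_norm_powr_ball:
  assumes "holomorphic_ball f" "0 < p"
  shows "(\<lambda>z. norm (f z) powr p) \<in> borel_measurable (restrict_space borel unit_ball)"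
  using assms by (intro borel_measurable_continuous_on_restrict continuous_on_norm_powr
    holomorphic_ball_imp_continuous_on)

lemma bergman_norm_powr:
  assumes "f \<in> bergman_space p \<alpha>" "0 < p"
  shows "ennreal (bergman_norm p \<alpha> f powr p) = (\<integral>\<^sup>+z. ennreal (norm (f z) powr p) \<partial>vol_weighted \<alpha>)"
proof -
  have "(\<integral>\<^sup>+z. ennreal (norm (f z) powr p) \<partial>vol_weighted \<alpha>) = ennreal (\<integral>z. norm (f z) powr p \<partial>vol_weighted \<alpha>)"
    using assms by (intro nn_integral_eq_integral) (auto simp: bergman_space_def)
  moreover have "0 \<le> (\<integral>z. norm (f z) powr p \<partial>vol_weighted \<alpha>)" by (rule integral_nonneg_AE) simp
  ultimately show ?thesis using assms(2) by (simp add: bergman_norm_def powr_powr)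
qed

lemma bergman_spaceI:
  assumes "holomorphic_ball f" "0 < p" "0 \<le> B"
    and le: "(\<integral>\<^sup>+z. ennreal (norm (f z) powr p) \<partial>vol_weighted \<alpha>) \<le> ennreal B"
  shows "f \<in> bergman_space p \<alpha>" "bergman_norm p \<alpha> f \<le> B powr (1 / p)"
proof -
  have "integrable (vol_weighted \<alpha>) (\<lambda>z. norm (f z) powr p)"
    using measurable_norm_powr_ball[OF assms(1,2)] le
    by (intro integrableI_nonneg) (auto simp: borel_measurable_vol_weighted_iff le_less_trans)
  then show *: "f \<in> bergman_space p \<alpha>" using assms(1) by (simp add: bergman_space_def)
  have "bergman_norm p \<alpha> f powr p \<le> B"
    using le assms(3) by (simp flip: bergman_norm_powr[OF * assms(2)])
  then have "(bergman_norm p \<alpha> f powr p) powr (1 / p) \<le> B powr (1 / p)"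
    using assms(2) by (intro powr_mono2) auto
  then show "bergman_norm p \<alpha> f \<le> B powr (1 / p)"
    using assms(2) by (simp add: powr_powr bergman_norm_def)
qed

lemma bergman_norm_nonneg: "0 \<le> bergman_norm p \<alpha> f"
  by (simp add: bergman_norm_def)

lemma bergman_pointwise:
  fixes p q \<alpha> :: real
  assumes "0 < p" "0 < q" "- 1 < \<alpha>"
  obtains C :: real where "0 < C"
    "\<And>(f :: complex ^ 'n \<Rightarrow> complex) z. f \<in> bergman_space p \<alpha> \<Longrightarrow> z \<in> unit_ball \<Longrightarrow>
      norm (f z) powr q \<le> C * bergman_norm p \<alpha> f powr q *
        defect z powr (- ((real CARD('n) + 1 + \<alpha>) * q / p))"
proof -
  define N where "N = real CARD('n) + 1 + \<alpha>"
  obtain C where C: "0 < C" "\<And>(f :: complex ^ 'n \<Rightarrow> complex) a. holomorphic_ball f \<Longrightarrow> a \<in> unit_ball \<Longrightarrow>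
      ennreal (norm (f a) powr p * defect a powr (real CARD('n) + 1 + \<alpha>)) \<le>
      ennreal C * weighted_lint \<alpha> (\<lambda>z. norm (f z) powr p)"
    using pointwise_estimate[OF assms(1), of \<alpha>, where 'n='n] by auto
  define \<kappa> where "\<kappa> = vol_const TYPE('n) \<alpha>"
  note \<kappa> = nn_integral_vol_weighted[OF assms(3), where 'n='n, folded \<kappa>_def]
  have "norm (f z) powr q \<le> (C / \<kappa>) powr (q / p) * bergman_norm p \<alpha> f powr q *
        defect z powr (- (N * q / p))"
    if f: "f \<in> bergman_space p \<alpha>" and z: "z \<in> unit_ball" for f :: "complex ^ 'n \<Rightarrow> complex" and z
  proof -
    define \<delta> where "\<delta> = defect z"
    have \<delta>: "0 < \<delta>" using norm_unit_ball_sq[OF z] by (simp add: \<delta>_def)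
    define b where "b = bergman_norm p \<alpha> f"
    have b: "0 \<le> b" by (simp add: b_def bergman_norm_nonneg)
    have hol: "holomorphic_ball f" using f by (simp add: bergman_space_def)
    have "ennreal \<kappa> * ennreal (norm (f z) powr p * \<delta> powr N) \<le>
        ennreal C * (ennreal \<kappa> * weighted_lint \<alpha> (\<lambda>z. norm (f z) powr p))"
      using mult_left_mono[OF C(2)[OF hol z], of "ennreal \<kappa>"] by (simp add: \<delta>_def N_def mult_ac)
    also have "\<dots> = ennreal C * ennreal (b powr p)"
      unfolding b_def bergman_norm_powr[OF f assms(1)]
      by (simp add: \<kappa>(2)[OF measurable_norm_powr_ball[OF hol assms(1)]])
    finally have "\<kappa> * (norm (f z) powr p * \<delta> powr N) \<le> C * b powr p"
      using C \<kappa> by (simp flip: ennreal_mult)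
    then have "norm (f z) powr p \<le> C / \<kappa> * b powr p * \<delta> powr (- N)"
      using \<kappa>(1) \<delta> by (simp add: powr_minus field_simps)
    then have "(norm (f z) powr p) powr (q / p) \<le> (C / \<kappa> * b powr p * \<delta> powr (- N)) powr (q / p)"
      using assms by (intro powr_mono2) auto
    also have "\<dots> = (C / \<kappa>) powr (q / p) * b powr q * \<delta> powr (- (N * q / p))"
    proof -
      have *: "(X * b powr p * \<delta> powr (- N)) powr (q / p) = X powr (q / p) * b powr q * \<delta> powr (- (N * q / p))"
        if "0 < X" for X
        using assms that by (simp add: powr_mult powr_powr)
      show ?thesis by (rule *) (use C(1) \<kappa>(1) in simp)
    qed
    finally show ?thesis using assms by (simp add: powr_powr b_def \<delta>_def)
  qed
  moreover have "0 < (C / \<kappa>) powr (q / p)" using C \<kappa> by simp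
  ultimately show ?thesis using that unfolding N_def by blast
qed

section \<open>Test functions\<close>

definition test_fun :: "real \<Rightarrow> nat \<Rightarrow> complex ^ 'n \<Rightarrow> complex ^ 'n \<Rightarrow> complex"
  where "test_fun \<gamma> b a z = of_real (defect a powr (real b - \<gamma>)) / (1 - cdot z a) ^ b"

lemma norm_test_fun:
  "norm (test_fun \<gamma> b a z) = defect a powr (real b - \<gamma>) / norm (1 - cdot z a) ^ b"
  by (simp add: test_fun_def norm_divide norm_power)

lemma holomorphic_test_fun:
  fixes a :: "complex ^ 'n"
  assumes a: "a \<in> unit_ball"
  shows "holomorphic_ball (test_fun \<gamma> b a)"
  unfolding holomorphic_ball_def
proof
  fix z :: "complex ^ 'n" assume "z \<in> unit_ball"
  then have nz: "1 - cdot z a \<noteq> 0" using one_minus_cdot_nonzero a by auto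
  define g where "g w = of_real (defect a powr (real b - \<gamma>)) / (1 - w) ^ b" for w :: complex
  have "g field_differentiable (at (cdot z a))"
    unfolding g_def using nz by (intro derivative_intros) auto
  then obtain g' where "(g has_derivative (*) g') (at (cdot z a))"
    by (auto simp: field_differentiable_def has_field_derivative_def)
  from has_derivative_compose[OF has_derivative_cdot this]
  have "(test_fun \<gamma> b a has_derivative (\<lambda>v. g' * cdot v a)) (at z)"
    by (simp add: test_fun_def[abs_def] g_def)
  then show "\<exists>f'. (test_fun \<gamma> b a has_derivative f') (at z) \<and> (\<forall>c v. f' (c *s v) = c * f' v)"
    by (auto simp: cdot_simps)
qed

text \<open>The p-th power of the modulus is \<delta>^(bp - N) |1 - \<langle>z,a\<rangle>|^(-bp);
  the estimate with \<beta> = bp returns exactly the inverse power of \<delta>.\<close>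

lemma test_fun_bergman:
  fixes p \<alpha> :: real and b :: nat
  assumes "0 < p" "- 1 < \<alpha>" and b: "real CARD('n) + 1 + \<alpha> < real b * p"
  obtains B :: real where "0 < B"
    "\<And>a :: complex ^ 'n. a \<in> unit_ball \<Longrightarrow>
      test_fun ((real CARD('n) + 1 + \<alpha>) / p) b a \<in> bergman_space p \<alpha> \<and>
      bergman_norm p \<alpha> (test_fun ((real CARD('n) + 1 + \<alpha>) / p) b a) \<le> B"
proof -
  define N where "N = real CARD('n) + 1 + \<alpha>"
  obtain K where K: "0 < K" "\<And>a :: complex ^ 'n. a \<in> unit_ball \<Longrightarrow>
      weighted_lint \<alpha> (\<lambda>z. norm (1 - cdot z a) powr (- (real b * p)))
      \<le> ennreal (K * defect a powr (real CARD('n) + 1 + \<alpha> - real b * p))"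
    using forelli_rudin_estimate[OF assms(2) b] by auto
  define \<kappa> where "\<kappa> = vol_const TYPE('n) \<alpha>"
  note \<kappa> = nn_integral_vol_weighted[OF assms(2), where 'n='n, folded \<kappa>_def]
  have "test_fun (N / p) b a \<in> bergman_space p \<alpha> \<and> bergman_norm p \<alpha> (test_fun (N / p) b a) \<le> (\<kappa> * K) powr (1 / p)"
    if a: "a \<in> unit_ball" for a :: "complex ^ 'n"
  proof -
    define \<delta> where "\<delta> = defect a"
    have \<delta>: "0 < \<delta>" using norm_unit_ball_sq[OF a] by (simp add: \<delta>_def)
    let ?f = "test_fun (N / p) b a"
    have hol: "holomorphic_ball ?f" by (rule holomorphic_test_fun[OF a])
    have norm: "norm (?f z) powr p = \<delta> powr (real b * p - N) * norm (1 - cdot z a) powr (- (real b * p))"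
      if "z \<in> unit_ball" for z
    proof -
      have "1 - cdot z a \<noteq> 0" using one_minus_cdot_nonzero a that by auto
      then have "norm (?f z) = \<delta> powr (real b - N / p) / norm (1 - cdot z a) powr real b"
        by (simp add: norm_test_fun \<delta>_def powr_realpow)
      then have "norm (?f z) powr p = \<delta> powr ((real b - N / p) * p) / norm (1 - cdot z a) powr (real b * p)"
        by (simp add: powr_divide powr_powr)
      also have "(real b - N / p) * p = real b * p - N" using assms(1) by (simp add: field_simps)
      finally show ?thesis by (simp add: powr_minus divide_inverse)
    qed
    have meas: "(\<lambda>z. norm (1 - cdot z a) powr (- (real b * p)) * defect z powr \<alpha>)
        \<in> borel_measurable (restrict_space borel unit_ball)"
    proof (intro borel_measurable_continuous_on_restrict continuous_on_mult continuous_on_weight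
        continuous_on_powr continuous_on_const continuous_on_norm continuous_on_diff)
      show "continuous_on unit_ball (\<lambda>z. cdot z a)" unfolding cdot_def by (intro continuous_intros)
      show "\<forall>z\<in>unit_ball. norm (1 - cdot z a) \<noteq> 0"
        using one_minus_cdot_nonzero[of a] a by (metis mem_ball_0 norm_eq_zero)
    qed
    have "(\<integral>\<^sup>+z. ennreal (norm (?f z) powr p) \<partial>vol_weighted \<alpha>) =
        ennreal \<kappa> * weighted_lint \<alpha> (\<lambda>z. norm (?f z) powr p)"
      by (rule \<kappa>(2)[OF measurable_norm_powr_ball[OF hol assms(1)]])
    also have "weighted_lint \<alpha> (\<lambda>z. norm (?f z) powr p) =
        (\<integral>\<^sup>+z. ennreal (\<delta> powr (real b * p - N)) *
          (ennreal (norm (1 - cdot z a) powr (- (real b * p)) * defect z powr \<alpha>) * indicator unit_ball z) \<partial>lborel)"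
      by (intro nn_integral_cong) (auto simp: indicator_def norm mult_ac simp flip: ennreal_mult)
    also have "\<dots> = ennreal (\<delta> powr (real b * p - N)) *
        weighted_lint \<alpha> (\<lambda>z. norm (1 - cdot z a) powr (- (real b * p)))"
      using meas by (intro nn_integral_cmult)
        (auto simp flip: borel_measurable_restrict_space_iff_ennreal)
    also have "\<dots> \<le> ennreal (\<delta> powr (real b * p - N)) * ennreal (K * \<delta> powr (N - real b * p))"
      unfolding \<delta>_def N_def by (intro mult_left_mono K(2) a) auto
    also have "\<dots> = ennreal (K * (\<delta> powr (real b * p - N) * \<delta> powr (N - real b * p)))"
      using K by (simp add: mult_ac flip: ennreal_mult)
    also have "\<delta> powr (real b * p - N) * \<delta> powr (N - real b * p) = 1"
      using \<delta> by (simp flip: powr_add)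
    finally have "(\<integral>\<^sup>+z. ennreal (norm (?f z) powr p) \<partial>vol_weighted \<alpha>) \<le> ennreal (\<kappa> * K)"
      using \<kappa>(1) K(1) by (simp add: ennreal_mult mult_left_mono)
    from bergman_spaceI[OF hol assms(1) _ this] show ?thesis using \<kappa>(1) K(1) by simp
  qed
  moreover have "0 < (\<kappa> * K) powr (1 / p)" using \<kappa> K by simp
  ultimately show ?thesis using that unfolding N_def by blast
qed

section \<open>The embedding\<close>

definition tent_quot :: "real \<Rightarrow> real \<Rightarrow> real \<Rightarrow> real \<Rightarrow> (complex ^ 'n) measure \<Rightarrow>
    (complex ^ 'n \<Rightarrow> complex) \<Rightarrow> complex ^ 'n \<Rightarrow> ennreal"
  where "tent_quot q s t R \<mu> f a = (\<integral>\<^sup>+z\<in>bergman_ball a R. ennreal (norm (f z) powr q) \<partial>\<mu>) /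
      ennreal (defect a powr s * ln (2 / (1 - norm a)) powr t)"

lemma tent_sup_eq: "tent_sup q s t R \<mu> f = (SUP a\<in>unit_ball. tent_quot q s t R \<mu> f a)"
  by (simp add: tent_sup_def tent_quot_def)

lemma tent_weight_pos:
  "a \<in> unit_ball \<Longrightarrow> 0 < defect a powr s * ln (2 / (1 - norm a)) powr t"
proof -
  assume a: "a \<in> unit_ball"
  then have "1 < 2 / (1 - norm a)"
    by (auto simp: less_divide_eq intro: less_le_trans[OF _ norm_ge_zero])
  then have "0 < ln (2 / (1 - norm a))" by (rule ln_gt_zero)
  then show ?thesis using norm_unit_ball_sq[OF a] by simp
qed

text \<open>The tent norm contains 1 - |a| in the logarithm and the Carleson ratio 1 - |a|^2. These
  differ by a factor of at most 2, and the logarithms then by at most 1 + ln 2 / ln 2 = 2.\<close>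

lemma tent_weight_comparable:
  fixes a :: "complex ^ 'n"
  assumes a: "a \<in> unit_ball"
  defines "\<delta> \<equiv> defect a"
  shows "ln (2 / \<delta>) powr t \<le> 2 powr \<bar>t\<bar> * ln (2 / (1 - norm a)) powr t"
    and "ln (2 / (1 - norm a)) powr t \<le> 2 powr \<bar>t\<bar> * ln (2 / \<delta>) powr t"
proof -
  have \<delta>: "0 < \<delta>" "\<delta> \<le> 1" using one_minus_norm_sq_bounds[OF a] by (auto simp: \<delta>_def)
  have \<delta>_eq: "\<delta> = (1 - norm a) * (1 + norm a)" by (simp add: \<delta>_def power2_eq_square algebra_simps)
  have le: "\<delta> \<le> 2 * (1 - norm a)"
    unfolding \<delta>_eq mult.commute[of 2] using a by (intro mult_left_mono) auto
  have "(1 - norm a) * 1 \<le> \<delta>" unfolding \<delta>_eq using a by (intro mult_left_mono) auto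
  then have ge: "1 - norm a \<le> 2 * \<delta>" using \<delta>(1) by simp
  show "ln (2 / \<delta>) powr t \<le> 2 powr \<bar>t\<bar> * ln (2 / (1 - norm a)) powr t"
    using ln_powr_comparable[of \<delta> "1 - norm a" 2 t] \<delta> le ge a by simp
  show "ln (2 / (1 - norm a)) powr t \<le> 2 powr \<bar>t\<bar> * ln (2 / \<delta>) powr t"
    using ln_powr_comparable[of "1 - norm a" \<delta> 2 t] \<delta> le ge a by simp
qed

lemma borel_measurable_ball_measure:
  assumes "borel_measure_ball \<mu>" "holomorphic_ball f"
  shows "f \<in> borel_measurable \<mu>"
proof -
  have "f \<in> borel_measurable (restrict_space borel unit_ball)"
    by (intro borel_measurable_continuous_on_restrict holomorphic_ball_imp_continuous_on assms(2))
  then show ?thesis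
    by (simp add: measurable_cong_sets[OF assms(1)[unfolded borel_measure_ball_def] refl])
qed

text \<open>The power of the defect on the right reconciles the exponents \<open>s\<close> of the
  tent norm and s + (n+1+\<alpha>)q/p of the Carleson ratio; \<open>2 powr \<bar>t\<bar>\<close>
  reconciles the logarithms.\<close>

lemma tent_quot_le:
  fixes a :: "complex ^ 'n" and p \<alpha> q s t B :: real
  assumes \<mu>: "borel_measure_ball \<mu>" and a: "a \<in> unit_ball" and R: "0 < R" and B: "0 \<le> B"
    and le: "\<And>z. z \<in> bergman_ball a R \<Longrightarrow> norm (f z) powr q \<le> B"
  shows "tent_quot q s t R \<mu> f a \<le>
    ennreal (2 powr \<bar>t\<bar> * B * defect a powr ((real CARD('n) + 1 + \<alpha>) * q / p)) * carleson_ratio p \<alpha> q s t \<mu> R a"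
proof -
  let ?I = "\<integral>\<^sup>+z\<in>bergman_ball a R. ennreal (norm (f z) powr q) \<partial>\<mu>"
  define \<delta> where "\<delta> = defect a"
  define E where "E = (real CARD('n) + 1 + \<alpha>) * q / p"
  define u where "u = \<delta> powr s * ln (2 / (1 - norm a)) powr t"
  define v where "v = log_weight (s + E) t \<delta>"
  have \<delta>: "0 < \<delta>" "\<delta> \<le> 1" using one_minus_norm_sq_bounds[OF a] by (auto simp: \<delta>_def)
  have u: "0 < u" using tent_weight_pos[OF a] by (simp add: u_def \<delta>_def)
  have v: "0 < v" using \<delta> by (simp add: v_def log_weight_pos)
  have vu: "v \<le> 2 powr \<bar>t\<bar> * \<delta> powr E * u"
  proof -
    have "\<delta> powr (s + E) * ln (2 / \<delta>) powr t \<le> \<delta> powr (s + E) * (2 powr \<bar>t\<bar> * ln (2 / (1 - norm a)) powr t)"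
      unfolding \<delta>_def by (intro mult_left_mono tent_weight_comparable[OF a]) auto
    then show ?thesis by (simp add: v_def u_def log_weight_def powr_add mult_ac)
  qed
  have "?I \<le> (\<integral>\<^sup>+z. ennreal B * indicator (bergman_ball a R) z \<partial>\<mu>)"
    using le by (intro nn_integral_mono) (auto simp: indicator_def intro: ennreal_leI)
  also have "\<dots> = ennreal B * emeasure \<mu> (bergman_ball a R)"
    by (rule nn_integral_cmult_indicator[OF bergman_ball_in_sets[OF \<mu> a R]])
  finally have "tent_quot q s t R \<mu> f a \<le> ennreal B * emeasure \<mu> (bergman_ball a R) / ennreal u"
    unfolding tent_quot_def u_def \<delta>_def by (rule divide_right_mono_ennreal)
  also have "\<dots> = ennreal B * (emeasure \<mu> (bergman_ball a R) / ennreal u)"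
    by (simp add: ennreal_times_divide)
  also have "\<dots> \<le> ennreal B * (ennreal (2 powr \<bar>t\<bar> * \<delta> powr E) * (emeasure \<mu> (bergman_ball a R) / ennreal v))"
    by (intro mult_left_mono ennreal_divide_le_cmult[OF u v vu order_refl]) auto
  also have "\<dots> = ennreal (2 powr \<bar>t\<bar> * B * \<delta> powr E) * (emeasure \<mu> (bergman_ball a R) / ennreal v)"
    using B by (simp add: ennreal_mult mult_ac)
  finally show ?thesis
    unfolding carleson_ratio_eq \<delta>_def E_def v_def .
qed

text \<open>The assumed growth of \<open>f\<close> is exactly the difference between the two
  weights, so no power of the defect is left.\<close>

lemma carleson_ratio_le:
  fixes a :: "complex ^ 'n" and p \<alpha> q s t c :: real
  assumes \<mu>: "borel_measure_ball \<mu>" and a: "a \<in> unit_ball" and R: "0 < R" and c: "0 < c"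
    and ge: "\<And>z. z \<in> bergman_ball a R \<Longrightarrow>
      c * defect a powr (- ((real CARD('n) + 1 + \<alpha>) * q / p)) \<le> norm (f z) powr q"
  shows "carleson_ratio p \<alpha> q s t \<mu> R a \<le> ennreal (2 powr \<bar>t\<bar> / c) * tent_quot q s t R \<mu> f a"
proof -
  let ?I = "\<integral>\<^sup>+z\<in>bergman_ball a R. ennreal (norm (f z) powr q) \<partial>\<mu>"
  define \<delta> where "\<delta> = defect a"
  define E where "E = (real CARD('n) + 1 + \<alpha>) * q / p"
  define u where "u = \<delta> powr s * ln (2 / (1 - norm a)) powr t"
  define v where "v = log_weight (s + E) t \<delta>"
  define B where "B = c * \<delta> powr (- E)"
  have \<delta>: "0 < \<delta>" "\<delta> \<le> 1" using one_minus_norm_sq_bounds[OF a] by (auto simp: \<delta>_def)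
  have B: "0 < B" using c \<delta> by (simp add: B_def)
  have u: "0 < u" using tent_weight_pos[OF a] by (simp add: u_def \<delta>_def)
  have v: "0 < v" using \<delta> by (simp add: v_def log_weight_pos)
  have uv: "u / B \<le> 2 powr \<bar>t\<bar> / c * v"
  proof -
    have "\<delta> powr s * ln (2 / (1 - norm a)) powr t \<le> \<delta> powr s * (2 powr \<bar>t\<bar> * ln (2 / \<delta>) powr t)"
      unfolding \<delta>_def by (intro mult_left_mono tent_weight_comparable[OF a]) auto
    then have "u * (\<delta> powr E / c) \<le> \<delta> powr s * (2 powr \<bar>t\<bar> * ln (2 / \<delta>) powr t) * (\<delta> powr E / c)"
      unfolding u_def using c by (intro mult_right_mono) auto
    then show ?thesis using \<delta> by (simp add: B_def v_def log_weight_def powr_add powr_minus divide_inverse mult_ac)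
  qed
  have "ennreal B * emeasure \<mu> (bergman_ball a R) = (\<integral>\<^sup>+z. ennreal B * indicator (bergman_ball a R) z \<partial>\<mu>)"
    by (rule nn_integral_cmult_indicator[OF bergman_ball_in_sets[OF \<mu> a R], symmetric])
  also have "\<dots> \<le> ?I"
    using ge by (intro nn_integral_mono) (auto simp: indicator_def B_def \<delta>_def E_def intro: ennreal_leI)
  finally have le: "ennreal B * emeasure \<mu> (bergman_ball a R) \<le> ?I" .
  have "emeasure \<mu> (bergman_ball a R) = ennreal (1 / B) * (ennreal B * emeasure \<mu> (bergman_ball a R))"
    using B by (simp flip: ennreal_mult mult.assoc)
  also have "\<dots> \<le> ennreal (1 / B) * ?I"
    by (intro mult_left_mono le) auto
  finally have "emeasure \<mu> (bergman_ball a R) / ennreal v \<le>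
      ennreal (1 / B) * ?I / ennreal v"
    by (rule divide_right_mono_ennreal)
  also have "\<dots> = ennreal (1 / B) * (?I / ennreal v)"
    by (simp add: ennreal_times_divide)
  also have "\<dots> \<le> ennreal (1 / B) * (ennreal (2 powr \<bar>t\<bar> / c * B) *
      (?I / ennreal u))"
  proof (intro mult_left_mono ennreal_divide_le_cmult[OF v u _ order_refl])
    show "u \<le> 2 powr \<bar>t\<bar> / c * B * v" using uv B by (simp add: pos_divide_le_eq mult_ac)
  qed auto
  finally have "carleson_ratio p \<alpha> q s t \<mu> R a \<le> ennreal (1 / B) *
      (ennreal (2 powr \<bar>t\<bar> / c * B) * tent_quot q s t R \<mu> f a)"
    unfolding carleson_ratio_eq tent_quot_def u_def v_def \<delta>_def E_def .
  also have "\<dots> = ennreal (1 / B * (2 powr \<bar>t\<bar> / c * B)) * tent_quot q s t R \<mu> f a"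
    using B c by (subst ennreal_mult) (auto simp: mult.assoc)
  also have "1 / B * (2 powr \<bar>t\<bar> / c * B) = 2 powr \<bar>t\<bar> / c" using B by simp
  finally show ?thesis .
qed

definition carleson_sup where
  "carleson_sup p \<alpha> q s t \<mu> R = (SUP a\<in>unit_ball. carleson_ratio p \<alpha> q s t \<mu> R a)"

text \<open>The filter lets |a| tend to 1 from below, so only points of the open ball count.\<close>

definition carleson_vanishing where
  "carleson_vanishing p \<alpha> q s t \<mu> R \<longleftrightarrow>
    (carleson_ratio p \<alpha> q s t \<mu> R \<longlongrightarrow> 0) (filtercomap norm (at_left 1))"

lemma carleson_ratio_le_sup: "a \<in> unit_ball \<Longrightarrow> carleson_ratio p \<alpha> q s t \<mu> R a \<le> carleson_sup p \<alpha> q s t \<mu> R"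
  unfolding carleson_sup_def by (rule SUP_upper)

lemma tent_quot_le_sup: "a \<in> unit_ball \<Longrightarrow> tent_quot q s t R \<mu> f a \<le> tent_sup q s t R \<mu> f"
  unfolding tent_sup_eq by (rule SUP_upper)

lemma exponent_exists:
  fixes N p :: real
  assumes "0 < p"
  obtains b :: nat where "N < real b * p"
  using reals_Archimedean3[OF assms] by blast

lemma tent_sup_eq_tent_norm:
  assumes "f \<in> tent_space q s t R \<mu>" "0 < q"
  shows "tent_sup q s t R \<mu> f = ennreal (tent_norm q s t R \<mu> f powr q)"
  using assms by (simp add: tent_space_def tent_norm_def powr_powr)

text \<open>Centres in a compact part have all their Bergman balls in one compact ball, since 1 -
  |w|^2 \<ge> (1 - r^2) / M there. On that ball local finiteness of \<mu> and locally uniform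
  convergence become available.\<close>

lemma bergman_ball_subset_cball:
  assumes R: "0 < R" and r: "0 \<le> r" "r < 1"
  obtains r' where "0 \<le> r'" "r' < 1"
    "\<And>a :: complex ^ 'n. norm a \<le> r \<Longrightarrow> bergman_ball a R \<subseteq> cball 0 r'"
proof -
  define \<rho> where "\<rho> = bergman_radius R"
  define M where "M = 4 / (1 - \<rho>)\<^sup>2"
  have \<rho>: "0 < \<rho>" "\<rho> < 1" using bergman_radius[of R] R by (auto simp: \<rho>_def)
  have "(1 - \<rho>)\<^sup>2 \<le> 1" using \<rho> by (simp add: power_le_one)
  then have M: "1 \<le> M" using \<rho> by (simp add: M_def field_simps)
  have r2: "r\<^sup>2 < 1" using r by (simp add: power_less_one_iff)
  define e where "e = (1 - r\<^sup>2) / M"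
  have e: "0 < e" "e \<le> 1"
  proof -
    show "0 < e" using r2 M by (simp add: e_def)
    have "1 - r\<^sup>2 \<le> M" using M zero_le_power2[of r] by linarith
    then show "e \<le> 1" using M by (simp add: e_def)
  qed
  have "norm w \<le> sqrt (1 - e)" if a: "norm a \<le> r" and w: "w \<in> bergman_ball a R" for a w :: "complex ^ 'n"
  proof (rule real_le_rsqrt)
    have ab: "a \<in> unit_ball" using a r by simp
    have "(norm a)\<^sup>2 \<le> r\<^sup>2" using a by (intro power_mono) auto
    then have "1 - r\<^sup>2 \<le> M * defect w"
      using bergman_ball_comparable(2)[OF ab R w] by (simp add: M_def \<rho>_def)
    then have "e \<le> defect w" using M by (simp add: e_def pos_divide_le_eq mult.commute)
    then show "(norm w)\<^sup>2 \<le> 1 - e" by simp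
  qed
  then have "bergman_ball a R \<subseteq> cball 0 (sqrt (1 - e))" if "norm a \<le> r" for a :: "complex ^ 'n"
    using that by auto
  moreover have "sqrt (1 - e) < 1" "0 \<le> sqrt (1 - e)" using e by simp_all
  ultimately show ?thesis using that by blast
qed

text \<open>For |z| \<le> r the denominator is at least (1 - r)^b in modulus, while the numerator
  tends to 0 because its exponent b - \<gamma> is positive.\<close>

lemma test_fun_uniform_limit:
  fixes a :: "nat \<Rightarrow> complex ^ 'n"
  assumes a: "\<And>k. a k \<in> unit_ball" and lim: "(\<lambda>k. norm (a k)) \<longlonglongrightarrow> 1" and \<gamma>: "\<gamma> < real b"
    and K: "compact K" "K \<subseteq> unit_ball"
  shows "uniform_limit K (\<lambda>k. test_fun \<gamma> b (a k)) (\<lambda>_. 0) sequentially"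
proof -
  obtain r where r: "0 \<le> r" "r < 1" "\<And>z. z \<in> K \<Longrightarrow> norm z \<le> r"
  proof (cases "K = {}")
    case False
    then obtain z0 where "z0 \<in> K" "\<And>z. z \<in> K \<Longrightarrow> norm z \<le> norm z0"
      using continuous_attains_sup[OF K(1), of norm] by (auto intro: continuous_intros)
    then show ?thesis using K(2) by (intro that[of "norm z0"]) auto
  qed (use that[of 0] in auto)
  define g where "g k = (defect (a k)) powr (real b - \<gamma>) / (1 - r) ^ b" for k
  have "(\<lambda>k. defect (a k)) \<longlonglongrightarrow> 1 - 1\<^sup>2" by (intro tendsto_intros lim)
  then have "(\<lambda>k. (defect (a k)) powr (real b - \<gamma>)) \<longlonglongrightarrow> 0 powr (real b - \<gamma>)"
    using \<gamma> one_minus_norm_sq_bounds[OF a]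
    by (intro tendsto_powr' tendsto_const) (auto intro!: always_eventually less_imp_le)
  then have "g \<longlonglongrightarrow> 0 / (1 - r) ^ b" unfolding g_def using r by (intro tendsto_divide tendsto_const) auto
  then have g: "g \<longlonglongrightarrow> 0" by simp
  have le: "norm (test_fun \<gamma> b (a k) z) \<le> g k" if z: "z \<in> K" for k z
  proof -
    have "norm (cdot z (a k)) \<le> r * 1"
      using r(1) r(3)[OF z] a[of k] by (intro order_trans[OF norm_cdot_le] mult_mono) auto
    then have "1 - r \<le> norm (1 - cdot z (a k))"
      using norm_triangle_ineq2[of 1 "cdot z (a k)"] by simp
    then show ?thesis
      unfolding norm_test_fun g_def using r by (intro divide_left_mono power_mono mult_pos_pos zero_less_power) auto
  qed
  show ?thesis
  proof (rule uniform_limitI)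
    fix e :: real assume "0 < e"
    with g have "eventually (\<lambda>k. g k < e) sequentially" by (rule order_tendstoD)
    then show "eventually (\<lambda>k. \<forall>z\<in>K. dist (test_fun \<gamma> b (a k) z) 0 < e) sequentially"
    proof eventually_elim
      case (elim k)
      show ?case
      proof
        fix z assume "z \<in> K"
        from le[OF this, of k] elim show "dist (test_fun \<gamma> b (a k) z) 0 < e" by simp
      qed
    qed
  qed
qed

section \<open>Tent quotients against Carleson ratios at a single point\<close>

context
  fixes p q \<alpha> s t :: real
  assumes p: "0 < p" and q: "0 < q" and \<alpha>: "- 1 < \<alpha>"
begin

abbreviation "bspace \<equiv> bergman_space p \<alpha>"
abbreviation "bnorm \<equiv> bergman_norm p \<alpha>"
abbreviation "quot \<equiv> tent_quot q s t"
abbreviation "ratio \<equiv> carleson_ratio p \<alpha> q s t"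
abbreviation "csup \<equiv> carleson_sup p \<alpha> q s t"
abbreviation "vanishing \<equiv> carleson_vanishing p \<alpha> q s t"
abbreviation "emb_bound \<equiv> embedding_bound p \<alpha> q s t"
abbreviation "emb_bounded \<equiv> embedding_bounded p \<alpha> q s t"
abbreviation "emb_norm \<equiv> embedding_norm p \<alpha> q s t"
abbreviation "emb_compact \<equiv> embedding_compact p \<alpha> q s t"

text \<open>The pointwise bound costs a negative power of the defect, which stays comparable on
  D(a,R) and cancels against the one in \<open>tent_quot_le\<close>. Keeping the same point
  \<open>a\<close> on both sides lets the estimate serve boundedness and compactness alike.\<close>

lemma tent_quot_bergman_le:
  assumes R: "0 < R"
  obtains C :: real where "0 < C"
    "\<And>\<mu> (f :: complex ^ 'n \<Rightarrow> complex) a. borel_measure_ball \<mu> \<Longrightarrow> f \<in> bspace \<Longrightarrow> a \<in> unit_ball \<Longrightarrow>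
      quot R \<mu> f a \<le> ennreal (C * bnorm f powr q) * ratio \<mu> R a"
proof -
  define E where "E = (real CARD('n) + 1 + \<alpha>) * q / p"
  obtain C where C: "0 < C" "\<And>(f :: complex ^ 'n \<Rightarrow> complex) z. f \<in> bspace \<Longrightarrow> z \<in> unit_ball \<Longrightarrow>
      norm (f z) powr q \<le> C * bnorm f powr q *
        defect z powr (- ((real CARD('n) + 1 + \<alpha>) * q / p))"
    using bergman_pointwise[OF p q \<alpha>, where 'n='n] by auto
  define \<rho> where "\<rho> = bergman_radius R"
  define M where "M = 4 / (1 - \<rho>)\<^sup>2"
  have \<rho>: "0 < \<rho>" "\<rho> < 1" using bergman_radius[of R] R by (auto simp: \<rho>_def)
  have "(1 - \<rho>)\<^sup>2 \<le> 1" using \<rho> by (simp add: power_le_one)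
  then have M: "1 \<le> M" using \<rho> by (simp add: M_def field_simps)
  define K where "K = 2 powr \<bar>t\<bar> * (C * M powr \<bar>- E\<bar>)"
  have "quot R \<mu> f a \<le> ennreal (K * bnorm f powr q) * ratio \<mu> R a"
    if \<mu>: "borel_measure_ball \<mu>" and f: "f \<in> bspace" and a: "a \<in> unit_ball"
    for \<mu> and f :: "complex ^ 'n \<Rightarrow> complex" and a
  proof -
    define \<delta> where "\<delta> = defect a"
    have \<delta>: "0 < \<delta>" "\<delta> \<le> 1" using one_minus_norm_sq_bounds[OF a] by (auto simp: \<delta>_def)
    let ?b = "bnorm f powr q"
    define B where "B = C * ?b * (M powr \<bar>- E\<bar> * \<delta> powr (- E))"
    have "norm (f z) powr q \<le> B" if z: "z \<in> bergman_ball a R" for z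
    proof -
      have zb: "z \<in> unit_ball" using z by (simp add: bergman_ball_def)
      have "norm (f z) powr q \<le> C * ?b * defect z powr (- E)"
        using C(2)[OF f zb] by (simp add: E_def)
      also have "defect z powr (- E) \<le> M powr \<bar>- E\<bar> * \<delta> powr (- E)"
        using bergman_ball_comparable(1,2)[OF a R z] norm_unit_ball_sq[OF zb] \<delta> M
        by (intro powr_le_powr_cmult) (auto simp: M_def \<rho>_def \<delta>_def)
      finally show ?thesis using C(1) by (simp add: B_def mult_left_mono)
    qed
    moreover have "0 \<le> B" using C M by (simp add: B_def)
    ultimately have "quot R \<mu> f a \<le>
      ennreal (2 powr \<bar>t\<bar> * B * \<delta> powr E) * ratio \<mu> R a"
      unfolding \<delta>_def E_def by (intro tent_quot_le[OF \<mu> a R]) auto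
    also have "2 powr \<bar>t\<bar> * B * \<delta> powr E = K * ?b * (\<delta> powr (- E) * \<delta> powr E)"
      by (simp add: B_def K_def mult_ac)
    also have "\<delta> powr (- E) * \<delta> powr E = 1" using \<delta> by (simp flip: powr_add)
    finally show ?thesis by simp
  qed
  moreover have "0 < K" using C M by (simp add: K_def)
  ultimately show ?thesis using that by blast
qed

lemma carleson_ratio_le_test_fun:
  assumes R: "0 < R"
  obtains C :: real where "0 < C"
    "\<And>\<mu> (a :: complex ^ 'n). borel_measure_ball \<mu> \<Longrightarrow> a \<in> unit_ball \<Longrightarrow>
      ratio \<mu> R a \<le>
      ennreal C * quot R \<mu> (test_fun ((real CARD('n) + 1 + \<alpha>) / p) b a) a"
proof -
  define N where "N = real CARD('n) + 1 + \<alpha>"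
  define \<rho> where "\<rho> = bergman_radius R"
  have \<rho>: "0 < \<rho>" "\<rho> < 1" using bergman_radius[of R] R by (auto simp: \<rho>_def)
  \<comment> \<open>From |1 - \<langle>z,a\<rangle>| \<le> \<delta> / (1 - \<rho>) on D(a,R): the
    test function is at least (1-\<rho>)^b \<delta>^(-N/p) in modulus, and this is raised to the
    power \<open>q\<close>.\<close>
  define c where "c = ((1 - \<rho>) ^ b) powr q"
  have c: "0 < c" using \<rho> by (simp add: c_def)
  have "ratio \<mu> R a \<le> ennreal (2 powr \<bar>t\<bar> / c) * quot R \<mu> (test_fun (N / p) b a) a"
    if \<mu>: "borel_measure_ball \<mu>" and a: "a \<in> unit_ball" for \<mu> and a :: "complex ^ 'n"
  proof (rule carleson_ratio_le[OF \<mu> a R c])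
    fix z assume z: "z \<in> bergman_ball a R"
    define \<delta> where "\<delta> = defect a"
    have \<delta>: "0 < \<delta>" using norm_unit_ball_sq[OF a] by (simp add: \<delta>_def)
    have "z \<in> unit_ball" using z by (simp add: bergman_ball_def)
    then have nz: "0 < norm (1 - cdot z a)" using one_minus_cdot_nonzero[of a z] a by simp
    have le: "norm (1 - cdot z a) \<le> \<delta> / (1 - \<rho>)"
      using bergman_ball_comparable(3)[OF a R z] by (simp add: \<delta>_def \<rho>_def)
    have "\<delta> powr (real b - N / p) * (1 - \<rho>) ^ b / \<delta> ^ b = \<delta> powr (real b - N / p) / (\<delta> / (1 - \<rho>)) ^ b"
      by (simp add: power_divide)
    also have "\<dots> \<le> \<delta> powr (real b - N / p) / norm (1 - cdot z a) ^ b"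
      using le nz by (intro divide_left_mono power_mono) (auto simp: \<delta> \<rho>)
    finally have "(\<delta> powr (real b - N / p) / \<delta> powr real b) * (1 - \<rho>) ^ b \<le> norm (test_fun (N / p) b a z)"
      using \<delta> by (simp add: norm_test_fun \<delta>_def powr_realpow)
    also have "\<delta> powr (real b - N / p) / \<delta> powr real b = \<delta> powr (- (N / p))"
      by (simp flip: powr_diff)
    finally have "(\<delta> powr (- (N / p)) * (1 - \<rho>) ^ b) powr q \<le> norm (test_fun (N / p) b a z) powr q"
      using q \<rho> by (intro powr_mono2) auto
    then show "c * defect a powr (- ((real CARD('n) + 1 + \<alpha>) * q / p)) \<le> norm (test_fun (N / p) b a z) powr q"
      using \<rho> by (simp add: powr_mult powr_powr c_def \<delta>_def N_def mult_ac)
  qed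
  then show ?thesis using that c unfolding N_def by (metis divide_pos_pos powr_gt_zero zero_neq_numeral)
qed

text \<open>Fixes \<gamma> = N/p and some \<open>b\<close> with bp > N. This one inequality gives
  both the bound in the Bergman space and \<gamma> < b, which is needed for locally uniform
  convergence.\<close>

lemma test_functions:
  assumes R: "0 < R"
  obtains \<gamma> b B K where "\<gamma> < real b" "0 < B"
    "\<And>a :: complex ^ 'n. a \<in> unit_ball \<Longrightarrow> test_fun \<gamma> b a \<in> bspace \<and> bnorm (test_fun \<gamma> b a) \<le> B"
    "0 < K" "\<And>\<mu> (a :: complex ^ 'n). borel_measure_ball \<mu> \<Longrightarrow> a \<in> unit_ball \<Longrightarrow>
      ratio \<mu> R a \<le> ennreal K * quot R \<mu> (test_fun \<gamma> b a) a"
proof -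
  define N where "N = real CARD('n) + 1 + \<alpha>"
  obtain b :: nat where b: "N < real b * p" by (rule exponent_exists[OF p])
  obtain B where B: "0 < B" "\<And>a :: complex ^ 'n. a \<in> unit_ball \<Longrightarrow>
      test_fun (N / p) b a \<in> bspace \<and> bnorm (test_fun (N / p) b a) \<le> B"
    using test_fun_bergman[OF p \<alpha> b[unfolded N_def]] unfolding N_def by auto
  obtain K where K: "0 < K" "\<And>\<mu> (a :: complex ^ 'n). borel_measure_ball \<mu> \<Longrightarrow> a \<in> unit_ball \<Longrightarrow>
      ratio \<mu> R a \<le> ennreal K * quot R \<mu> (test_fun (N / p) b a) a"
    using carleson_ratio_le_test_fun[OF R, of b, where 'n='n] unfolding N_def by auto
  have "N / p < real b" using b p by (simp add: field_simps)
  then show ?thesis using that B K by blast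
qed

section \<open>Change of radius\<close>

lemma carleson_sup_transfer:
  assumes "0 < R" "0 < R'"
  obtains C :: real where "0 < C"
    "\<And>\<mu> :: (complex ^ 'n) measure. borel_measure_ball \<mu> \<Longrightarrow> csup \<mu> R' < \<infinity> \<Longrightarrow>
      csup \<mu> R < \<infinity> \<and> enn2real (csup \<mu> R) \<le> C * enn2real (csup \<mu> R')"
proof -
  obtain C :: real and F :: "(complex ^ 'n) set" where CF: "0 < C" "finite F" "F \<subseteq> unit_ball"
    "\<And>\<mu> (a :: complex ^ 'n). borel_measure_ball \<mu> \<Longrightarrow> a \<in> unit_ball \<Longrightarrow>
      ratio \<mu> R a \<le> ennreal C * (\<Sum>b\<in>F. ratio \<mu> R' (mobius a b))"
    using carleson_ratio_transfer[OF assms, of p \<alpha> q s t, where 'n='n] by blast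
  \<comment> \<open>Adding 1 to the cardinality keeps the constant positive without knowing that
    \<open>F\<close> is nonempty.\<close>
  define C' where "C' = C * (real (card F) + 1)"
  have C': "0 < C'" using CF(1) by (simp add: C'_def add_nonneg_pos)
  have le: "csup \<mu> R \<le> ennreal C' * csup \<mu> R'"
    if \<mu>: "borel_measure_ball \<mu>" for \<mu> :: "(complex ^ 'n) measure"
    unfolding carleson_sup_def[of p \<alpha> q s t \<mu> R]
  proof (rule SUP_least)
    fix a :: "complex ^ 'n" assume a: "a \<in> unit_ball"
    have "(\<Sum>b\<in>F. ratio \<mu> R' (mobius a b)) \<le> (\<Sum>b\<in>F. csup \<mu> R')"
      using CF(3) by (intro sum_mono carleson_ratio_le_sup mobius_in_ball[OF a]) auto
    also have "\<dots> = ennreal (real (card F)) * csup \<mu> R'"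
      by (simp add: ennreal_of_nat_eq_real_of_nat)
    also have "\<dots> \<le> ennreal (real (card F) + 1) * csup \<mu> R'"
      by (intro mult_right_mono ennreal_leI) auto
    finally have le: "(\<Sum>b\<in>F. ratio \<mu> R' (mobius a b)) \<le>
        ennreal (real (card F) + 1) * csup \<mu> R'" .
    have "ratio \<mu> R a \<le> ennreal C * (\<Sum>b\<in>F. ratio \<mu> R' (mobius a b))"
      by (rule CF(4)[OF \<mu> a])
    also have "\<dots> \<le> ennreal C * (ennreal (real (card F) + 1) * csup \<mu> R')"
      by (intro mult_left_mono le) auto
    finally show "ratio \<mu> R a \<le> ennreal C' * csup \<mu> R'"
      using CF(1) by (simp add: C'_def ennreal_mult mult.assoc)
  qed
  show ?thesis
  proof (rule that[OF C'], rule conjI)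
    fix \<mu> :: "(complex ^ 'n) measure"
    assume \<mu>: "borel_measure_ball \<mu>" and "csup \<mu> R' < \<infinity>"
    then have fin: "ennreal C' * csup \<mu> R' < \<infinity>" by (simp add: ennreal_mult_less_top)
    show "csup \<mu> R < \<infinity>" using le[OF \<mu>] fin by (rule le_less_trans)
    show "enn2real (csup \<mu> R) \<le> C' * enn2real (csup \<mu> R')"
      using enn2real_mono[OF le[OF \<mu>]] fin C' by (simp add: enn2real_mult)
  qed
qed

lemma carleson_vanishing_iff:
  fixes \<mu> :: "(complex ^ 'n) measure"
  shows "vanishing \<mu> R \<longleftrightarrow>
    (\<forall>e>0. \<exists>r. 0 \<le> r \<and> r < 1 \<and> (\<forall>a. r < norm a \<and> norm a < 1 \<longrightarrow> ratio \<mu> R a \<le> ennreal e))"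
  (is "_ \<longleftrightarrow> ?rhs")
proof
  assume lim: "vanishing \<mu> R"
  show ?rhs
  proof (intro allI impI)
    fix e :: real assume "0 < e"
    then have "eventually (\<lambda>a. ratio \<mu> R a < ennreal e) (filtercomap norm (at_left 1))"
      using order_tendstoD(2)[OF lim[unfolded carleson_vanishing_def], of "ennreal e"] by simp
    then obtain Q where Q: "eventually Q (at_left (1 :: real))"
      "\<And>a. Q (norm a) \<Longrightarrow> ratio \<mu> R a < ennreal e"
      unfolding eventually_filtercomap by blast
    then obtain r where "r < 1" "\<And>y. r < y \<Longrightarrow> y < 1 \<Longrightarrow> Q y"
      unfolding eventually_at_left_field by blast
    with Q(2) show "\<exists>r. 0 \<le> r \<and> r < 1 \<and> (\<forall>a. r < norm a \<and> norm a < 1 \<longrightarrow> ratio \<mu> R a \<le> ennreal e)"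
      by (intro exI[of _ "max 0 r"]) (auto intro: less_imp_le)
  qed
next
  assume r: ?rhs
  show "vanishing \<mu> R"
    unfolding carleson_vanishing_def
  proof (rule order_tendstoI)
    fix x :: ennreal assume "0 < x"
    then obtain y where y: "0 < y" "y < x" using dense by blast
    then obtain e where e: "y = ennreal e" "0 < e" by (cases y) auto
    obtain r where "r < 1" "\<And>a. r < norm a \<Longrightarrow> norm a < 1 \<Longrightarrow> ratio \<mu> R a \<le> ennreal e"
      using r e by blast
    then show "eventually (\<lambda>a. ratio \<mu> R a < x) (filtercomap norm (at_left 1))"
      unfolding eventually_filtercomap eventually_at_left_field
      using y e by (intro exI[of _ "\<lambda>y. r < y \<and> y < 1"]) (auto intro: le_less_trans)
  qed simp
qed

text \<open>As |a| tends to 1, the finitely many centres \<phi>_a(b) approach the sphere together,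
  since their defects are at most \<open>M\<close> times that of \<open>a\<close>.\<close>

lemma carleson_vanishing_transfer:
  fixes \<mu> :: "(complex ^ 'n) measure"
  assumes R: "0 < R" "0 < R'" and \<mu>: "borel_measure_ball \<mu>" and lim: "vanishing \<mu> R'"
  shows "vanishing \<mu> R"
  unfolding carleson_vanishing_iff
proof (intro allI impI)
  fix e :: real assume e: "0 < e"
  obtain C :: real and F :: "(complex ^ 'n) set" where CF: "0 < C" "finite F" "F \<subseteq> unit_ball"
    "\<And>\<mu> (a :: complex ^ 'n). borel_measure_ball \<mu> \<Longrightarrow> a \<in> unit_ball \<Longrightarrow>
      ratio \<mu> R a \<le> ennreal C * (\<Sum>b\<in>F. ratio \<mu> R' (mobius a b))"
    using carleson_ratio_transfer[OF R, of p \<alpha> q s t, where 'n='n] by blast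
  define \<rho> where "\<rho> = Max (insert 0 (norm ` F))"
  have \<rho>: "0 \<le> \<rho>" "\<rho> < 1" "\<And>b. b \<in> F \<Longrightarrow> norm b \<le> \<rho>"
    using CF(2,3) by (auto simp: \<rho>_def)
  define M where "M = 4 / (1 - \<rho>)\<^sup>2"
  have M: "0 < M" using \<rho> by (simp add: M_def)
  define e' where "e' = e / (C * (real (card F) + 1))"
  have card: "0 < real (card F) + 1" by (simp add: add_nonneg_pos)
  have e': "0 < e'" using e CF(1) card by (simp add: e'_def)
  then obtain r where r: "0 \<le> r" "r < 1"
    "\<And>a. r < norm a \<Longrightarrow> norm a < 1 \<Longrightarrow> ratio \<mu> R' a \<le> ennreal e'"
    using lim unfolding carleson_vanishing_iff by blast
  \<comment> \<open>The defect of \<open>a\<close> is at most 2(1 - |a|); for |a| > r' it is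
    therefore below (1 - r^2) / M, and that of \<phi>_a(b) is below 1 - r^2.\<close>
  define r' where "r' = max 0 (1 - (1 - r\<^sup>2) / (2 * M))"
  have r2: "r\<^sup>2 < 1" using r by (simp add: power_less_one_iff)
  have r': "0 \<le> r'" "r' < 1" using r2 M by (auto simp: r'_def)
  have "ratio \<mu> R a \<le> ennreal e" if a1: "r' < norm a" "norm a < 1" for a :: "complex ^ 'n"
  proof -
    have a: "a \<in> unit_ball" using a1 by simp
    have b_le: "ratio \<mu> R' (mobius a b) \<le> ennreal e'" if b: "b \<in> F" for b
    proof (rule r(3))
      have mb: "mobius a b \<in> unit_ball" using mobius_in_ball[OF a] CF(3) b by blast
      then show "norm (mobius a b) < 1" by simp
      have "defect a = (1 - norm a) * (1 + norm a)" by (simp add: power2_eq_square algebra_simps)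
      also have "\<dots> \<le> (1 - norm a) * 2" using a1 by (intro mult_left_mono) auto
      also have "\<dots> < (1 - r\<^sup>2) / (2 * M) * 2"
      proof (rule mult_strict_right_mono)
        show "1 - norm a < (1 - r\<^sup>2) / (2 * M)" using a1(1) unfolding r'_def max_less_iff_conj by linarith
      qed simp
      finally have "M * defect a < 1 - r\<^sup>2" using M by (simp add: field_simps)
      then have "r\<^sup>2 < (norm (mobius a b))\<^sup>2"
        using mobius_comparable(1)[OF a \<rho>(3)[OF b] \<rho>(1,2)] by (simp add: M_def)
      then show "r < norm (mobius a b)" by (rule power2_less_imp_less) simp
    qed
    have "ratio \<mu> R a \<le> ennreal C * (\<Sum>b\<in>F. ratio \<mu> R' (mobius a b))"
      by (rule CF(4)[OF \<mu> a])
    also have "\<dots> \<le> ennreal C * (\<Sum>b\<in>F. ennreal e')"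
      by (intro mult_left_mono sum_mono b_le) auto
    also have "\<dots> = ennreal (C * (real (card F) * e'))"
      using CF(1) e' by (simp add: ennreal_of_nat_eq_real_of_nat ennreal_mult)
    also have "C * (real (card F) * e') \<le> C * ((real (card F) + 1) * e')"
      using CF(1) e' by (intro mult_left_mono mult_right_mono) auto
    also have "\<dots> = e" using CF(1) card by (simp add: e'_def)
    finally show ?thesis by (simp add: ennreal_leI)
  qed
  then show "\<exists>r. 0 \<le> r \<and> r < 1 \<and> (\<forall>a. r < norm a \<and> norm a < 1 \<longrightarrow> ratio \<mu> R a \<le> ennreal e)"
    using r' by blast
qed

section \<open>Boundedness and the norm of the embedding\<close>

lemma embedding_bound_if_carleson:
  assumes R: "0 < R"
  obtains C :: real where "0 < C"
    "\<And>\<mu> :: (complex ^ 'n) measure. borel_measure_ball \<mu> \<Longrightarrow> csup \<mu> R < \<infinity> \<Longrightarrow>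
      emb_bound R \<mu> ((C * enn2real (csup \<mu> R)) powr (1 / q))"
proof -
  obtain C where C: "0 < C"
    "\<And>\<mu> (f :: complex ^ 'n \<Rightarrow> complex) a. borel_measure_ball \<mu> \<Longrightarrow> f \<in> bspace \<Longrightarrow> a \<in> unit_ball \<Longrightarrow>
      quot R \<mu> f a \<le> ennreal (C * bnorm f powr q) * ratio \<mu> R a"
    using tent_quot_bergman_le[OF R, where 'n='n] by auto
  have "emb_bound R \<mu> ((C * enn2real (csup \<mu> R)) powr (1 / q))"
    if \<mu>: "borel_measure_ball \<mu>" and fin: "csup \<mu> R < \<infinity>" for \<mu> :: "(complex ^ 'n) measure"
    unfolding embedding_bound_def
  proof (intro conjI ballI)
    fix f :: "complex ^ 'n \<Rightarrow> complex" assume f: "f \<in> bspace"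
    define X where "X = enn2real (csup \<mu> R)"
    have X: "0 \<le> X" "csup \<mu> R = ennreal X" using fin by (simp_all add: X_def)
    let ?b = "bnorm f"
    have "tent_sup q s t R \<mu> f \<le> ennreal (C * ?b powr q) * ennreal X"
      unfolding tent_sup_eq X(2)[symmetric]
      by (intro SUP_least order_trans[OF C(2)[OF \<mu> f]] mult_left_mono carleson_ratio_le_sup) auto
    also have "\<dots> = ennreal (C * X * ?b powr q)"
      using C(1) X(1) by (simp add: mult_ac flip: ennreal_mult)
    finally have le: "tent_sup q s t R \<mu> f \<le> ennreal (C * X * ?b powr q)" .
    then have "tent_sup q s t R \<mu> f < \<infinity>" by (auto intro: le_less_trans)
    moreover have "f \<in> borel_measurable \<mu>"
      using f by (intro borel_measurable_ball_measure[OF \<mu>]) (simp add: bergman_space_def)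
    ultimately show "f \<in> tent_space q s t R \<mu>" by (simp add: tent_space_def)
    have "enn2real (tent_sup q s t R \<mu> f) \<le> C * X * ?b powr q"
      using C(1) X(1) by (intro enn2real_leI le) auto
    then have "tent_norm q s t R \<mu> f \<le> (C * X * ?b powr q) powr (1 / q)"
      unfolding tent_norm_def using q by (intro powr_mono2) auto
    also have "\<dots> = (C * X) powr (1 / q) * ?b"
      using C(1) X(1) q bergman_norm_nonneg[of p \<alpha> f] by (simp add: powr_mult powr_powr)
    finally show "tent_norm q s t R \<mu> f \<le> (C * enn2real (csup \<mu> R)) powr (1 / q) * ?b"
      by (simp add: X_def)
  qed simp
  with C(1) show ?thesis using that by blast
qed

lemma carleson_if_embedding_bound:
  assumes R: "0 < R"
  obtains K :: real where "0 < K"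
    "\<And>(\<mu> :: (complex ^ 'n) measure) C. borel_measure_ball \<mu> \<Longrightarrow> emb_bound R \<mu> C \<Longrightarrow>
      csup \<mu> R \<le> ennreal (K * C powr q)"
proof -
  obtain \<gamma> b B K where \<gamma>: "\<gamma> < real b" and B: "0 < B"
    "\<And>a :: complex ^ 'n. a \<in> unit_ball \<Longrightarrow> test_fun \<gamma> b a \<in> bspace \<and> bnorm (test_fun \<gamma> b a) \<le> B"
    and K: "0 < K" "\<And>\<mu> (a :: complex ^ 'n). borel_measure_ball \<mu> \<Longrightarrow> a \<in> unit_ball \<Longrightarrow>
      ratio \<mu> R a \<le> ennreal K * quot R \<mu> (test_fun \<gamma> b a) a"
    by (rule test_functions[OF R, where 'n='n]) (rule that; assumption)
  have "csup \<mu> R \<le> ennreal (K * B powr q * C powr q)"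
    if \<mu>: "borel_measure_ball \<mu>" and emb: "emb_bound R \<mu> C" for \<mu> :: "(complex ^ 'n) measure" and C
    unfolding carleson_sup_def
  proof (rule SUP_least)
    fix a :: "complex ^ 'n" assume a: "a \<in> unit_ball"
    let ?f = "test_fun \<gamma> b a"
    have f: "?f \<in> bspace" "bnorm ?f \<le> B" using B(2)[OF a] by auto
    have ten: "?f \<in> tent_space q s t R \<mu>" "tent_norm q s t R \<mu> ?f \<le> C * bnorm ?f" and C: "0 \<le> C"
      using emb f(1) by (auto simp: embedding_bound_def)
    have "tent_norm q s t R \<mu> ?f \<le> C * B"
      using ten(2) mult_left_mono[OF f(2) C] by linarith
    then have "tent_norm q s t R \<mu> ?f powr q \<le> (C * B) powr q"
      using q by (intro powr_mono2) (auto simp: tent_norm_def)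
    then have le: "tent_norm q s t R \<mu> ?f powr q \<le> C powr q * B powr q"
      using C B(1) by (simp add: powr_mult)
    have "ratio \<mu> R a \<le> ennreal K * tent_sup q s t R \<mu> ?f"
      by (intro order_trans[OF K(2)[OF \<mu> a]] mult_left_mono tent_quot_le_sup a) auto
    also have "\<dots> \<le> ennreal K * ennreal (C powr q * B powr q)"
      unfolding tent_sup_eq_tent_norm[OF ten(1) q] by (intro mult_left_mono ennreal_leI le) auto
    also have "\<dots> = ennreal (K * B powr q * C powr q)"
      using K(1) by (simp add: mult_ac flip: ennreal_mult)
    finally show "ratio \<mu> R a \<le> ennreal (K * B powr q * C powr q)" .
  qed
  moreover have "0 < K * B powr q" using K B by simp
  ultimately show ?thesis using that by blast
qed

lemma embedding_bounded_iff:
  fixes \<mu> :: "(complex ^ 'n) measure"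
  assumes R: "0 < R" and \<mu>: "borel_measure_ball \<mu>"
  shows "emb_bounded R \<mu> \<longleftrightarrow> csup \<mu> R < \<infinity>"
proof
  assume "emb_bounded R \<mu>"
  then show "csup \<mu> R < \<infinity>"
    unfolding embedding_bounded_def
    using carleson_if_embedding_bound[OF R, where 'n='n] \<mu>
    by (metis ennreal_less_top infinity_ennreal_def le_less_trans)
next
  assume "csup \<mu> R < \<infinity>"
  then show "emb_bounded R \<mu>"
    unfolding embedding_bounded_def
    using embedding_bound_if_carleson[OF R, where 'n='n] \<mu> by metis
qed

text \<open>The norm is an infimum over admissible bounds. It is estimated from above by exhibiting
  one bound, and from below because every bound satisfies the Carleson estimate obtained from the
  test functions.\<close>

lemma embedding_norm_comparable:
  assumes R: "0 < R"
  obtains C K :: real where "0 < C" "0 < K"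
    "\<And>\<mu> :: (complex ^ 'n) measure. borel_measure_ball \<mu> \<Longrightarrow> emb_bounded R \<mu> \<Longrightarrow>
      emb_norm R \<mu> powr q \<le> C * enn2real (csup \<mu> R) \<and>
      enn2real (csup \<mu> R) \<le> K * emb_norm R \<mu> powr q"
proof -
  obtain C :: real where C: "0 < C"
    "\<And>\<mu> :: (complex ^ 'n) measure. borel_measure_ball \<mu> \<Longrightarrow> csup \<mu> R < \<infinity> \<Longrightarrow>
      emb_bound R \<mu> ((C * enn2real (csup \<mu> R)) powr (1 / q))"
    using embedding_bound_if_carleson[OF R, where 'n='n] by auto
  obtain K :: real where K: "0 < K"
    "\<And>(\<mu> :: (complex ^ 'n) measure) C. borel_measure_ball \<mu> \<Longrightarrow> emb_bound R \<mu> C \<Longrightarrow>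
      csup \<mu> R \<le> ennreal (K * C powr q)"
    using carleson_if_embedding_bound[OF R, where 'n='n] by auto
  have "emb_norm R \<mu> powr q \<le> C * enn2real (csup \<mu> R) \<and>
      enn2real (csup \<mu> R) \<le> K * emb_norm R \<mu> powr q"
    if \<mu>: "borel_measure_ball \<mu>" and emb: "emb_bounded R \<mu>" for \<mu> :: "(complex ^ 'n) measure"
  proof
    define X where "X = enn2real (csup \<mu> R)"
    have X: "0 \<le> X" by (simp add: X_def)
    define S where "S = {C. emb_bound R \<mu> C}"
    have fin: "csup \<mu> R < \<infinity>"
      using embedding_bounded_iff[OF R \<mu>] emb by simp
    have S0: "S \<noteq> {}" using emb by (auto simp: S_def embedding_bounded_def)
    have nonneg: "0 \<le> c" if "c \<in> S" for c using that by (simp add: S_def embedding_bound_def)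
    have norm: "emb_norm R \<mu> = Inf S" by (simp add: embedding_norm_def S_def)
    have Inf0: "0 \<le> Inf S" using S0 nonneg by (intro cInf_greatest)
    have "(C * X) powr (1 / q) \<in> S" using C(2)[OF \<mu> fin] by (simp add: S_def X_def)
    then have "Inf S \<le> (C * X) powr (1 / q)" using nonneg by (intro cInf_lower bdd_belowI)
    then have "Inf S powr q \<le> ((C * X) powr (1 / q)) powr q" using Inf0 q by (intro powr_mono2) auto
    then show "emb_norm R \<mu> powr q \<le> C * enn2real (csup \<mu> R)"
      using q C(1) X by (simp add: norm powr_powr X_def)
    \<comment> \<open>The inequality is solved for the bound \<open>c\<close>, so that it passes to
      the infimum without assuming that it is attained.\<close>
    have "(X / K) powr (1 / q) \<le> Inf S"
    proof (rule cInf_greatest[OF S0])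
      fix c assume c: "c \<in> S"
      have "X \<le> K * c powr q"
        unfolding X_def using K c by (intro enn2real_leI K(2)[OF \<mu>]) (auto simp: S_def)
      then have "X / K \<le> c powr q" using K(1) by (simp add: field_simps)
      then have "(X / K) powr (1 / q) \<le> (c powr q) powr (1 / q)"
        using K(1) X q by (intro powr_mono2) auto
      then show "(X / K) powr (1 / q) \<le> c" using q nonneg[OF c] by (simp add: powr_powr)
    qed
    then have "((X / K) powr (1 / q)) powr q \<le> Inf S powr q" using q by (intro powr_mono2) auto
    then have "X / K \<le> Inf S powr q" using q K(1) X by (simp add: powr_powr)
    then show "enn2real (csup \<mu> R) \<le> K * emb_norm R \<mu> powr q"
      using K(1) by (simp add: norm X_def field_simps)
  qed
  with C(1) K(1) show ?thesis using that by blast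
qed

section \<open>Compactness of the embedding\<close>

lemma carleson_sup_finite_if_vanishing:
  fixes \<mu> :: "(complex ^ 'n) measure"
  assumes R: "0 < R" and \<mu>: "borel_measure_ball \<mu>" "locally_finite_ball \<mu>"
    and lim: "vanishing \<mu> R"
  shows "csup \<mu> R < \<infinity>"
proof -
  define S where "S = s + (real CARD('n) + 1 + \<alpha>) * q / p"
  \<comment> \<open>The limit controls only r < |a| < 1. For |a| \<le> r all Bergman balls lie in
    one compact ball, which has finite mass since \<mu> is locally finite, and the weights are
    bounded below.\<close>
  obtain r where r: "0 \<le> r" "r < 1"
    "\<And>a. r < norm a \<Longrightarrow> norm a < 1 \<Longrightarrow> ratio \<mu> R a \<le> ennreal 1"
    using lim unfolding carleson_vanishing_iff by (metis zero_less_one)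
  obtain r' where r': "0 \<le> r'" "r' < 1"
    "\<And>a :: complex ^ 'n. norm a \<le> r \<Longrightarrow> bergman_ball a R \<subseteq> cball 0 r'"
    using bergman_ball_subset_cball[OF R r(1,2), where 'n='n] by blast
  have "compact (cball (0 :: complex ^ 'n) r')" "cball (0 :: complex ^ 'n) r' \<subseteq> unit_ball"
    using r' by auto
  then have fin: "emeasure \<mu> (cball 0 r') < \<infinity>" using \<mu>(2) by (simp add: locally_finite_ball_def)
  have r2: "r\<^sup>2 < 1" using r by (simp add: power_less_one_iff)
  \<comment> \<open>For |a| \<le> r the defect lies between 1 / M and 1, so the weight at
    \<open>a\<close> is comparable with its value at defect 1.\<close>
  define M where "M = 1 / (1 - r\<^sup>2)"
  have M: "1 \<le> M" using r2 by (simp add: M_def field_simps)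
  define c where "c = M powr \<bar>S\<bar> * (1 + ln M / ln 2) powr \<bar>t\<bar>"
  have w1: "0 < log_weight S t 1" by (simp add: log_weight_pos)
  define B where "B = ennreal c * (emeasure \<mu> (cball 0 r') / ennreal (log_weight S t 1))"
  have "emeasure \<mu> (cball 0 r') / ennreal (log_weight S t 1) < \<infinity>"
    using fin w1 by (simp add: ennreal_divide_eq_times ennreal_mult_less_top)
  then have B: "B < \<infinity>" by (simp add: B_def ennreal_mult_less_top)
  have "ratio \<mu> R a \<le> max B (ennreal 1)" if a: "a \<in> unit_ball" for a :: "complex ^ 'n"
  proof (cases "norm a \<le> r")
    case True
    define \<delta> where "\<delta> = defect a"
    have \<delta>: "0 < \<delta>" "\<delta> \<le> 1" using one_minus_norm_sq_bounds[OF a] by (auto simp: \<delta>_def)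
    have "(norm a)\<^sup>2 \<le> r\<^sup>2" using True by (intro power_mono) auto
    then have "1 - r\<^sup>2 \<le> \<delta>" by (simp add: \<delta>_def)
    then have "1 \<le> M * \<delta>" using r2 by (simp add: M_def field_simps)
    then have w: "log_weight S t 1 \<le> c * log_weight S t \<delta>"
      unfolding c_def using \<delta> M by (intro log_weight_comparable) auto
    have "cball 0 r' \<in> sets \<mu>"
      using \<mu>(1) r' by (auto simp: borel_measure_ball_def sets_restrict_space_iff)
    then have "emeasure \<mu> (bergman_ball a R) \<le> emeasure \<mu> (cball 0 r')"
      using r'(3)[OF True] by (intro emeasure_mono)
    then have "ratio \<mu> R a \<le> B"
      unfolding carleson_ratio_eq B_def S_def[symmetric] \<delta>_def[symmetric]
      using \<delta> w1 w by (intro ennreal_divide_le_cmult log_weight_pos) auto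
    then show ?thesis by (simp add: le_max_iff_disj)
  next
    case False
    then show ?thesis using r(3)[of a] a by (simp add: le_max_iff_disj)
  qed
  then have "csup \<mu> R \<le> max B (ennreal 1)"
    unfolding carleson_sup_def by (rule SUP_least)
  also have "\<dots> < \<infinity>" using B by simp
  finally show ?thesis .
qed

text \<open>The supremum over \<open>a\<close> is split at |a| = r. Near the sphere the ratio is
  small and the norms are bounded; in the interior the functions are uniformly small and the ratio
  is bounded.\<close>

lemma embedding_compact_if_vanishing:
  fixes \<mu> :: "(complex ^ 'n) measure"
  assumes R: "0 < R"
    and \<mu>: "borel_measure_ball \<mu>" "locally_finite_ball \<mu>" and lim: "vanishing \<mu> R"
  shows "emb_compact R \<mu>"
  unfolding embedding_compact_def
proof (intro conjI allI impI)
  have fin: "csup \<mu> R < \<infinity>"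
    by (rule carleson_sup_finite_if_vanishing[OF R \<mu> lim])
  then show "emb_bounded R \<mu>"
    using embedding_bounded_iff[OF R \<mu>(1)] by simp
  define X where "X = enn2real (csup \<mu> R)"
  have X: "0 \<le> X" "csup \<mu> R = ennreal X" using fin by (simp_all add: X_def)
  fix f :: "nat \<Rightarrow> complex ^ 'n \<Rightarrow> complex"
  assume f: "(\<forall>k. f k \<in> bspace) \<and> (\<exists>M. \<forall>k. bnorm (f k) \<le> M) \<and>
    (\<forall>K. compact K \<and> K \<subseteq> unit_ball \<longrightarrow> uniform_limit K f (\<lambda>_. 0) sequentially)"
  then obtain M where M: "\<And>k. bnorm (f k) \<le> M" by blast
  have "0 \<le> M" using M[of 0] bergman_norm_nonneg[of p \<alpha> "f 0"] by linarith
  obtain C where C: "0 < C"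
    "\<And>\<mu> (f :: complex ^ 'n \<Rightarrow> complex) a. borel_measure_ball \<mu> \<Longrightarrow> f \<in> bspace \<Longrightarrow> a \<in> unit_ball \<Longrightarrow>
      quot R \<mu> f a \<le> ennreal (C * bnorm f powr q) * ratio \<mu> R a"
    using tent_quot_bergman_le[OF R, where 'n='n] by auto
  have small: "eventually (\<lambda>k. enn2real (tent_sup q s t R \<mu> (f k)) \<le> e) sequentially" if e: "0 < e" for e
  proof -
    \<comment> \<open>The bound allowed for the ratio near the sphere; the summand 1 makes the
      division safe when \<open>M = 0\<close>.\<close>
    define e1 where "e1 = e / (C * (M powr q + 1))"
    have pos: "0 < C * (M powr q + 1)" using C(1) by (simp add: add_nonneg_pos)
    have e1: "0 < e1" using e pos by (simp add: e1_def)
    obtain r where r: "0 \<le> r" "r < 1"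
      "\<And>a. r < norm a \<Longrightarrow> norm a < 1 \<Longrightarrow> ratio \<mu> R a \<le> ennreal e1"
      using lim e1 unfolding carleson_vanishing_iff by blast
    obtain r' where r': "0 \<le> r'" "r' < 1"
      "\<And>a :: complex ^ 'n. norm a \<le> r \<Longrightarrow> bergman_ball a R \<subseteq> cball 0 r'"
      using bergman_ball_subset_cball[OF R r(1,2), where 'n='n] by blast
    \<comment> \<open>The bound allowed for |f_k|^q on the compact ball, shrunk by the supremum
      \<open>X\<close> of the ratios and by the comparison of the logarithms.\<close>
    define e2 where "e2 = e / (2 powr \<bar>t\<bar> * (X + 1))"
    have e2: "0 < e2" using e X(1) by (simp add: e2_def add_nonneg_pos)
    have "compact (cball (0 :: complex ^ 'n) r')" "cball (0 :: complex ^ 'n) r' \<subseteq> unit_ball"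
      using r' by auto
    then have "uniform_limit (cball 0 r') f (\<lambda>_. 0) sequentially" using f by blast
    then have "eventually (\<lambda>k. \<forall>z\<in>cball 0 r'. dist (f k z) 0 < e2 powr (1 / q)) sequentially"
      using e2 by (intro uniform_limitD) auto
    then show ?thesis
    proof eventually_elim
      case (elim k)
      have "quot R \<mu> (f k) a \<le> ennreal e" if a: "a \<in> unit_ball" for a
      proof (cases "norm a \<le> r")
        case True
        have le: "norm (f k z) powr q \<le> e2" if z: "z \<in> bergman_ball a R" for z
        proof -
          have "norm (f k z) \<le> e2 powr (1 / q)" using elim r'(3)[OF True] z by force
          then have "norm (f k z) powr q \<le> (e2 powr (1 / q)) powr q" using q by (intro powr_mono2) auto
          then show ?thesis using q e2 by (simp add: powr_powr)
        qed
        let ?E = "(real CARD('n) + 1 + \<alpha>) * q / p"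
        have "defect a powr ?E \<le> 1 powr ?E"
          using one_minus_norm_sq_bounds[OF a] p q \<alpha> by (intro powr_mono2) auto
        then have E1: "defect a powr ?E \<le> 1" by simp
        have "quot R \<mu> (f k) a \<le>
            ennreal (2 powr \<bar>t\<bar> * e2 * defect a powr ?E) * ratio \<mu> R a"
          using e2 le by (intro tent_quot_le[OF \<mu>(1) a R]) auto
        also have "\<dots> \<le> ennreal (2 powr \<bar>t\<bar> * e2 * 1) * ennreal X"
          unfolding X(2)[symmetric] using e2
          by (intro mult_mono ennreal_leI mult_left_mono carleson_ratio_le_sup a E1) auto
        also have "\<dots> = ennreal (2 powr \<bar>t\<bar> * e2 * X)"
          using e2 X(1) by (simp flip: ennreal_mult)
        also have "\<dots> \<le> ennreal (2 powr \<bar>t\<bar> * e2 * (X + 1))"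
          using e2 by (intro ennreal_leI mult_left_mono) auto
        also have "2 powr \<bar>t\<bar> * e2 * (X + 1) = e" using X(1) by (simp add: e2_def)
        finally show ?thesis .
      next
        case False
        have "quot R \<mu> (f k) a \<le> ennreal (C * bnorm (f k) powr q) * ratio \<mu> R a"
          using f by (intro C(2) \<mu> a) auto
        also have "\<dots> \<le> ennreal (C * (M powr q + 1)) * ennreal e1"
        proof (intro mult_mono ennreal_leI mult_left_mono)
          have "bnorm (f k) powr q \<le> M powr q"
            using M q by (intro powr_mono2 bergman_norm_nonneg) auto
          then show "bnorm (f k) powr q \<le> M powr q + 1" by simp
          show "ratio \<mu> R a \<le> ennreal e1" using False a by (intro r(3)) auto
        qed (use C(1) in auto)
        also have "\<dots> = ennreal (C * (M powr q + 1) * e1)"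
          using pos e1 by (intro ennreal_mult[symmetric]) auto
        also have "C * (M powr q + 1) * e1 = e"
          by (metis e1_def less_irrefl nonzero_mult_div_cancel_left pos times_divide_eq_right)
        finally show ?thesis .
      qed
      then have "tent_sup q s t R \<mu> (f k) \<le> ennreal e" unfolding tent_sup_eq by (rule SUP_least)
      then show "enn2real (tent_sup q s t R \<mu> (f k)) \<le> e" using e by (intro enn2real_leI) auto
    qed
  qed
  have "(\<lambda>k. enn2real (tent_sup q s t R \<mu> (f k))) \<longlonglongrightarrow> 0"
  proof (rule tendstoI)
    fix e :: real assume "0 < e"
    then have "eventually (\<lambda>k. enn2real (tent_sup q s t R \<mu> (f k)) \<le> e / 2) sequentially"
      by (intro small) simp
    then show "eventually (\<lambda>k. dist (enn2real (tent_sup q s t R \<mu> (f k))) 0 < e) sequentially"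
      by eventually_elim (use \<open>0 < e\<close> in auto)
  qed
  then have "(\<lambda>k. enn2real (tent_sup q s t R \<mu> (f k)) powr (1 / q)) \<longlonglongrightarrow> 0 powr (1 / q)"
    using q by (intro tendsto_powr' tendsto_const) auto
  then show "(\<lambda>k. tent_norm q s t R \<mu> (f k)) \<longlonglongrightarrow> 0"
    by (simp add: tent_norm_def)
qed

text \<open>If the limit fails, the ratio exceeds some \<open>e\<close> at points \<open>a k\<close>
  approaching the sphere. The test functions at these points form a sequence admissible in the
  definition of compactness, so their tent norms tend to 0, but these norms dominate the
  ratios.\<close>

lemma vanishing_if_embedding_compact:
  fixes \<mu> :: "(complex ^ 'n) measure"
  assumes R: "0 < R"
    and \<mu>: "borel_measure_ball \<mu>" and comp: "emb_compact R \<mu>"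
  shows "vanishing \<mu> R"
proof (rule ccontr)
  assume "\<not> vanishing \<mu> R"
  then obtain e where e: "0 < e"
    "\<And>r. 0 \<le> r \<Longrightarrow> r < 1 \<Longrightarrow> \<exists>a. r < norm a \<and> norm a < 1 \<and> \<not> ratio \<mu> R a \<le> ennreal e"
    unfolding carleson_vanishing_iff by blast
  have "\<exists>a. 1 - 1 / real (Suc k) < norm a \<and> norm a < 1 \<and> \<not> ratio \<mu> R a \<le> ennreal e" for k
    by (rule e(2)) auto
  then obtain a where a: "\<And>k. 1 - 1 / real (Suc k) < norm (a k)" "\<And>k. norm (a k) < 1"
    "\<And>k. \<not> ratio \<mu> R (a k) \<le> ennreal e"
    by metis
  have ab: "a k \<in> unit_ball" for k using a(2) by simp
  have lim: "(\<lambda>k. norm (a k)) \<longlonglongrightarrow> 1"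
  proof (rule tendsto_sandwich)
    have "(\<lambda>k. 1 - 1 / real (Suc k)) \<longlonglongrightarrow> 1 - 0"
      by (intro tendsto_diff tendsto_const LIMSEQ_Suc[OF lim_1_over_n])
    then show "(\<lambda>k. 1 - 1 / real (Suc k)) \<longlonglongrightarrow> 1" by simp
    show "eventually (\<lambda>k. 1 - 1 / real (Suc k) \<le> norm (a k)) sequentially"
      by (intro always_eventually allI less_imp_le a(1))
    show "eventually (\<lambda>k. norm (a k) \<le> 1) sequentially"
      by (intro always_eventually allI less_imp_le a(2))
  qed (rule tendsto_const)
  obtain \<gamma> b B K where \<gamma>: "\<gamma> < real b" and B: "0 < B"
    "\<And>a :: complex ^ 'n. a \<in> unit_ball \<Longrightarrow> test_fun \<gamma> b a \<in> bspace \<and> bnorm (test_fun \<gamma> b a) \<le> B"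
    and K: "0 < K" "\<And>\<mu> (a :: complex ^ 'n). borel_measure_ball \<mu> \<Longrightarrow> a \<in> unit_ball \<Longrightarrow>
      ratio \<mu> R a \<le> ennreal K * quot R \<mu> (test_fun \<gamma> b a) a"
    by (rule test_functions[OF R, where 'n='n]) (rule that; assumption)
  define f where "f k = test_fun \<gamma> b (a k)" for k
  have f: "f k \<in> bspace" "bnorm (f k) \<le> B" for k
    using B(2)[OF ab] by (auto simp: f_def)
  have ul: "uniform_limit A f (\<lambda>_. 0) sequentially" if "compact A" "A \<subseteq> unit_ball" for A
    unfolding f_def[abs_def] using that
    by (intro test_fun_uniform_limit ab lim \<gamma>)
  have "\<forall>k. f k \<in> bspace" "\<exists>M. \<forall>k. bnorm (f k) \<le> M" using f by auto
  then have "(\<lambda>k. tent_norm q s t R \<mu> (f k)) \<longlonglongrightarrow> 0"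
    using comp ul unfolding embedding_compact_def by simp
  then have "(\<lambda>k. tent_norm q s t R \<mu> (f k) powr q) \<longlonglongrightarrow> 0 powr q"
    using q by (intro tendsto_powr' tendsto_const) (auto simp: tent_norm_def)
  then have "(\<lambda>k. K * tent_norm q s t R \<mu> (f k) powr q) \<longlonglongrightarrow> K * 0"
    by (intro tendsto_mult tendsto_const) simp
  then have "eventually (\<lambda>k. K * tent_norm q s t R \<mu> (f k) powr q < e) sequentially"
    using e(1) by (intro order_tendstoD) auto
  then obtain k where k: "K * tent_norm q s t R \<mu> (f k) powr q < e"
    by (auto simp: eventually_sequentially)
  \<comment> \<open>Membership guarantees a finite supremum. This is essential because
    \<open>enn2real\<close> turns an infinite one into 0, and the norm would then say
    nothing.\<close>
  have ten: "f k \<in> tent_space q s t R \<mu>"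
    using comp f(1)[of k] by (auto simp: embedding_compact_def embedding_bounded_def embedding_bound_def)
  have "ratio \<mu> R (a k) \<le> ennreal K * tent_sup q s t R \<mu> (f k)"
    unfolding f_def by (intro order_trans[OF K(2)[OF \<mu> ab]] mult_left_mono tent_quot_le_sup ab) auto
  also have "\<dots> = ennreal (K * tent_norm q s t R \<mu> (f k) powr q)"
    unfolding tent_sup_eq_tent_norm[OF ten q] using K(1) by (simp add: ennreal_mult)
  also have "\<dots> \<le> ennreal e" using k by (intro ennreal_leI) simp
  finally show False using a(3) by blast
qed

text \<open>The comparison at the radius \<open>R0\<close> is combined with a change of radius in
  each direction. Finiteness is carried along first, since the real values are meaningful only for
  finite suprema.\<close>

lemma embedding_norm_equivalent:
  assumes R0: "0 < R0" and R: "0 < R"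
  shows "\<exists>C>0. \<forall>\<mu> :: (complex ^ 'n) measure.
      borel_measure_ball \<mu> \<and> emb_bounded R0 \<mu> \<longrightarrow>
      1 / C * enn2real (csup \<mu> R) \<le> emb_norm R0 \<mu> powr q \<and>
      emb_norm R0 \<mu> powr q \<le> C * enn2real (csup \<mu> R)"
proof -
  obtain C K :: real where CK: "0 < C" "0 < K"
    "\<And>\<mu> :: (complex ^ 'n) measure. borel_measure_ball \<mu> \<Longrightarrow> emb_bounded R0 \<mu> \<Longrightarrow>
      emb_norm R0 \<mu> powr q \<le> C * enn2real (csup \<mu> R0) \<and>
      enn2real (csup \<mu> R0) \<le> K * emb_norm R0 \<mu> powr q"
    using embedding_norm_comparable[OF R0, where 'n='n] by blast
  obtain C1 :: real where C1: "0 < C1"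
    "\<And>\<mu> :: (complex ^ 'n) measure. borel_measure_ball \<mu> \<Longrightarrow> csup \<mu> R < \<infinity> \<Longrightarrow>
      csup \<mu> R0 < \<infinity> \<and> enn2real (csup \<mu> R0) \<le> C1 * enn2real (csup \<mu> R)"
    using carleson_sup_transfer[OF R0 R, where 'n='n] by auto
  obtain C2 :: real where C2: "0 < C2"
    "\<And>\<mu> :: (complex ^ 'n) measure. borel_measure_ball \<mu> \<Longrightarrow> csup \<mu> R0 < \<infinity> \<Longrightarrow>
      csup \<mu> R < \<infinity> \<and> enn2real (csup \<mu> R) \<le> C2 * enn2real (csup \<mu> R0)"
    using carleson_sup_transfer[OF R R0, where 'n='n] by auto
  define A where "A = C * C1 + C2 * K"
  have A: "0 < A" "C * C1 \<le> A" "C2 * K \<le> A" using CK C1 C2 by (auto simp: A_def add_pos_pos)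
  show ?thesis
  proof (intro exI[of _ A] conjI allI impI A(1))
    fix \<mu> :: "(complex ^ 'n) measure"
    assume "borel_measure_ball \<mu> \<and> emb_bounded R0 \<mu>"
    then have \<mu>: "borel_measure_ball \<mu>" and emb: "emb_bounded R0 \<mu>" by auto
    have fin0: "csup \<mu> R0 < \<infinity>" using embedding_bounded_iff[OF R0 \<mu>] emb by simp
    have fin: "csup \<mu> R < \<infinity>" using C2(2)[OF \<mu> fin0] by simp
    let ?n = "emb_norm R0 \<mu> powr q"
    let ?X = "enn2real (csup \<mu> R)" and ?Y = "enn2real (csup \<mu> R0)"
    have "?X \<le> C2 * ?Y" using C2(2)[OF \<mu> fin0] by simp
    also have "\<dots> \<le> C2 * (K * ?n)" using CK(3)[OF \<mu> emb] C2(1) by (intro mult_left_mono) auto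
    also have "\<dots> = (C2 * K) * ?n" by simp
    also have "\<dots> \<le> A * ?n" by (intro mult_right_mono A) auto
    finally show "1 / A * ?X \<le> ?n" using A(1) by (simp add: field_simps)
    have "?n \<le> C * ?Y" using CK(3)[OF \<mu> emb] by simp
    also have "\<dots> \<le> C * (C1 * ?X)" using C1(2)[OF \<mu> fin] CK(1) by (intro mult_left_mono) auto
    also have "\<dots> = (C * C1) * ?X" by simp
    also have "\<dots> \<le> A * ?X" by (intro mult_right_mono A) auto
    finally show "?n \<le> A * ?X" .
  qed
qed

end

theorem theorem3p3:
  fixes p q \<alpha> s t R0 :: real
  assumes "0 < p" and "0 < q" and "- 1 < \<alpha>" and "0 < R0"
  shows
    "(\<forall>\<mu> :: (complex ^ 'n) measure. borel_measure_ball \<mu> \<longrightarrow>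
        (embedding_bounded p \<alpha> q s t R0 \<mu> \<longleftrightarrow>
          (\<exists>R>0. (SUP a\<in>unit_ball. carleson_ratio p \<alpha> q s t \<mu> R a) < \<infinity>)) \<and>
        (embedding_bounded p \<alpha> q s t R0 \<mu> \<longleftrightarrow>
          (\<forall>R>0. (SUP a\<in>unit_ball. carleson_ratio p \<alpha> q s t \<mu> R a) < \<infinity>))) \<and>
     (\<forall>R>0. \<exists>C>0. \<forall>\<mu> :: (complex ^ 'n) measure.
        borel_measure_ball \<mu> \<and> embedding_bounded p \<alpha> q s t R0 \<mu> \<longrightarrow>
          1 / C * enn2real (SUP a\<in>unit_ball. carleson_ratio p \<alpha> q s t \<mu> R a)
            \<le> embedding_norm p \<alpha> q s t R0 \<mu> powr q \<and>
          embedding_norm p \<alpha> q s t R0 \<mu> powr q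
            \<le> C * enn2real (SUP a\<in>unit_ball. carleson_ratio p \<alpha> q s t \<mu> R a)) \<and>
     (\<forall>\<mu> :: (complex ^ 'n) measure. borel_measure_ball \<mu> \<and> locally_finite_ball \<mu> \<longrightarrow>
        (embedding_compact p \<alpha> q s t R0 \<mu> \<longleftrightarrow>
          (\<exists>R>0. (carleson_ratio p \<alpha> q s t \<mu> R \<longlongrightarrow> 0) (filtercomap norm (at_left 1)))) \<and>
        (embedding_compact p \<alpha> q s t R0 \<mu> \<longleftrightarrow>
          (\<forall>R>0. (carleson_ratio p \<alpha> q s t \<mu> R \<longlongrightarrow> 0) (filtercomap norm (at_left 1)))))"
  unfolding carleson_sup_def[symmetric] carleson_vanishing_def[symmetric]
proof (intro conjI allI impI)
  fix \<mu> :: "(complex ^ 'n) measure" assume \<mu>: "borel_measure_ball \<mu>"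
  note iff = embedding_bounded_iff[OF assms \<mu>, of s t]
  \<comment> \<open>Finiteness passes between any two radii, so the existential and the universal
    version both reduce to the condition at \<open>R0\<close>.\<close>
  have transfer: "carleson_sup p \<alpha> q s t \<mu> R < \<infinity>"
    if "0 < R" "0 < R'" "carleson_sup p \<alpha> q s t \<mu> R' < \<infinity>" for R R'
    using carleson_sup_transfer[OF assms(1-3) that(1,2), of s t, where 'n='n] \<mu> that(3) by metis
  show "embedding_bounded p \<alpha> q s t R0 \<mu> \<longleftrightarrow> (\<exists>R>0. carleson_sup p \<alpha> q s t \<mu> R < \<infinity>)"
    unfolding iff using transfer[OF assms(4)] assms(4) by blast
  show "embedding_bounded p \<alpha> q s t R0 \<mu> \<longleftrightarrow> (\<forall>R>0. carleson_sup p \<alpha> q s t \<mu> R < \<infinity>)"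
    unfolding iff using transfer[OF _ assms(4)] assms(4) by blast
next
  fix \<mu> :: "(complex ^ 'n) measure" assume "borel_measure_ball \<mu> \<and> locally_finite_ball \<mu>"
  then have \<mu>: "borel_measure_ball \<mu>" "locally_finite_ball \<mu>" by auto
  have iff: "embedding_compact p \<alpha> q s t R0 \<mu> \<longleftrightarrow> carleson_vanishing p \<alpha> q s t \<mu> R0"
    using embedding_compact_if_vanishing[OF assms \<mu>] vanishing_if_embedding_compact[OF assms \<mu>(1)] by blast
  note transfer = carleson_vanishing_transfer[OF assms(1-3) _ _ \<mu>(1)]
  show "embedding_compact p \<alpha> q s t R0 \<mu> \<longleftrightarrow> (\<exists>R>0. carleson_vanishing p \<alpha> q s t \<mu> R)"
    unfolding iff using transfer[OF assms(4)] assms(4) by blast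
  show "embedding_compact p \<alpha> q s t R0 \<mu> \<longleftrightarrow> (\<forall>R>0. carleson_vanishing p \<alpha> q s t \<mu> R)"
    unfolding iff using transfer[OF _ assms(4)] assms(4) by blast
qed (rule embedding_norm_equivalent[OF assms])

end
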